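(* The language $L_\mathrm{ENT} \cap L_\mathrm{PRE}$ is decidable in pseudo-polynomial time, where $L_\mathrm{ENT} = \{\langle\Sigma, A \Rightarrow B\rangle \mid \Sigma \text{ is a finite theory and } \Sigma \vdash A \Rightarrow B\}$ and $L_\mathrm{PRE} = \{\langle\Sigma, A \Rightarrow B\rangle \mid \Sigma \text{ is finite and } \Sigma \text{ and } A \Rightarrow B \text{ are predictive}\}$.
   Context: $Y$ is a fixed non-empty finite set of attributes and $\mathcal{T}_Y = \{y^i \mid y \in Y, i \in \mathbb{Z}\}$; $M + j = \{y^{i+j} \mid y^i \in M\}$. A formula is $A \Rightarrow B$ with $A,B$ finite subsets of $\mathcal{T}_Y$; a theory is a set of formulas; $\langle\Sigma, A \Rightarrow B\rangle$ is a standard encoding (time points as integers). A formula $A \Rightarrow B$ is predictive if $A \neq \emptyset$, $B \neq \emptyset$ and $i \leq j$ for all $x^i \in A$, $y^j \in B$; a theory is predictive if all its formulas are. Deduction rules (for finite $A,B,C,D \subseteq \mathcal{T}_Y$, $i \in \mathbb{Z}$): (Ax) infer $A \cup B \Rightarrow A$; (Cut) from $A \Rightarrow B$ and $B \cup C \Rightarrow D$ infer $A \cup C \Rightarrow D$; (Shf) from $A \Rightarrow B$ infer $A+i \Rightarrow B+i$; $\Sigma \vdash A \Rightarrow B$ means there is a finite sequence ending with $A \Rightarrow B$ each member of which is in $\Sigma$ or follows from earlier members by these rules. Pseudo-polynomial time means running time bounded by a polynomial in the size of the input and the magnitude of the numeric values (integers) occurring in it. *)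

theory Defs
  imports Main
begin

text \<open>Attributes form a finite nonempty type 'y; a time-stamped attribute y^i is a pair (y, i).
 A formula A \<Rightarrow> B is a pair of finite sets of such pairs.\<close>

type_synonym 'y tattr = "'y \<times> int"
type_synonym 'y fml = "'y tattr set \<times> 'y tattr set"

definition shift :: "int \<Rightarrow> 'y tattr set \<Rightarrow> 'y tattr set" where
  "shift j M = (\<lambda>(y, i). (y, i + j)) ` M"

definition is_fml :: "'y fml \<Rightarrow> bool" where
  "is_fml \<phi> \<longleftrightarrow> finite (fst \<phi>) \<and> finite (snd \<phi>)"

definition follows :: "'y fml set \<Rightarrow> 'y fml \<Rightarrow> bool" where
  "follows S \<phi> \<longleftrightarrow>
     (\<exists>A B. finite A \<and> finite B \<and> \<phi> = (A \<union> B, A))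
   \<or> (\<exists>A B C D. finite A \<and> finite B \<and> finite C \<and> finite D \<and>
        (A, B) \<in> S \<and> (B \<union> C, D) \<in> S \<and> \<phi> = (A \<union> C, D))
   \<or> (\<exists>A B i. finite A \<and> finite B \<and> (A, B) \<in> S \<and> \<phi> = (shift i A, shift i B))"

definition provable :: "'y fml set \<Rightarrow> 'y fml \<Rightarrow> bool" where
  "provable \<Sigma> \<phi> \<longleftrightarrow> (\<exists>ds. ds \<noteq> [] \<and> last ds = \<phi> \<and>
      (\<forall>k < length ds. ds ! k \<in> \<Sigma> \<or> follows (set (take k ds)) (ds ! k)))"

definition predictive :: "'y fml \<Rightarrow> bool" where
  "predictive \<phi> \<longleftrightarrow> fst \<phi> \<noteq> {} \<and> snd \<phi> \<noteq> {} \<and>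
     (\<forall>x i y j. (x, i) \<in> fst \<phi> \<longrightarrow> (y, j) \<in> snd \<phi> \<longrightarrow> i \<le> j)"

datatype 'y sym = Att 'y | Bit0 | Bit1 | Neg | Arrow | Semi

fun bin :: "nat \<Rightarrow> 'y sym list" where
  "bin n = (if n < 2 then [if n = 0 then Bit0 else Bit1]
            else bin (n div 2) @ [if n mod 2 = 0 then Bit0 else Bit1])"

definition enc_int :: "int \<Rightarrow> 'y sym list" where
  "enc_int i = (if i < 0 then [Neg] else []) @ bin (nat \<bar>i\<bar>)"

definition enc_term :: "'y tattr \<Rightarrow> 'y sym list" where
  "enc_term t = Att (fst t) # enc_int (snd t)"

definition enc_fml :: "'y tattr list \<times> 'y tattr list \<Rightarrow> 'y sym list" where
  "enc_fml f = concat (map enc_term (fst f)) @ [Arrow] @ concat (map enc_term (snd f))"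

text \<open>\<langle>\<Sigma>, A \<Rightarrow> B\<rangle>: the formulas of \<Sigma> (each terminated by Semi), then the query formula.
 Finite sets are written as lists of their elements (any listing).\<close>
definition enc_input :: "('y tattr list \<times> 'y tattr list) list \<Rightarrow> 'y tattr list \<times> 'y tattr list \<Rightarrow> 'y sym list" where
  "enc_input \<Sigma>s f = concat (map (\<lambda>g. enc_fml g @ [Semi]) \<Sigma>s) @ enc_fml f"

definition fml_of :: "'y tattr list \<times> 'y tattr list \<Rightarrow> 'y fml" where
  "fml_of f = (set (fst f), set (snd f))"

definition L_ENT :: "'y sym list set" where
  "L_ENT = {enc_input \<Sigma>s f | \<Sigma>s f. provable (fml_of ` set \<Sigma>s) (fml_of f)}"

definition L_PRE :: "'y sym list set" where
  "L_PRE = {enc_input \<Sigma>s f | \<Sigma>s f.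
              (\<forall>g \<in> set \<Sigma>s. predictive (fml_of g)) \<and> predictive (fml_of f)}"

fun bin_val :: "'y sym list \<Rightarrow> nat" where
  "bin_val [] = 0"
| "bin_val (s # ds) = (if s = Bit1 then 1 else 0) * 2 ^ length ds + bin_val ds"

definition magnitude :: "'y sym list \<Rightarrow> nat" where
  "magnitude w = Max ({0} \<union> {bin_val ds | ds u v. w = u @ ds @ v \<and> set ds \<subseteq> {Bit0, Bit1}})"

text \<open>Tape alphabet: input symbols plus blank (None). States 0..<nQ, start 0,
 accepting state 1, rejecting state 2 (both halting).\<close>

datatype dir = Lft | Rgt | Stay

record 'y tm =
  nQ :: nat
  delta :: "nat \<Rightarrow> 'y sym option \<Rightarrow> nat \<times> 'y sym option \<times> dir"

definition valid_tm :: "'y tm \<Rightarrow> bool" where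
  "valid_tm M \<longleftrightarrow> 3 \<le> nQ M \<and> (\<forall>q s. q < nQ M \<longrightarrow> fst (delta M q s) < nQ M)"

type_synonym 'y config = "nat \<times> int \<times> (int \<Rightarrow> 'y sym option)"

definition dir_off :: "dir \<Rightarrow> int" where
  "dir_off d = (case d of Lft \<Rightarrow> -1 | Rgt \<Rightarrow> 1 | Stay \<Rightarrow> 0)"

definition step :: "'y tm \<Rightarrow> 'y config \<Rightarrow> 'y config" where
  "step M c = (case c of (q, h, tp) \<Rightarrow>
     if q = 1 \<or> q = 2 then c
     else (case delta M q (tp h) of (q', s', d) \<Rightarrow> (q', h + dir_off d, tp(h := s'))))"

definition init_config :: "'y sym list \<Rightarrow> 'y config" where
  "init_config w = (0, 0, \<lambda>i. if 0 \<le> i \<and> i < int (length w) then Some (w ! nat i) else None)"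

definition run :: "'y tm \<Rightarrow> nat \<Rightarrow> 'y sym list \<Rightarrow> 'y config" where
  "run M t w = (step M ^^ t) (init_config w)"

definition decides_within :: "'y tm \<Rightarrow> 'y sym list set \<Rightarrow> ('y sym list \<Rightarrow> nat) \<Rightarrow> bool" where
  "decides_within M L T \<longleftrightarrow> (\<forall>w. \<exists>t \<le> T w.
      (fst (run M t w) = 1 \<and> w \<in> L) \<or> (fst (run M t w) = 2 \<and> w \<notin> L))"

definition pseudo_poly_decidable :: "'y sym list set \<Rightarrow> bool" where
  "pseudo_poly_decidable L \<longleftrightarrow> (\<exists>M c k. valid_tm M \<and>
      decides_within M L (\<lambda>w. c * (length w + magnitude w + 1) ^ k))"

end

theory Submission
  imports Defs
begin

text \<open>
  By soundness and completeness of the rules for closure under shifted formulas, \<open>A \<Rightarrow> B\<close> is provable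
  from \<open>\<Sigma>\<close> iff forward chaining from \<open>A\<close> reaches \<open>B\<close>. In the predictive case a premise is never later
  than a conclusion, so only time points between \<open>- N\<close> and \<open>N\<close> matter, where \<open>N\<close> bounds the integers
  in the input. Hence a number of rounds linear in \<open>N\<close>, each trying every shift between \<open>- 2 * N\<close> and
  \<open>2 * N\<close>, suffices.

  This procedure is carried over to a Turing machine in two steps. A loop language works on Boolean
  timelines with a common head; the integers are first rewritten in unary, as head movements, which is
  affordable because the time may depend on the magnitude. Its programs become programs over finitely
  many stacks, and these run on a tape that holds the stacks one after the other, separated by blanks.
  In this layout the initial tape already is the input followed by empty stacks.
\<close>

section \<open>Polynomial bounds\<close>

text \<open>Deciding the language includes rejecting every string that is not an encoding, so a
  finite automaton checks the syntax first. Unique readability then makes the separate existential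
  definitions of \<open>L_ENT\<close> and \<open>L_PRE\<close> speak of the same theory and query.

  The bounds come from predictivity. A premise that lies in the window from -N to N after a shift
  was moved by at most 2 * N, since its own time point is bounded by N. Predictive formulas have a
  premise, so every useful shift is limited in this way, and a conclusion, being no earlier than
  that premise, does not fall below -N. A round that changes the window fills at least one of its
  |Y| * (2 * N + 1) cells.

  The machine never computes a maximum: N is the total length of the unary strings, which dominates
  every integer of the input and is polynomial in length plus magnitude. Copies of that length drive
  the loops. As N is positive, 2 * N + 1 is at most 3 * N, so 3 * |Y| loops of N rounds suffice, and
  the factor 3 * |Y| is a constant of the program.\<close>

definition poly_bounded :: "(nat \<Rightarrow> nat) \<Rightarrow> bool" where
  "poly_bounded f \<longleftrightarrow> (\<exists>C k. \<forall>x. f x \<le> C * (x + 1) ^ k)"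

lemma poly_bounded_mono: "poly_bounded g \<Longrightarrow> (\<And>x. f x \<le> g x) \<Longrightarrow> poly_bounded f"
  unfolding poly_bounded_def by (meson le_trans)

lemma poly_bounded_const: "poly_bounded (\<lambda>_. c)"
  unfolding poly_bounded_def by (rule exI[of _ c], rule exI[of _ 0]) simp

lemma poly_bounded_ident: "poly_bounded (\<lambda>x. x)"
  unfolding poly_bounded_def by (rule exI[of _ 1], rule exI[of _ 1]) simp

lemma poly_bounded_add:
  assumes "poly_bounded f" "poly_bounded g" shows "poly_bounded (\<lambda>x. f x + g x)"
proof -
  obtain C k D m where f: "\<And>x. f x \<le> C * (x + 1) ^ k" and g: "\<And>x. g x \<le> D * (x + 1) ^ m"
    using assms unfolding poly_bounded_def by blast
  have "f x + g x \<le> (C + D) * (x + 1) ^ (k + m)" for x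
  proof -
    have "(x + 1) ^ k \<le> (x + 1) ^ (k + m)" "(x + 1) ^ m \<le> (x + 1) ^ (k + m)"
      by (rule power_increasing; simp)+
    then have "C * (x + 1) ^ k \<le> C * (x + 1) ^ (k + m)" "D * (x + 1) ^ m \<le> D * (x + 1) ^ (k + m)"
      by (simp_all add: mult_left_mono)
    then show ?thesis using f[of x] g[of x] by (simp only: add_mult_distrib)
  qed
  then show ?thesis unfolding poly_bounded_def by blast
qed

lemma poly_bounded_mult:
  assumes "poly_bounded f" "poly_bounded g" shows "poly_bounded (\<lambda>x. f x * g x)"
proof -
  obtain C k D m where f: "\<And>x. f x \<le> C * (x + 1) ^ k" and g: "\<And>x. g x \<le> D * (x + 1) ^ m"
    using assms unfolding poly_bounded_def by blast
  have "f x * g x \<le> (C * D) * (x + 1) ^ (k + m)" for x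
    using mult_le_mono[OF f[of x] g[of x]] by (simp add: power_add ac_simps)
  then show ?thesis unfolding poly_bounded_def by blast
qed

lemma poly_bounded_power: "poly_bounded f \<Longrightarrow> poly_bounded (\<lambda>x. f x ^ n)"
  by (induction n) (auto intro: poly_bounded_const[of 1, simplified] poly_bounded_mult poly_bounded_const)

text \<open>Loop programs are timed in the length of the unary strings, which is itself only
  polynomial in the size of the input; \<open>poly_bounded_driver_time\<close> composes the two
  bounds.\<close>

lemma poly_bounded_compose:
  assumes "poly_bounded f" "poly_bounded g" shows "poly_bounded (\<lambda>x. f (g x))"
proof -
  obtain C k where f: "\<And>x. f x \<le> C * (x + 1) ^ k"
    using assms unfolding poly_bounded_def by blast
  have "poly_bounded (\<lambda>x. C * (g x + 1) ^ k)"
    by (intro poly_bounded_mult poly_bounded_power poly_bounded_add poly_bounded_const assms)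
  then show ?thesis using f by (rule poly_bounded_mono)
qed

lemma poly_bounded_sum:
  "finite A \<Longrightarrow> (\<And>i. i \<in> A \<Longrightarrow> poly_bounded (f i)) \<Longrightarrow> poly_bounded (\<lambda>x. \<Sum>i\<in>A. f i x)"
  by (induction A rule: finite_induct) (auto intro: poly_bounded_const poly_bounded_add)

lemmas poly_bounded_intros = poly_bounded_const poly_bounded_ident poly_bounded_add
  poly_bounded_mult poly_bounded_power

section \<open>Machines over an arbitrary finite state set\<close>

text \<open>Programs branch over symbols and the tape controller carries one in hand, so its state
  set is finite only because the alphabet is.\<close>

instance sym :: (finite) finite
proof
  have "(UNIV :: 'a sym set) \<subseteq> range Att \<union> {Bit0, Bit1, Neg, Arrow, Semi}"
  proof
    fix x :: "'a sym"
    show "x \<in> range Att \<union> {Bit0, Bit1, Neg, Arrow, Semi}" by (cases x) simp_all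
  qed
  then show "finite (UNIV :: 'a sym set)" by (rule finite_subset) simp
qed

type_synonym 'y tape = "int \<Rightarrow> 'y sym option"

text \<open>Unlike \<open>step\<close> it has no distinguished halting states. Halting is expressed
  by states that the transition function leaves fixed.\<close>

definition gstep :: "('s \<Rightarrow> 'y sym option \<Rightarrow> 's \<times> 'y sym option \<times> dir) \<Rightarrow>
    's \<times> int \<times> 'y tape \<Rightarrow> 's \<times> int \<times> 'y tape" where
  "gstep \<delta> c = (case c of (q, h, tp) \<Rightarrow>
     case \<delta> q (tp h) of (q', s', d) \<Rightarrow> (q', h + dir_off d, tp(h := s')))"

lemma tm_of_gstep:
  fixes \<delta> :: "'s \<Rightarrow> 'y sym option \<Rightarrow> 's \<times> 'y sym option \<times> dir"
  assumes fin: "finite S" and S: "s0 \<in> S" "acc \<in> S" "rej \<in> S" and dist: "distinct [s0, acc, rej]"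
    and closed: "\<And>s x. s \<in> S \<Longrightarrow> fst (\<delta> s x) \<in> S"
    and halt: "\<And>x. \<delta> acc x = (acc, x, Stay)" "\<And>x. \<delta> rej x = (rej, x, Stay)"
  obtains M where "valid_tm M"
    "\<And>w t. fst ((gstep \<delta> ^^ t) (s0, snd (init_config w))) = acc \<Longrightarrow> fst (run M t w) = 1"
    "\<And>w t. fst ((gstep \<delta> ^^ t) (s0, snd (init_config w))) = rej \<Longrightarrow> fst (run M t w) = 2"
proof -
  obtain xs where xs: "set xs = S - {s0, acc, rej}" "distinct xs"
    using finite_distinct_list[of "S - {s0, acc, rej}"] fin by auto
  define ys where "ys = s0 # acc # rej # xs"
  have dys: "distinct ys" and sys: "set ys = S" using xs dist S by (auto simp: ys_def)
  define f where "f s = (THE i. i < length ys \<and> ys ! i = s)" for s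
  have f_nth: "f (ys ! i) = i" if "i < length ys" for i
    unfolding f_def using that dys by (intro the_equality) (auto simp: nth_eq_iff_index_eq)
  have f: "f s < length ys \<and> ys ! f s = s" if "s \<in> S" for s
  proof -
    obtain i where "i < length ys" "ys ! i = s" using \<open>s \<in> S\<close> sys by (metis in_set_conv_nth)
    then show ?thesis using f_nth by auto
  qed
  define M where "M = \<lparr>nQ = length ys,
     delta = \<lambda>q x. case \<delta> (ys ! q) x of (s', x', d) \<Rightarrow> (f s', x', d)\<rparr>"
  have valid: "valid_tm M"
    unfolding valid_tm_def
  proof (intro conjI allI impI)
    show "3 \<le> nQ M" by (simp add: M_def ys_def)
    fix q and s :: "'y sym option" assume "q < nQ M"
    then have "ys ! q \<in> S" using sys by (auto simp: M_def)
    then show "fst (delta M q s) < nQ M"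
      using closed[of "ys ! q" s] f by (auto simp: M_def split: prod.splits)
  qed
  have f0: "f s0 = 0" "f acc = 1" "f rej = 2"
    using f_nth[of 0] f_nth[of 1] f_nth[of 2] by (auto simp: ys_def)
  have sim: "\<exists>s. s \<in> S \<and> (gstep \<delta> ^^ t) (s0, snd (init_config w)) = (s, snd (run M t w))
      \<and> fst (run M t w) = f s" for t w
  proof (induction t)
    case 0
    show ?case using S f0 by (simp add: run_def init_config_def)
  next
    case (Suc t)
    then obtain s where s: "s \<in> S" "(gstep \<delta> ^^ t) (s0, snd (init_config w)) = (s, snd (run M t w))"
      "fst (run M t w) = f s" by blast
    obtain q h tp where c: "run M t w = (q, h, tp)" by (rule prod_cases3)
    have q: "q = f s" using s(3) c by simp
    have run: "run M (Suc t) w = step M (q, h, tp)" using c by (simp add: run_def)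
    have g: "(gstep \<delta> ^^ Suc t) (s0, snd (init_config w)) = gstep \<delta> (s, h, tp)" using s(2) c by simp
    show ?case
    proof (cases "s = acc \<or> s = rej")
      case True
      then have "q = 1 \<or> q = 2" using f0 q by auto
      then have "run M (Suc t) w = (q, h, tp)" using run by (simp add: step_def)
      moreover have "gstep \<delta> (s, h, tp) = (s, h, tp)"
        using True halt by (auto simp: gstep_def dir_off_def)
      ultimately show ?thesis using g s(1) q by auto
    next
      case False
      have "q \<noteq> 1" using f[OF s(1)] f[OF S(2)] f0 q False by metis
      moreover have "q \<noteq> 2" using f[OF s(1)] f[OF S(3)] f0 q False by metis
      moreover have "ys ! q = s" using f[OF s(1)] q by simp
      moreover obtain s' x' d where \<delta>: "\<delta> s (tp h) = (s', x', d)" by (rule prod_cases3)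
      ultimately have "run M (Suc t) w = (f s', h + dir_off d, tp(h := x'))"
        unfolding run by (simp add: step_def M_def)
      moreover have "(gstep \<delta> ^^ Suc t) (s0, snd (init_config w)) = (s', h + dir_off d, tp(h := x'))"
        unfolding g by (simp add: gstep_def \<delta>)
      moreover have "s' \<in> S" using closed[OF s(1), of "tp h"] \<delta> by simp
      ultimately show ?thesis by simp
    qed
  qed
  show thesis
  proof (rule that[OF valid])
    fix w t
    obtain s where "(gstep \<delta> ^^ t) (s0, snd (init_config w)) = (s, snd (run M t w))"
      "fst (run M t w) = f s" using sim by blast
    then show "fst ((gstep \<delta> ^^ t) (s0, snd (init_config w))) = acc \<Longrightarrow> fst (run M t w) = 1"
      "fst ((gstep \<delta> ^^ t) (s0, snd (init_config w))) = rej \<Longrightarrow> fst (run M t w) = 2"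
      using f0 by simp_all
  qed
qed

section \<open>Stack programs\<close>

text \<open>Branches are functions of the symbol read, so over a finite alphabet a program is a
  finite tree. \<open>Drain\<close> is the only loop; it goes on until its stack is empty, including
  whatever its body pushes there.\<close>

datatype ('v, 'a) com = Skip | Halt bool | Push 'v 'a | Seq "('v, 'a) com" "('v, 'a) com" (infixr ";;" 60)
  | Pop 'v "'a option \<Rightarrow> ('v, 'a) com" | Drain 'v "'a \<Rightarrow> ('v, 'a) com"

datatype ('k, 'v, 'a) instr = IHalt bool | IGoto 'k | IPush 'v 'a 'k | IPop 'v "'a option \<Rightarrow> 'k"

text \<open>A control point is the list of programs still to be executed. A loop reappears in this
  list instead of being unfolded, which is why finitely many lists suffice. Falling off the end
  counts as rejection.\<close>

fun next_instr :: "('v, 'a) com list \<Rightarrow> (('v, 'a) com list, 'v, 'a) instr" where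
  "next_instr [] = IHalt False"
| "next_instr (Skip # K) = IGoto K"
| "next_instr (Halt b # K) = IHalt b"
| "next_instr (Push v a # K) = IPush v a K"
| "next_instr ((c1 ;; c2) # K) = IGoto (c1 # c2 # K)"
| "next_instr (Pop v f # K) = IPop v (\<lambda>x. f x # K)"
| "next_instr (Drain v f # K) = IPop v (\<lambda>x. case x of None \<Rightarrow> K | Some a \<Rightarrow> f a # Drain v f # K)"

definition hd_option :: "'a list \<Rightarrow> 'a option" where
  "hd_option xs = (case xs of [] \<Rightarrow> None | x # _ \<Rightarrow> Some x)"

lemma hd_option_simps [simp]: "hd_option [] = None" "hd_option (x # xs) = Some x"
  by (simp_all add: hd_option_def)

definition sstep :: "('v, 'a) com list \<times> ('v \<Rightarrow> 'a list) \<Rightarrow> ('v, 'a) com list \<times> ('v \<Rightarrow> 'a list)" where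
  "sstep c = (case c of (K, \<sigma>) \<Rightarrow> case next_instr K of
     IHalt b \<Rightarrow> (K, \<sigma>)
   | IGoto K' \<Rightarrow> (K', \<sigma>)
   | IPush v a K' \<Rightarrow> (K', \<sigma>(v := a # \<sigma> v))
   | IPop v f \<Rightarrow> (f (hd_option (\<sigma> v)), \<sigma>(v := tl (\<sigma> v))))"

fun succs :: "('k, 'v, 'a) instr \<Rightarrow> 'k set" where
  "succs (IHalt b) = {}"
| "succs (IGoto k) = {k}"
| "succs (IPush v a k) = {k}"
| "succs (IPop v f) = range f"

fun ivars :: "('k, 'v, 'a) instr \<Rightarrow> 'v set" where
  "ivars (IPush v a k) = {v}"
| "ivars (IPop v f) = {v}"
| "ivars _ = {}"

text \<open>Contains all control points that occur while \<open>c\<close> is executed in front of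
  \<open>K\<close>, except for the exit \<open>K\<close>. By \<open>finite_conts\<close> and
  \<open>conts_closed\<close> they can serve as states of a finite control.\<close>

primrec conts :: "('v, 'a) com \<Rightarrow> ('v, 'a) com list \<Rightarrow> ('v, 'a) com list set" where
  "conts Skip K = {Skip # K}"
| "conts (Halt b) K = {Halt b # K}"
| "conts (Push v a) K = {Push v a # K}"
| "conts (c1 ;; c2) K = insert ((c1 ;; c2) # K) (conts c1 (c2 # K) \<union> conts c2 K)"
| "conts (Pop v f) K = insert (Pop v f # K) (\<Union>x. conts (f x) K)"
| "conts (Drain v f) K = insert (Drain v f # K) (\<Union>a. conts (f a) (Drain v f # K))"

lemma finite_conts: "finite (conts (c :: ('v, 'a::finite) com) K)"
  by (induction c arbitrary: K) auto

lemma conts_self: "c # K \<in> conts c K"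
  by (cases c) auto

lemma conts_closed: "k \<in> conts c K \<Longrightarrow> succs (next_instr k) \<subseteq> insert K (conts c K)"
proof (induction c arbitrary: K)
  case (Seq c1 c2)
  from Seq.prems consider "k = (c1 ;; c2) # K" | "k \<in> conts c1 (c2 # K)" | "k \<in> conts c2 K" by auto
  then show ?case
  proof cases
    case 1
    then show ?thesis using conts_self[of c1 "c2 # K"] by simp
  next
    case 2
    then show ?thesis using Seq.IH(1)[OF 2] conts_self[of c2 K] by (simp only: conts.simps, blast)
  next
    case 3
    then show ?thesis using Seq.IH(2)[OF 3] by (simp only: conts.simps, blast)
  qed
next
  case (Pop v f)
  from Pop.prems consider "k = Pop v f # K" | x where "k \<in> conts (f x) K" by auto
  then show ?case
  proof cases
    case 1
    have "f x # K \<in> conts (Pop v f) K" for x using conts_self[of "f x" K] by (simp only: conts.simps, blast)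
    then show ?thesis by (simp only: 1 next_instr.simps succs.simps) blast
  next
    case 2
    then have "conts (f x) K \<subseteq> conts (Pop v f) K" by auto
    then show ?thesis using Pop.IH[OF rangeI 2] by blast
  qed
next
  case (Drain v f)
  from Drain.prems consider "k = Drain v f # K" | a where "k \<in> conts (f a) (Drain v f # K)" by auto
  then show ?case
  proof cases
    case 1
    have "f a # Drain v f # K \<in> conts (Drain v f) K" for a
      using conts_self[of "f a" "Drain v f # K"] by (simp only: conts.simps) blast
    then have "(case x of None \<Rightarrow> K | Some a \<Rightarrow> f a # Drain v f # K)
        \<in> insert K (conts (Drain v f) K)" for x by (cases x) (simp_all only: option.case insertI1 insertI2)
    then show ?thesis by (simp only: 1 next_instr.simps succs.simps) blast
  next
    case 2
    have "Drain v f # K \<in> conts (Drain v f) K" by simp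
    moreover have "conts (f a) (Drain v f # K) \<subseteq> conts (Drain v f) K" by auto
    ultimately show ?thesis using Drain.IH[OF rangeI 2] by blast
  qed
qed auto

section \<open>Stacks on a tape\<close>

text \<open>A zipper at the boundary \<open>h\<close>: \<open>l\<close> is read leftwards from
  \<open>h - 1\<close>, \<open>r\<close> rightwards from \<open>h\<close>, and all other cells are
  blank. The head may be on either side of the boundary.\<close>

definition tape :: "int \<Rightarrow> 'y sym option list \<Rightarrow> 'y sym option list \<Rightarrow> 'y tape" where
  "tape h l r = (\<lambda>i. if h \<le> i then (if nat (i - h) < length r then r ! nat (i - h) else None)
                    else if nat (h - 1 - i) < length l then l ! nat (h - 1 - i) else None)"

lemma tape_read [simp]: "tape h l (x # r) h = x" "tape h (x # l) r (h - 1) = x"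
  by (simp_all add: tape_def)

lemma tape_write [simp]: "(tape h l (x # r))(h := y) = tape h l (y # r)"
    "(tape h (x # l) r)(h - 1 := y) = tape h (y # l) r"
  by (rule ext, simp add: tape_def nth_Cons')+

lemma tape_shift: "tape (h + 1) (x # l) r = tape h l (x # r)"
proof
  fix i
  consider "i = h" | "h < i" | "i < h" by linarith
  then show "tape (h + 1) (x # l) r i = tape h l (x # r) i"
  proof cases
    case 2
    then have "nat (i - h) = Suc (nat (i - (h + 1)))" by simp
    with 2 show ?thesis by (simp add: tape_def)
  next
    case 3
    then have "nat (h - i) = Suc (nat (h - 1 - i))" by simp
    with 3 show ?thesis by (simp add: tape_def)
  qed (simp add: tape_def)
qed

text \<open>Everything left of the first stack is blank, so one blank may be made explicit there: it
  is the delimiter at which the leftward walks stop.\<close>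

lemma tape_pad [simp]: "tape h (l @ [None]) r = tape h l r"
  by (rule ext) (simp add: tape_def nth_append)

text \<open>The head rests on the first cell of the first stack. To push, \<open>Ins\<close> moves everything before the
  new symbol one cell to the left; after a pop, \<open>Carry\<close> closes the gap by moving everything before it
  one cell to the right. Numbers count the separating blanks still to be passed.\<close>

datatype ('k, 'y) ctl = Acc | Rej | Main 'k | Seek nat 'k | Ins "'y sym option" nat 'k
  | Back nat 'k "nat option" | Carry "'y sym option" nat nat 'k

abbreviation dec_if :: "'y sym option \<Rightarrow> nat \<Rightarrow> nat" where
  "dec_if x j \<equiv> (if x = None then j - 1 else j)"

text \<open>Leftward walks end at a blank met with counter zero, which is the one in front of the
  first stack. The last argument of \<open>Back\<close> tells whether the gap left by a pop has
  still to be closed. As only cells before the change are moved, the position of the first stack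
  drifts while everything to the right stays in place.\<close>

fun ctl_step :: "('k \<Rightarrow> ('k, 'v, 'y sym) instr) \<Rightarrow> ('v \<Rightarrow> nat) \<Rightarrow>
    ('k, 'y) ctl \<Rightarrow> 'y sym option \<Rightarrow> ('k, 'y) ctl \<times> 'y sym option \<times> dir" where
  "ctl_step ins ix Acc x = (Acc, x, Stay)"
| "ctl_step ins ix Rej x = (Rej, x, Stay)"
| "ctl_step ins ix (Main k) x = ((case ins k of
      IHalt b \<Rightarrow> if b then Acc else Rej
    | IGoto k' \<Rightarrow> Main k'
    | IPush v a k' \<Rightarrow> Seek (ix v) k
    | IPop v f \<Rightarrow> Seek (ix v) k), x, Stay)"
| "ctl_step ins ix (Seek j k) x = (if j = 0 then (case ins k of
      IPush v a k' \<Rightarrow> (Ins (Some a) (ix v) k', x, Lft)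
    | IPop v f \<Rightarrow> (Back (ix v) (f x) (if x = None then None else Some (ix v)), x, Lft)
    | _ \<Rightarrow> (Rej, x, Stay))
    else (Seek (dec_if x j) k, x, Rgt))"
| "ctl_step ins ix (Ins c j k) x =
    (if x = None \<and> j = 0 then (Main k, c, Stay) else (Ins x (dec_if x j) k, c, Lft))"
| "ctl_step ins ix (Back j k m) x =
    (if x = None \<and> j = 0 then (case m of None \<Rightarrow> Main k | Some i \<Rightarrow> Carry None i i k, x, Rgt)
     else (Back (dec_if x j) k m, x, Lft))"
| "ctl_step ins ix (Carry c j i k) x =
    (if j = 0 then (Back i k None, c, Stay) else (Carry x (dec_if x j) i k, c, Rgt))"

definition ctl_states :: "'k set \<Rightarrow> nat \<Rightarrow> ('k, 'y) ctl set" where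
  "ctl_states Ks n = {Acc, Rej} \<union> Main ` Ks \<union> (\<lambda>(j, k). Seek j k) ` ({..n} \<times> Ks) \<union>
     (\<lambda>(c, j, k). Ins c j k) ` (UNIV \<times> {..n} \<times> Ks) \<union>
     (\<lambda>(j, k, m). Back j k m) ` ({..n} \<times> Ks \<times> insert None (Some ` {..n})) \<union>
     (\<lambda>(c, j, i, k). Carry c j i k) ` (UNIV \<times> {..n} \<times> {..n} \<times> Ks)"

lemma finite_ctl_states: "finite Ks \<Longrightarrow> finite (ctl_states Ks n :: ('k, 'y::finite) ctl set)"
  by (simp add: ctl_states_def)

lemma ctl_states_iff [simp]:
  "Acc \<in> ctl_states Ks n" "Rej \<in> ctl_states Ks n"
  "Main k \<in> ctl_states Ks n \<longleftrightarrow> k \<in> Ks"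
  "Seek j k \<in> ctl_states Ks n \<longleftrightarrow> k \<in> Ks \<and> j \<le> n"
  "Ins c j k \<in> ctl_states Ks n \<longleftrightarrow> k \<in> Ks \<and> j \<le> n"
  "Back j k m \<in> ctl_states Ks n \<longleftrightarrow> k \<in> Ks \<and> j \<le> n \<and> m \<in> insert None (Some ` {..n})"
  "Carry c j i k \<in> ctl_states Ks n \<longleftrightarrow> k \<in> Ks \<and> j \<le> n \<and> i \<le> n"
  by (auto simp: ctl_states_def image_iff)

lemma ctl_closed:
  assumes "\<And>k. k \<in> Ks \<Longrightarrow> succs (ins k) \<subseteq> Ks" "\<And>v. ix v \<le> n" "s \<in> ctl_states Ks n"
  shows "fst (ctl_step ins ix s x) \<in> ctl_states Ks n"
proof (cases s)
  case (Main k)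
  then show ?thesis using assms(1)[of k] assms(2,3) by (cases "ins k") auto
next
  case (Seek j k)
  then show ?thesis using assms(1)[of k] assms(2,3) by (cases "ins k") auto
next
  case (Back j k m)
  then show ?thesis using assms(2,3) by (cases m) auto
qed (use assms in auto)

abbreviation nones :: "'y sym option list \<Rightarrow> nat" where
  "nones u \<equiv> length (filter (\<lambda>x. x = None) u)"

lemma nones_pos: "u \<noteq> [] \<Longrightarrow> last u = None \<Longrightarrow> nones u > 0"
  by (simp only: length_greater_0_conv filter_empty_conv) (metis last_in_set)

text \<open>A nonempty \<open>u\<close> ends in a blank, so the counter reaches zero exactly at the
  end of \<open>u\<close> and not earlier.\<close>

lemma seek_run:
  assumes "u \<noteq> [] \<Longrightarrow> last u = None"
  shows "(gstep (ctl_step ins ix) ^^ length u) (Seek (nones u) k, h, tape h l (u @ r)) =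
    (Seek 0 k, h + int (length u), tape (h + int (length u)) (rev u @ l) r)"
  using assms
proof (induction u arbitrary: h l)
  case (Cons x u)
  have "gstep (ctl_step ins ix) (Seek (nones (x # u)) k, h, tape h l ((x # u) @ r)) =
      (Seek (nones u) k, h + 1, tape (h + 1) (x # l) (u @ r))"
    using nones_pos[OF _ Cons.prems] by (auto simp: gstep_def dir_off_def tape_shift)
  then show ?case using Cons.IH[of "h + 1" "x # l"] Cons.prems
    by (auto simp: funpow_Suc_right add.assoc simp del: funpow.simps split: if_splits)
qed simp

lemma carry_run:
  assumes "u \<noteq> [] \<Longrightarrow> last u = None"
  shows "(gstep (ctl_step ins ix) ^^ length u) (Carry c (nones u) i k, h, tape h l (u @ r)) =
    (Carry (last (c # u)) 0 i k, h + int (length u),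
     tape (h + int (length u)) (rev (butlast (c # u)) @ l) r)"
  using assms
proof (induction u arbitrary: h l c)
  case (Cons x u)
  have "gstep (ctl_step ins ix) (Carry c (nones (x # u)) i k, h, tape h l ((x # u) @ r)) =
      (Carry x (nones u) i k, h + 1, tape (h + 1) (c # l) (u @ r))"
    using nones_pos[OF _ Cons.prems] by (auto simp: gstep_def dir_off_def tape_shift)
  then show ?case using Cons.IH[of x "h + 1" "c # l"] Cons.prems
    by (auto simp: funpow_Suc_right add.assoc simp del: funpow.simps split: if_splits)
qed simp

lemma ins_run:
  "(gstep (ctl_step ins ix) ^^ Suc (length u)) (Ins c (nones u) k, h - 1, tape h (u @ None # l) r) =
    (Main k, h - 1 - int (length u), tape (h - 1 - int (length u)) l (rev u @ c # r))"
proof (induction u arbitrary: h c r)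
  case Nil
  then show ?case using tape_shift[of "h - 1" c l r] by (simp add: gstep_def dir_off_def)
next
  case (Cons x u)
  have "gstep (ctl_step ins ix) (Ins c (nones (x # u)) k, h - 1, tape h ((x # u) @ None # l) r) =
      (Ins x (nones u) k, h - 1 - 1, tape (h - 1) (u @ None # l) (c # r))"
    using tape_shift[of "h - 1" c "u @ None # l" r] by (auto simp: gstep_def dir_off_def)
  then show ?case using Cons.IH[of x "h - 1" "c # r"]
    by (simp add: funpow_Suc_right algebra_simps del: funpow.simps)
qed

lemma back_run:
  "(gstep (ctl_step ins ix) ^^ Suc (length u)) (Back (nones u) k m, h - 1, tape h (u @ None # l) r) =
    (case m of None \<Rightarrow> Main k | Some i \<Rightarrow> Carry None i i k, h - int (length u),
     tape (h - int (length u)) (None # l) (rev u @ r))"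
proof (induction u arbitrary: h r)
  case Nil
  then show ?case by (simp add: gstep_def dir_off_def)
next
  case (Cons x u)
  have "gstep (ctl_step ins ix) (Back (nones (x # u)) k m, h - 1, tape h ((x # u) @ None # l) r) =
      (Back (nones u) k m, h - 1 - 1, tape (h - 1) (u @ None # l) (x # r))"
    using tape_shift[of "h - 1" x "u @ None # l" r] by (auto simp: gstep_def dir_off_def)
  then show ?case using Cons.IH[of "h - 1" "x # r"]
    by (simp add: funpow_Suc_right algebra_simps del: funpow.simps)
qed


section \<open>Simulation of single stack instructions on the tape\<close>

definition layout :: "'v list \<Rightarrow> ('v \<Rightarrow> 'y sym list) \<Rightarrow> 'y sym option list" where
  "layout vs \<sigma> = concat (map (\<lambda>v. map Some (\<sigma> v) @ [None]) vs)"

lemma layout_simps [simp]: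
  "layout [] \<sigma> = []" "layout (v # vs) \<sigma> = map Some (\<sigma> v) @ None # layout vs \<sigma>"
  "layout (vs @ us) \<sigma> = layout vs \<sigma> @ layout us \<sigma>"
  by (simp_all add: layout_def)

lemma layout_upd [simp]: "v \<notin> set vs \<Longrightarrow> layout vs (\<sigma>(v := xs)) = layout vs \<sigma>"
  by (induction vs) auto

lemma nones_layout [simp]: "nones (layout vs \<sigma>) = length vs"
  by (induction vs) (simp_all add: filter_map comp_def)

lemma nones_rev: "nones (rev u) = nones u"
  by (simp add: rev_filter[symmetric])

lemma last_layout: "layout vs \<sigma> \<noteq> [] \<Longrightarrow> last (layout vs \<sigma>) = None"
  by (induction vs) auto

lemma funpow_trans: "(f ^^ m) x = y \<Longrightarrow> (f ^^ n) y = z \<Longrightarrow> (f ^^ (m + n)) x = z"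
  by (simp add: funpow_add add.commute[of m n])

lemma funpow_first: "f x = y \<Longrightarrow> (f ^^ n) y = z \<Longrightarrow> (f ^^ Suc n) x = z"
  by (simp add: funpow_swap1)

context
  fixes ins :: "'k \<Rightarrow> ('k, 'v, 'y sym) instr" and ix :: "'v \<Rightarrow> nat"
    and xs zs :: "'v list" and v :: 'v
  assumes v: "v \<notin> set xs" "v \<notin> set zs" and ix: "ix v = length xs"
begin

lemma push_run:
  assumes "ins k = IPush v a k'"
  shows "(gstep (ctl_step ins ix) ^^ (2 * length (layout xs \<sigma>) + 3))
      (Main k, h, tape h [] (layout (xs @ v # zs) \<sigma>)) =
    (Main k', h - 1, tape (h - 1) [] (layout (xs @ v # zs) (\<sigma>(v := a # \<sigma> v))))"
proof -
  let ?P = "layout xs \<sigma>" and ?R = "layout (v # zs) \<sigma>" and ?g = "gstep (ctl_step ins ix)"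
  let ?h = "h + int (length ?P)"
  have 1: "?g (Main k, h, tape h [] (?P @ ?R)) = (Seek (nones ?P) k, h, tape h [] (?P @ ?R))"
    by (cases "?P @ ?R") (auto simp: gstep_def dir_off_def assms ix)
  have 2: "(?g ^^ length ?P) (Seek (nones ?P) k, h, tape h [] (?P @ ?R)) =
      (Seek 0 k, ?h, tape ?h (rev ?P) ?R)"
    using seek_run[of ?P ins ix k h "[]" ?R] last_layout by auto
  obtain x R where R: "?R = x # R" by (cases ?R) auto
  have 3: "?g (Seek 0 k, ?h, tape ?h (rev ?P) ?R) =
      (Ins (Some a) (nones (rev ?P)) k', ?h - 1, tape ?h (rev ?P @ None # []) ?R)"
    unfolding R by (simp add: gstep_def dir_off_def assms ix nones_rev)
  have 4: "(?g ^^ Suc (length (rev ?P)))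
      (Ins (Some a) (nones (rev ?P)) k', ?h - 1, tape ?h (rev ?P @ None # []) ?R) =
      (Main k', h - 1, tape (h - 1) [] (?P @ Some a # ?R))"
    unfolding ins_run by simp
  show ?thesis
    using funpow_first[OF 1 funpow_trans[OF 2 funpow_first[OF 3 4]]] v
    by (simp add: mult_2 numeral_3_eq_3)
qed

lemma pop_None_run:
  assumes "ins k = IPop v f" "\<sigma> v = []"
  shows "(gstep (ctl_step ins ix) ^^ (2 * length (layout xs \<sigma>) + 3))
      (Main k, h, tape h [] (layout (xs @ v # zs) \<sigma>)) =
    (Main (f None), h, tape h [] (layout (xs @ v # zs) \<sigma>))"
proof -
  let ?P = "layout xs \<sigma>" and ?R = "layout (v # zs) \<sigma>" and ?g = "gstep (ctl_step ins ix)"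
  let ?h = "h + int (length ?P)"
  have 1: "?g (Main k, h, tape h [] (?P @ ?R)) = (Seek (nones ?P) k, h, tape h [] (?P @ ?R))"
    by (cases "?P @ ?R") (auto simp: gstep_def dir_off_def assms ix)
  have 2: "(?g ^^ length ?P) (Seek (nones ?P) k, h, tape h [] (?P @ ?R)) =
      (Seek 0 k, ?h, tape ?h (rev ?P) ?R)"
    using seek_run[of ?P ins ix k h "[]" ?R] last_layout by auto
  have 3: "?g (Seek 0 k, ?h, tape ?h (rev ?P) ?R) =
      (Back (nones (rev ?P)) (f None) None, ?h - 1, tape ?h (rev ?P @ None # []) ?R)"
    by (simp add: gstep_def dir_off_def assms ix nones_rev)
  have 4: "(?g ^^ Suc (length (rev ?P)))
      (Back (nones (rev ?P)) (f None) None, ?h - 1, tape ?h (rev ?P @ None # []) ?R) =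
      (Main (f None), h, tape h [] (?P @ ?R))"
    unfolding back_run using tape_pad[of h "[]"] by simp
  show ?thesis
    using funpow_first[OF 1 funpow_trans[OF 2 funpow_first[OF 3 4]]] v
    by (simp add: mult_2 numeral_3_eq_3)
qed

lemma pop_Some_run:
  assumes "ins k = IPop v f" "\<sigma> v = a # as"
  shows "(gstep (ctl_step ins ix) ^^ (4 * length (layout xs \<sigma>) + 5))
      (Main k, h, tape h [] (layout (xs @ v # zs) \<sigma>)) =
    (Main (f (Some a)), h + 1, tape (h + 1) [] (layout (xs @ v # zs) (\<sigma>(v := as))))"
proof -
  let ?P = "layout xs \<sigma>" and ?g = "gstep (ctl_step ins ix)"
  let ?R' = "map Some as @ None # layout zs \<sigma>"
  let ?R = "Some a # ?R'"
  let ?h = "h + int (length ?P)" and ?k = "f (Some a)" and ?i = "length xs"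
  have 1: "?g (Main k, h, tape h [] (?P @ ?R)) = (Seek (nones ?P) k, h, tape h [] (?P @ ?R))"
    by (cases "?P @ ?R") (auto simp: gstep_def dir_off_def assms ix)
  have 2: "(?g ^^ length ?P) (Seek (nones ?P) k, h, tape h [] (?P @ ?R)) =
      (Seek 0 k, ?h, tape ?h (rev ?P) ?R)"
    using seek_run[of ?P ins ix k h "[]" ?R] last_layout by auto
  have 3: "?g (Seek 0 k, ?h, tape ?h (rev ?P) ?R) =
      (Back (nones (rev ?P)) ?k (Some ?i), ?h - 1, tape ?h (rev ?P @ None # []) ?R)"
    by (simp add: gstep_def dir_off_def assms ix nones_rev)
  have 4: "(?g ^^ Suc (length (rev ?P)))
      (Back (nones (rev ?P)) ?k (Some ?i), ?h - 1, tape ?h (rev ?P @ None # []) ?R) =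
      (Carry None (nones ?P) ?i ?k, h, tape h [] (?P @ ?R))"
    unfolding back_run using tape_pad[of h "[]"] by simp
  \<comment> \<open>Either the final separator of \<open>?P\<close> or, if \<open>?P\<close> is
    empty, the blank with which \<open>Carry\<close> starts; \<open>None # ?P\<close> covers both
    cases.\<close>
  have last: "last (None # ?P) = None" using last_layout[of xs \<sigma>] by auto
  have 5: "(?g ^^ length ?P) (Carry None (nones ?P) ?i ?k, h, tape h [] (?P @ ?R)) =
      (Carry None 0 ?i ?k, ?h, tape ?h (rev (butlast (None # ?P))) ?R)"
    using carry_run[of ?P ins ix None ?i ?k h "[]" ?R] last_layout last by auto
  \<comment> \<open>Writing the blank in hand over the popped symbol completes the copy of
    \<open>?P\<close> one cell further right, with the initial blank now in front of it.\<close>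
  have "tape ?h (rev (butlast (None # ?P))) (None # ?R') =
      tape (?h + 1) (None # rev (butlast (None # ?P))) ?R'"
    by (simp add: tape_shift)
  also have "None # rev (butlast (None # ?P)) = rev (butlast (None # ?P) @ [last (None # ?P)])"
    using last by simp
  also have "\<dots> = rev ?P @ None # []"
    by (subst append_butlast_last_id) auto
  finally have 6: "?g (Carry None 0 ?i ?k, ?h, tape ?h (rev (butlast (None # ?P))) ?R) =
      (Back (nones (rev ?P)) ?k None, ?h + 1 - 1, tape (?h + 1) (rev ?P @ None # []) ?R')"
    by (simp add: gstep_def dir_off_def nones_rev)
  have 7: "(?g ^^ Suc (length (rev ?P)))
      (Back (nones (rev ?P)) ?k None, ?h + 1 - 1, tape (?h + 1) (rev ?P @ None # []) ?R') =
      (Main ?k, h + 1, tape (h + 1) [] (?P @ ?R'))"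
    unfolding back_run using tape_pad[of "h + 1" "[]"] by simp
  have "layout (xs @ v # zs) \<sigma> = ?P @ ?R" using assms by simp
  moreover have "layout (xs @ v # zs) (\<sigma>(v := as)) = ?P @ ?R'" using v by simp
  moreover have "4 * length ?P + 5 = Suc (length ?P + Suc (Suc (length (rev ?P)) +
      (length ?P + Suc (Suc (length (rev ?P))))))" by simp
  ultimately show ?thesis
    using funpow_first[OF 1 funpow_trans[OF 2 funpow_first[OF 3 funpow_trans[OF 4
      funpow_trans[OF 5 funpow_first[OF 6 7]]]]]] by (simp only:)
qed

end

definition index :: "'v list \<Rightarrow> 'v \<Rightarrow> nat" where
  "index vs v = length (takeWhile (\<lambda>u. u \<noteq> v) vs)"

lemma index_le: "index vs v \<le> length vs"
  by (simp add: index_def length_takeWhile_le)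

lemma sstep_run:
  assumes vs: "distinct vs" "ivars (next_instr K) \<subseteq> set vs"
    and halt: "\<And>b. next_instr K \<noteq> IHalt b" and step: "sstep (K, \<sigma>) = (K', \<sigma>')"
  shows "\<exists>t\<le>4 * length (layout vs \<sigma>) + 5. \<exists>h'.
    (gstep (ctl_step next_instr (index vs)) ^^ t) (Main K, h, tape h [] (layout vs \<sigma>)) =
      (Main K', h', tape h' [] (layout vs \<sigma>'))"
    (is "\<exists>t\<le>?b. \<exists>h'. ?run t h'")
proof -
  have split: "\<exists>xs zs. vs = xs @ v # zs \<and> v \<notin> set xs \<and> v \<notin> set zs \<and> index vs v = length xs"
    if v: "v \<in> set vs" for v
  proof -
    obtain xs zs where "vs = xs @ v # zs" "v \<notin> set xs" using split_list_first[of v vs] v by blast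
    then show ?thesis using vs(1) by (auto simp: index_def takeWhile_append)
  qed
  show ?thesis
  proof (cases "next_instr K")
    case (IHalt b)
    then show ?thesis using halt by simp
  next
    case (IGoto k)
    have "?run 1 h"
      using step by (cases "layout vs \<sigma>") (auto simp: gstep_def dir_off_def sstep_def IGoto tape_def)
    then show ?thesis by (intro exI[of _ 1]) auto
  next
    case (IPush v a k)
    then obtain xs zs where xs: "vs = xs @ v # zs" "v \<notin> set xs" "v \<notin> set zs" "index vs v = length xs"
      using split[of v] vs(2) by (metis insert_subset ivars.simps(1))
    have "K' = k" "\<sigma>' = \<sigma>(v := a # \<sigma> v)" using step by (auto simp: sstep_def IPush)
    then have "?run (2 * length (layout xs \<sigma>) + 3) (h - 1)"
      using push_run[of v xs zs "index vs" next_instr K a k \<sigma> h] xs IPush by simp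
    then show ?thesis using xs(1) by (intro exI[of _ "2 * length (layout xs \<sigma>) + 3"]) auto
  next
    case (IPop v f)
    then obtain xs zs where xs: "vs = xs @ v # zs" "v \<notin> set xs" "v \<notin> set zs" "index vs v = length xs"
      using split[of v] vs(2) by (metis insert_subset ivars.simps(2))
    have K': "K' = f (hd_option (\<sigma> v))" "\<sigma>' = \<sigma>(v := tl (\<sigma> v))" using step by (auto simp: sstep_def IPop)
    show ?thesis
    proof (cases "\<sigma> v")
      case Nil
      then have "\<sigma>' = \<sigma>" using K' by auto
      then have "?run (2 * length (layout xs \<sigma>) + 3) h"
        using pop_None_run[of v xs zs "index vs" next_instr K f \<sigma> h] xs IPop K' Nil by simp
      then show ?thesis using xs(1) by (intro exI[of _ "2 * length (layout xs \<sigma>) + 3"]) auto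
    next
      case (Cons a as)
      then have "?run (4 * length (layout xs \<sigma>) + 5) (h + 1)"
        using pop_Some_run[of v xs zs "index vs" next_instr K f \<sigma> a as h] xs IPop K' by simp
      then show ?thesis using xs(1) by (intro exI[of _ "4 * length (layout xs \<sigma>) + 5"]) auto
    qed
  qed
qed

lemma length_layout_upd:
  assumes "length xs \<le> Suc (length (\<sigma> v))" "distinct vs"
  shows "length (layout vs (\<sigma>(v := xs))) \<le> Suc (length (layout vs \<sigma>))"
  using assms(2)
proof (induction vs)
  case (Cons u vs)
  show ?case
  proof (cases "u = v")
    case True
    then have "layout vs (\<sigma>(v := xs)) = layout vs \<sigma>" using Cons.prems by simp
    then show ?thesis using True assms(1) by (simp del: fun_upd_apply layout_upd add: fun_upd_same)
  qed (use Cons in simp)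
qed simp

lemma length_layout_sstep:
  assumes "sstep (K, \<sigma>) = (K', \<sigma>')" "distinct vs"
  shows "length (layout vs \<sigma>') \<le> Suc (length (layout vs \<sigma>))"
proof (cases "next_instr K")
  case (IPush v a k)
  then show ?thesis using assms length_layout_upd[of "a # \<sigma> v" \<sigma> v vs] by (auto simp: sstep_def)
next
  case (IPop v f)
  then show ?thesis using assms length_layout_upd[of "tl (\<sigma> v)" \<sigma> v vs] by (auto simp: sstep_def)
qed (use assms in \<open>auto simp: sstep_def\<close>)

text \<open>A stack instruction costs time linear in the length of the layout and lengthens it by at
  most one cell. Hence \<open>t\<close> instructions cost at most
  \<open>t * (4 * (length w + n + t) + 5)\<close> steps, and polynomial bounds survive.\<close>

theorem com_decidable:
  fixes c :: "('v, ('y::finite) sym) com"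
  assumes "poly_bounded \<tau>"
    and run: "\<And>w. \<exists>t\<le>\<tau> (length w + magnitude w). \<exists>b K \<sigma>.
      (sstep ^^ t) ([c], (\<lambda>_. [])(inp := w)) = (Halt b # K, \<sigma>) \<and> (b \<longleftrightarrow> w \<in> L)"
  shows "pseudo_poly_decidable L"
proof -
  \<comment> \<open>\<open>[]\<close> is added because \<open>conts\<close> omits the exit
    continuation.\<close>
  define Ks where "Ks = insert [] (conts c [])"
  have Ks: "finite Ks" "[c] \<in> Ks" "\<And>K. K \<in> Ks \<Longrightarrow> succs (next_instr K) \<subseteq> Ks"
    using conts_closed[of _ c "[]"] conts_self[of c "[]"] by (auto simp: Ks_def finite_conts)
  have "finite (ivars i)" for i :: "(('v, 'y sym) com list, 'v, 'y sym) instr"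
    by (cases i) auto
  then have "finite (\<Union>K\<in>Ks. ivars (next_instr K))" using Ks(1) by blast
  then obtain us where us: "set us = (\<Union>K\<in>Ks. ivars (next_instr K)) - {inp}" "distinct us"
    using finite_distinct_list[of "(\<Union>K\<in>Ks. ivars (next_instr K)) - {inp}"] by auto
  \<comment> \<open>The head starts on the first input symbol and must rest on the first stack,
    hence \<open>inp\<close> comes first.\<close>
  define vs where "vs = inp # us"
  have vs: "distinct vs" "\<And>K. K \<in> Ks \<Longrightarrow> ivars (next_instr K) \<subseteq> set vs"
    using us by (auto simp: vs_def)
  define \<delta> where "\<delta> = ctl_step (next_instr :: ('v, 'y sym) com list \<Rightarrow> _) (index vs)"
  define S where "S = (ctl_states Ks (length vs) :: (('v, 'y sym) com list, 'y) ctl set)"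
  have closed: "fst (\<delta> s x) \<in> S" if "s \<in> S" for s x
    using ctl_closed[of Ks next_instr "index vs" "length vs" s x] Ks(3) index_le[of vs] that
    by (auto simp: S_def \<delta>_def)
  obtain M where M: "valid_tm M"
    "\<And>w t. fst ((gstep \<delta> ^^ t) (Main [c], snd (init_config w))) = Acc \<Longrightarrow> fst (run M t w) = 1"
    "\<And>w t. fst ((gstep \<delta> ^^ t) (Main [c], snd (init_config w))) = Rej \<Longrightarrow> fst (run M t w) = 2"
    by (rule tm_of_gstep[of S "Main [c]" Acc Rej \<delta>])
      (use Ks closed in \<open>auto simp: S_def finite_ctl_states \<delta>_def\<close>)
  define n where "n = length vs"
  define \<sigma>0 where "\<sigma>0 w = (\<lambda>_. [])(inp := w)" for w :: "'y sym list"
  have init: "snd (init_config w) = (0, tape 0 [] (layout vs (\<sigma>0 w)))" for w :: "'y sym list"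
  proof -
    have "inp \<notin> set us" using us by simp
    then have "layout us (\<sigma>0 w) = layout us (\<lambda>_. [])" by (simp add: \<sigma>0_def)
    also have "\<dots> = replicate (length us) None" by (induction us) auto
    finally have "layout vs (\<sigma>0 w) = map Some w @ replicate (Suc (length us)) None"
      by (simp add: vs_def \<sigma>0_def)
    then show ?thesis
      by (auto simp: init_config_def tape_def nth_append fun_eq_iff nth_Cons')
  qed
  have len0: "length (layout vs (\<sigma>0 w)) = length w + n" for w :: "'y sym list"
  proof -
    have "inp \<notin> set us" using us by simp
    then have "layout us (\<sigma>0 w) = layout us (\<lambda>_. [])" by (simp add: \<sigma>0_def)
    also have "\<dots> = replicate (length us) None" by (induction us) auto
    finally show ?thesis by (simp add: vs_def \<sigma>0_def n_def)
  qed
  have sim: "\<exists>t'\<le>t * (4 * (length w + n + t) + 5). \<exists>h K \<sigma>. K \<in> Ks \<and>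
      (sstep ^^ t) ([c], \<sigma>0 w) = (K, \<sigma>) \<and> length (layout vs \<sigma>) \<le> length w + n + t \<and>
      (gstep \<delta> ^^ t') (Main [c], snd (init_config w)) = (Main K, h, tape h [] (layout vs \<sigma>))"
    for t and w :: "'y sym list"
  proof (induction t)
    case 0
    then show ?case using Ks(2) by (auto simp: init len0)
  next
    case (Suc t)
    then obtain t' h K \<sigma> where IH: "t' \<le> t * (4 * (length w + n + t) + 5)" "K \<in> Ks"
      "(sstep ^^ t) ([c], \<sigma>0 w) = (K, \<sigma>)" "length (layout vs \<sigma>) \<le> length w + n + t"
      "(gstep \<delta> ^^ t') (Main [c], snd (init_config w)) = (Main K, h, tape h [] (layout vs \<sigma>))"
      by blast
    obtain K' \<sigma>' where step: "sstep (K, \<sigma>) = (K', \<sigma>')" by (cases "sstep (K, \<sigma>)")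
    have st: "(sstep ^^ Suc t) ([c], \<sigma>0 w) = (K', \<sigma>')" using IH(3) step by simp
    have len: "length (layout vs \<sigma>') \<le> length w + n + Suc t"
      using length_layout_sstep[OF step vs(1)] IH(4) by simp
    have bound: "t' + m \<le> Suc t * (4 * (length w + n + Suc t) + 5)"
      if "m \<le> 4 * length (layout vs \<sigma>) + 5" for m
    proof -
      have "t' + m \<le> Suc t * (4 * (length w + n + t) + 5)" using IH(1,4) that by simp
      also have "\<dots> \<le> Suc t * (4 * (length w + n + Suc t) + 5)" by (rule mult_le_mono2) simp
      finally show ?thesis .
    qed
    show ?case
    proof (cases "\<exists>b. next_instr K = IHalt b")
      case True
      then have "K' = K" "\<sigma>' = \<sigma>" using step by (auto simp: sstep_def)
      then show ?thesis using st len bound[of 0] IH(2,5) by auto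
    next
      case False
      then obtain m h' where m: "m \<le> 4 * length (layout vs \<sigma>) + 5"
        "(gstep \<delta> ^^ m) (Main K, h, tape h [] (layout vs \<sigma>)) = (Main K', h', tape h' [] (layout vs \<sigma>'))"
        using sstep_run[OF vs(1) vs(2)[OF IH(2)] _ step, of h] unfolding \<delta>_def by blast
      have "K' \<in> Ks"
        using step Ks(3)[OF IH(2)] False by (cases "next_instr K") (auto simp: sstep_def)
      then show ?thesis using st len bound[OF m(1)] funpow_trans[OF IH(5) m(2)] by blast
    qed
  qed
  \<comment> \<open>The summand 1 pays for the last move, from \<open>Halt\<close> into the
    accepting or rejecting state.\<close>
  define T where "T x = \<tau> x * (4 * (x + n + \<tau> x) + 5) + 1" for x
  have "poly_bounded T"
    unfolding T_def by (intro poly_bounded_intros assms(1))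
  then obtain C k where C: "\<And>x. T x \<le> C * (x + 1) ^ k" unfolding poly_bounded_def by blast
  have "decides_within M L (\<lambda>w. C * (length w + magnitude w + 1) ^ k)"
    unfolding decides_within_def
  proof
    fix w :: "'y sym list"
    let ?x = "length w + magnitude w"
    obtain t b K \<sigma> where t: "t \<le> \<tau> ?x" "(sstep ^^ t) ([c], \<sigma>0 w) = (Halt b # K, \<sigma>)" "b \<longleftrightarrow> w \<in> L"
      using run[of w] unfolding \<sigma>0_def by blast
    obtain t' h where t': "t' \<le> t * (4 * (length w + n + t) + 5)"
      "(gstep \<delta> ^^ t') (Main [c], snd (init_config w)) = (Main (Halt b # K), h, tape h [] (layout vs \<sigma>))"
      using sim[of t w] t(2) by auto
    have "fst (gstep \<delta> (Main (Halt b # K), h, tape h [] (layout vs \<sigma>))) = (if b then Acc else Rej)"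
      by (simp add: gstep_def \<delta>_def)
    then have "fst ((gstep \<delta> ^^ Suc t') (Main [c], snd (init_config w))) = (if b then Acc else Rej)"
      using t'(2) by simp
    then have "(fst (run M (Suc t') w) = 1 \<and> w \<in> L) \<or> (fst (run M (Suc t') w) = 2 \<and> w \<notin> L)"
      using M(2,3)[of "Suc t'" w] t(3) by (cases b) auto
    moreover have "t * (4 * (length w + n + t) + 5) \<le> \<tau> ?x * (4 * (?x + n + \<tau> ?x) + 5)"
      using t(1) by (intro mult_le_mono) auto
    then have "Suc t' \<le> T ?x" using t'(1) unfolding T_def by simp
    ultimately show "\<exists>t\<le>C * (?x + 1) ^ k.
        (fst (run M t w) = 1 \<and> w \<in> L) \<or> (fst (run M t w) = 2 \<and> w \<notin> L)"
      using C[of ?x] le_trans by blast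
  qed
  then show ?thesis using M(1) unfolding pseudo_poly_decidable_def by blast
qed

section \<open>Timed execution of stack programs\<close>

text \<open>The number of steps is chosen before the continuation \<open>K\<close>. This uniformity
  makes the relation compose under sequencing and looping.\<close>

definition runs :: "('v, 'a) com \<Rightarrow> nat \<Rightarrow> ('v \<Rightarrow> 'a list) \<Rightarrow> ('v \<Rightarrow> 'a list) \<Rightarrow> bool" where
  "runs c \<tau> \<sigma> \<sigma>' \<longleftrightarrow> (\<exists>t\<le>\<tau>. \<forall>K. (sstep ^^ t) (c # K, \<sigma>) = (K, \<sigma>'))"

lemma runs_mono: "runs c \<tau> \<sigma> \<sigma>' \<Longrightarrow> \<tau> \<le> \<tau>' \<Longrightarrow> runs c \<tau>' \<sigma> \<sigma>'"
  unfolding runs_def using le_trans by blast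

lemma runs_Skip: "runs Skip 1 \<sigma> \<sigma>"
  unfolding runs_def by (rule exI[of _ 1]) (simp add: sstep_def)

lemma runs_Push: "runs (Push v a) 1 \<sigma> (\<sigma>(v := a # \<sigma> v))"
  unfolding runs_def by (rule exI[of _ 1]) (simp add: sstep_def)

lemma runs_Seq:
  assumes "runs c1 t1 \<sigma> \<sigma>1" "runs c2 t2 \<sigma>1 \<sigma>2" shows "runs (c1 ;; c2) (t1 + t2 + 1) \<sigma> \<sigma>2"
proof -
  obtain s1 s2 where s: "s1 \<le> t1" "s2 \<le> t2" "\<And>K. (sstep ^^ s1) (c1 # K, \<sigma>) = (K, \<sigma>1)"
    "\<And>K. (sstep ^^ s2) (c2 # K, \<sigma>1) = (K, \<sigma>2)"
    using assms unfolding runs_def by blast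
  have "sstep ((c1 ;; c2) # K, \<sigma>) = (c1 # c2 # K, \<sigma>)" for K by (simp add: sstep_def)
  then have "(sstep ^^ Suc (s1 + s2)) ((c1 ;; c2) # K, \<sigma>) = (K, \<sigma>2)" for K
    using funpow_first funpow_trans s(3,4) by metis
  then show ?thesis unfolding runs_def using s(1,2) by (intro exI[of _ "Suc (s1 + s2)"]) auto
qed

lemma runs_Pop:
  assumes "runs (f (hd_option (\<sigma> v))) t (\<sigma>(v := tl (\<sigma> v))) \<sigma>'" shows "runs (Pop v f) (t + 1) \<sigma> \<sigma>'"
proof -
  obtain s where s: "s \<le> t" "\<And>K. (sstep ^^ s) (f (hd_option (\<sigma> v)) # K, \<sigma>(v := tl (\<sigma> v))) = (K, \<sigma>')"
    using assms unfolding runs_def by blast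
  have "sstep (Pop v f # K, \<sigma>) = (f (hd_option (\<sigma> v)) # K, \<sigma>(v := tl (\<sigma> v)))" for K
    by (simp add: sstep_def)
  then have "(sstep ^^ Suc s) (Pop v f # K, \<sigma>) = (K, \<sigma>')" for K
    using funpow_first s(2) by metis
  then show ?thesis unfolding runs_def using s(1) by (intro exI[of _ "Suc s"]) auto
qed

lemma runs_Drain_Nil: "\<sigma> v = [] \<Longrightarrow> runs (Drain v f) 1 \<sigma> \<sigma>"
  unfolding runs_def by (rule exI[of _ 1]) (auto simp: sstep_def)

lemma runs_Drain_Cons:
  assumes "\<sigma> v = a # as" "runs (f a) t1 (\<sigma>(v := as)) \<sigma>1" "runs (Drain v f) t2 \<sigma>1 \<sigma>2"
  shows "runs (Drain v f) (t1 + t2 + 1) \<sigma> \<sigma>2"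
proof -
  obtain s1 s2 where s: "s1 \<le> t1" "s2 \<le> t2" "\<And>K. (sstep ^^ s1) (f a # K, \<sigma>(v := as)) = (K, \<sigma>1)"
    "\<And>K. (sstep ^^ s2) (Drain v f # K, \<sigma>1) = (K, \<sigma>2)"
    using assms unfolding runs_def by blast
  have "sstep (Drain v f # K, \<sigma>) = (f a # Drain v f # K, \<sigma>(v := as))" for K
    using assms(1) by (simp add: sstep_def)
  then have "(sstep ^^ Suc (s1 + s2)) (Drain v f # K, \<sigma>) = (K, \<sigma>2)" for K
    using funpow_first funpow_trans s(3,4) by metis
  then show ?thesis unfolding runs_def using s(1,2) by (intro exI[of _ "Suc (s1 + s2)"]) auto
qed

text \<open>The invariant determines the rest of the drained stack, so a body that preserves it
  cannot refill the stack, and the number of rounds is known in advance.\<close>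

lemma runs_Drain:
  assumes "I xs \<sigma>" and hd: "\<And>xs \<sigma>. I xs \<sigma> \<Longrightarrow> \<sigma> v = xs"
    and step: "\<And>a as \<sigma>. I (a # as) \<sigma> \<Longrightarrow> \<exists>\<sigma>'. runs (f a) \<tau> (\<sigma>(v := as)) \<sigma>' \<and> I as \<sigma>'"
  shows "\<exists>\<sigma>'. runs (Drain v f) (length xs * (\<tau> + 1) + 1) \<sigma> \<sigma>' \<and> I [] \<sigma>'"
  using assms(1)
proof (induction xs arbitrary: \<sigma>)
  case Nil
  have "runs (Drain v f) 1 \<sigma> \<sigma>" by (rule runs_Drain_Nil, rule hd, rule Nil)
  then show ?case using Nil by auto
next
  case (Cons a as)
  obtain \<sigma>1 where 1: "runs (f a) \<tau> (\<sigma>(v := as)) \<sigma>1" "I as \<sigma>1" using step[OF Cons.prems] by blast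
  obtain \<sigma>2 where 2: "runs (Drain v f) (length as * (\<tau> + 1) + 1) \<sigma>1 \<sigma>2" "I [] \<sigma>2"
    using Cons.IH[OF 1(2)] by blast
  have "runs (Drain v f) (length (a # as) * (\<tau> + 1) + 1) \<sigma> \<sigma>2"
    by (rule runs_mono[OF runs_Drain_Cons[OF hd[OF Cons.prems] 1(1) 2(1)]]) simp
  then show ?case using 2(2) by blast
qed

lemma runs_Drain_Push:
  assumes "u \<noteq> v" "\<sigma> v = xs"
  shows "runs (Drain v (\<lambda>a. Push u a)) (2 * length xs + 1) \<sigma> (\<sigma>(v := [], u := rev xs @ \<sigma> u))"
  using assms(2)
proof (induction xs arbitrary: \<sigma>)
  case Nil
  then show ?case using runs_Drain_Nil[of \<sigma> v] by (simp add: fun_upd_idem)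
next
  case (Cons a as)
  let ?\<sigma>1 = "(\<sigma>(v := as))(u := a # \<sigma> u)"
  have 1: "runs (Push u a) 1 (\<sigma>(v := as)) ?\<sigma>1"
    using runs_Push[of u a "\<sigma>(v := as)"] assms(1) by simp
  have "?\<sigma>1(v := [], u := rev as @ ?\<sigma>1 u) = \<sigma>(v := [], u := rev (a # as) @ \<sigma> u)"
    using assms(1) by (auto simp: fun_eq_iff)
  then have 2: "runs (Drain v (Push u)) (2 * length as + 1) ?\<sigma>1
      (\<sigma>(v := [], u := rev (a # as) @ \<sigma> u))"
    using Cons.IH[of ?\<sigma>1] assms(1) by (simp del: fun_upd_apply add: fun_upd_same fun_upd_other)
  show ?case
    by (rule runs_mono[OF runs_Drain_Cons[where f = "Push u", OF Cons.prems 1 2]]) simp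
qed

section \<open>A loop language with timelines\<close>

text \<open>The state consists of a two-way infinite Boolean timeline for every track, one head that is
  common to all tracks, and flags. Loops range over read-only strings only, so every program
  terminates, in time polynomial in the length of these strings.\<close>

datatype ('r, 't, 'f, 'a) lcom = LSkip | MoveR | MoveL | Mark 't bool | Flag 'f bool
  | LSeq "('r, 't, 'f, 'a) lcom" "('r, 't, 'f, 'a) lcom" (infixr ";" 60)
  | Test 't "('r, 't, 'f, 'a) lcom" "('r, 't, 'f, 'a) lcom"
  | IfF 'f "('r, 't, 'f, 'a) lcom" "('r, 't, 'f, 'a) lcom"
  | For 'r "'a \<Rightarrow> ('r, 't, 'f, 'a) lcom"

type_synonym ('t, 'f) lstate = "('t \<Rightarrow> int \<Rightarrow> bool) \<times> int \<times> ('f \<Rightarrow> bool)"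

primrec leval :: "('r \<Rightarrow> 'a list) \<Rightarrow> ('r, 't, 'f, 'a) lcom \<Rightarrow> ('t, 'f) lstate \<Rightarrow> ('t, 'f) lstate" where
  "leval ro LSkip s = s"
| "leval ro MoveR s = (case s of (T, h, F) \<Rightarrow> (T, h + 1, F))"
| "leval ro MoveL s = (case s of (T, h, F) \<Rightarrow> (T, h - 1, F))"
| "leval ro (Mark t b) s = (case s of (T, h, F) \<Rightarrow> (T(t := (T t)(h := b)), h, F))"
| "leval ro (Flag f b) s = (case s of (T, h, F) \<Rightarrow> (T, h, F(f := b)))"
| "leval ro (c1 ; c2) s = leval ro c2 (leval ro c1 s)"
| "leval ro (Test t c1 c2) s = (case s of (T, h, F) \<Rightarrow> if T t h then leval ro c1 s else leval ro c2 s)"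
| "leval ro (IfF f c1 c2) s = (case s of (T, h, F) \<Rightarrow> if F f then leval ro c1 s else leval ro c2 s)"
| "leval ro (For r g) s = fold (\<lambda>a. leval ro (g a)) (ro r) s"

text \<open>While \<open>For r\<close> runs, its string is split over two stacks and cannot be
  traversed a second time, so nested loops must range over different strings.\<close>

primrec lwf :: "('r, 't, 'f, 'a) lcom \<Rightarrow> 'r set \<Rightarrow> bool" where
  "lwf LSkip A = True"
| "lwf MoveR A = True"
| "lwf MoveL A = True"
| "lwf (Mark t b) A = True"
| "lwf (Flag f b) A = True"
| "lwf (c1 ; c2) A = (lwf c1 A \<and> lwf c2 A)"
| "lwf (Test t c1 c2) A = (lwf c1 A \<and> lwf c2 A)"
| "lwf (IfF f c1 c2) A = (lwf c1 A \<and> lwf c2 A)"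
| "lwf (For r g) A = (r \<in> A \<and> (\<forall>a. lwf (g a) (A - {r})))"

text \<open>\<open>Str r True\<close> holds the part of a string still to be read,
  \<open>Str r False\<close> the part already read, reversed. \<open>Track t True\<close> holds the
  cell under the head and those to its right, \<open>Track t False\<close> those to its left,
  nearest first. Moving the common head is therefore one transfer between two stacks for every
  track.\<close>

datatype ('r, 't, 'f) var = Inp | Tmp nat | Str 'r bool | Track 't bool | Fl 'f

abbreviation bit_sym :: "bool \<Rightarrow> 'y sym" where
  "bit_sym b \<equiv> (if b then Bit1 else Bit0)"

text \<open>An exhausted stack answers \<open>None\<close>, which becomes \<open>Bit0\<close>; so
  finitely many symbols stand for a timeline that is false everywhere else.\<close>

fun move :: "bool \<Rightarrow> 't list \<Rightarrow> (('r, 't, 'f) var, 'y sym) com" where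
  "move d [] = Skip"
| "move d (t # ts) = Pop (Track t d) (\<lambda>x. Push (Track t (\<not> d)) (bit_sym (x = Some Bit1))) ;; move d ts"

primrec compile :: "'t list \<Rightarrow> ('r, 't, 'f, 'y sym) lcom \<Rightarrow> (('r, 't, 'f) var, 'y sym) com" where
  "compile ts LSkip = Skip"
| "compile ts MoveR = move True ts"
| "compile ts MoveL = move False ts"
| "compile ts (Mark t b) = Pop (Track t True) (\<lambda>_. Push (Track t True) (bit_sym b))"
| "compile ts (Flag f b) = Pop (Fl f) (\<lambda>_. if b then Push (Fl f) Bit1 else Skip)"
| "compile ts (c1 ; c2) = compile ts c1 ;; compile ts c2"
| "compile ts (Test t c1 c2) = Pop (Track t True) (\<lambda>x. Push (Track t True) (bit_sym (x = Some Bit1)) ;;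
     (if x = Some Bit1 then compile ts c1 else compile ts c2))"
| "compile ts (IfF f c1 c2) = Pop (Fl f) (\<lambda>x. if x = None then compile ts c2
     else Push (Fl f) Bit1 ;; compile ts c1)"
| "compile ts (For r g) =
     Drain (Str r True) (\<lambda>a. Push (Str r False) a ;; compile ts (g a)) ;;
     Drain (Str r False) (\<lambda>a. Push (Str r True) a)"

text \<open>Branches are added and loop bodies summed over the alphabet, instead of taking maxima,
  so that the closure properties of \<open>poly_bounded\<close> apply directly. The degree depends
  on the nesting depth of the program only.\<close>

primrec ltime :: "nat \<Rightarrow> ('r, 't, 'f, 'a::finite) lcom \<Rightarrow> nat \<Rightarrow> nat" where
  "ltime n LSkip N = 1"
| "ltime n MoveR N = 3 * n + 1"
| "ltime n MoveL N = 3 * n + 1"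
| "ltime n (Mark t b) N = 2"
| "ltime n (Flag f b) N = 2"
| "ltime n (c1 ; c2) N = ltime n c1 N + ltime n c2 N + 1"
| "ltime n (Test t c1 c2) N = ltime n c1 N + ltime n c2 N + 3"
| "ltime n (IfF f c1 c2) N = ltime n c1 N + ltime n c2 N + 3"
| "ltime n (For r g) N = N * ((\<Sum>a\<in>UNIV. ltime n (g a) N) + 3) + 2 * N + 3"

lemma poly_bounded_ltime: "poly_bounded (ltime n c)"
proof (induction c)
  case (For r g)
  then have "poly_bounded (\<lambda>N. \<Sum>a\<in>UNIV. ltime n (g a) N)" by (intro poly_bounded_sum) auto
  then show ?case by (simp, intro poly_bounded_intros)
qed (simp only: ltime.simps, (intro poly_bounded_intros; assumption))+

section \<open>Correctness and running time of the compilation\<close>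

definition getbit :: "'y sym list \<Rightarrow> nat \<Rightarrow> bool" where
  "getbit xs n \<longleftrightarrow> n < length xs \<and> xs ! n = Bit1"

definition cell :: "(('r, 't, 'f) var \<Rightarrow> 'y sym list) \<Rightarrow> 't \<Rightarrow> int \<Rightarrow> bool" where
  "cell \<sigma> t k = (if 0 \<le> k then getbit (\<sigma> (Track t True)) (nat k)
                 else getbit (\<sigma> (Track t False)) (nat (- 1 - k)))"

text \<open>Only cells are compared, since stacks that differ in the zeros at their bottom represent
  the same timeline. The set \<open>A\<close> consists of the strings that no enclosing loop is
  reading.\<close>

definition rep :: "'r set \<Rightarrow> ('r \<Rightarrow> 'y sym list) \<Rightarrow> (('r, 't, 'f) var \<Rightarrow> 'y sym list) \<Rightarrow>
    ('t, 'f) lstate \<Rightarrow> bool" where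
  "rep A ro \<sigma> s \<longleftrightarrow> (case s of (T, h, F) \<Rightarrow>
     (\<forall>r\<in>A. \<sigma> (Str r True) = ro r \<and> \<sigma> (Str r False) = []) \<and>
     (\<forall>t k. cell \<sigma> t k = T t (h + k)) \<and>
     (\<forall>f. \<sigma> (Fl f) = (if F f then [Bit1] else [])))"


lemma getbit_Cons: "getbit (bit_sym b # xs) n \<longleftrightarrow> (if n = 0 then b else getbit xs (n - 1))"
  by (auto simp: getbit_def nth_Cons')

lemma getbit_tl: "getbit (tl xs) n \<longleftrightarrow> getbit xs (Suc n)"
  by (cases xs) (auto simp: getbit_def)

lemma hd_option_bit: "hd_option xs = Some Bit1 \<longleftrightarrow> getbit xs 0"
  by (cases xs) (auto simp: getbit_def)

definition moved :: "bool \<Rightarrow> 't list \<Rightarrow> (('r, 't, 'f) var \<Rightarrow> 'y sym list) \<Rightarrow>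
    ('r, 't, 'f) var \<Rightarrow> 'y sym list" where
  "moved d ts \<sigma> v = (case v of
     Track t b \<Rightarrow> if t \<notin> set ts then \<sigma> v
       else if b = d then tl (\<sigma> (Track t d))
       else bit_sym (hd_option (\<sigma> (Track t d)) = Some Bit1) # \<sigma> (Track t (\<not> d))
   | _ \<Rightarrow> \<sigma> v)"

lemma moved_other [simp]: "moved d ts \<sigma> (Str r b) = \<sigma> (Str r b)" "moved d ts \<sigma> (Fl f) = \<sigma> (Fl f)"
  by (simp_all add: moved_def)

lemma runs_move: "distinct ts \<Longrightarrow> runs (move d ts) (3 * length ts + 1) \<sigma> (moved d ts \<sigma>)"
proof (induction ts arbitrary: \<sigma>)
  case Nil
  have "moved d [] \<sigma> = \<sigma>" by (rule ext) (simp add: moved_def split: var.split)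
  then show ?case using runs_Skip[of \<sigma>] by simp
next
  case (Cons t ts)
  let ?b = "bit_sym (hd_option (\<sigma> (Track t d)) = Some Bit1)"
  let ?\<sigma>1 = "(\<sigma>(Track t d := tl (\<sigma> (Track t d))))(Track t (\<not> d) := ?b # \<sigma> (Track t (\<not> d)))"
  have "runs (Pop (Track t d) (\<lambda>x. Push (Track t (\<not> d)) (bit_sym (x = Some Bit1)))) (1 + 1) \<sigma> ?\<sigma>1"
    using runs_Push[of "Track t (\<not> d)" ?b "\<sigma>(Track t d := tl (\<sigma> (Track t d)))"]
    by (intro runs_Pop) auto
  moreover have "runs (move d ts) (3 * length ts + 1) ?\<sigma>1 (moved d ts ?\<sigma>1)"
    using Cons by simp
  moreover have "moved d ts ?\<sigma>1 = moved d (t # ts) \<sigma>"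
    using Cons.prems by (auto simp: moved_def fun_eq_iff split: var.split)
  ultimately show ?case using runs_mono[OF runs_Seq] by fastforce
qed

lemma cell_moved:
  assumes "set ts = UNIV"
  shows "cell (moved True ts \<sigma>) t k = cell \<sigma> t (k + 1)"
    and "cell (moved False ts \<sigma>) t k = cell \<sigma> t (k - 1)"
proof -
  \<comment> \<open>Only the cell that ends up at -1 changes stacks.\<close>
  consider "k \<ge> 0" | "k = -1" | "k < -1" by linarith
  then show "cell (moved True ts \<sigma>) t k = cell \<sigma> t (k + 1)"
  proof cases
    case 3
    then have "nat (- 1 - k) = Suc (nat (- 1 - (k + 1)))" by simp
    with 3 show ?thesis using assms
      by (simp add: cell_def moved_def getbit_Cons)
  qed (use assms in \<open>simp_all add: cell_def moved_def getbit_Cons getbit_tl hd_option_bit nat_add_distrib\<close>)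
  \<comment> \<open>Here the cell that ends up at 0 is the one that changes stacks.\<close>
  consider "k > 0" | "k = 0" | "k < 0" by linarith
  then show "cell (moved False ts \<sigma>) t k = cell \<sigma> t (k - 1)"
  proof cases
    case 1
    then have "nat k = Suc (nat (k - 1))" by simp
    with 1 show ?thesis using assms
      by (simp add: cell_def moved_def getbit_Cons)
  next
    case 3
    then have "nat (- 1 - (k - 1)) = Suc (nat (- 1 - k))" by simp
    with 3 show ?thesis using assms
      by (simp add: cell_def moved_def getbit_tl)
  qed (use assms in \<open>simp add: cell_def moved_def getbit_Cons hd_option_bit\<close>)
qed

lemma cell_write:
  "cell (\<sigma>(Track t True := bit_sym b # tl (\<sigma> (Track t True)))) t' k =
    (if t' = t \<and> k = 0 then b else cell \<sigma> t' k)"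
  by (auto simp: cell_def getbit_Cons getbit_tl)

lemma cell_upd [simp]: "cell (\<sigma>(Str r b := xs)) = cell \<sigma>" "cell (\<sigma>(Fl f := xs)) = cell \<sigma>"
    "cell (\<sigma>(Tmp n := xs)) = cell \<sigma>" "cell (\<sigma>(Inp := xs)) = cell \<sigma>"
  by (intro ext; simp add: cell_def)+

text \<open>The clause on strings outside \<open>A\<close> carries the induction: the body of a loop
  over \<open>r\<close> is run with \<open>r\<close> removed from \<open>A\<close> and has to leave
  both halves of that string as they are.\<close>

theorem runs_compile:
  fixes c :: "('r, 't, 'f, ('y::finite) sym) lcom"
  assumes ts: "distinct ts" "set ts = UNIV"
  assumes "lwf c A" "rep A ro \<sigma> s" "\<And>r. r \<in> A \<Longrightarrow> length (ro r) \<le> N"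
  shows "\<exists>\<sigma>'. runs (compile ts c) (ltime (length ts) c N) \<sigma> \<sigma>' \<and> rep A ro \<sigma>' (leval ro c s) \<and>
    (\<forall>r b. r \<notin> A \<longrightarrow> \<sigma>' (Str r b) = \<sigma> (Str r b))"
  using assms(3-5)
proof (induction c arbitrary: A \<sigma> s)
  case LSkip
  then show ?case using runs_Skip by fastforce
next
  case MoveR
  have "rep A ro (moved True ts \<sigma>) (leval ro MoveR s)"
    using MoveR.prems(2) by (auto simp: rep_def cell_moved[OF ts(2)] add.assoc add.commute[of 1])
  then show ?case using runs_move[OF ts(1), of True \<sigma>]
    by (intro exI[of _ "moved True ts \<sigma>"]) auto
next
  case MoveL
  have "rep A ro (moved False ts \<sigma>) (leval ro MoveL s)"
    using MoveL.prems(2) by (auto simp: rep_def cell_moved[OF ts(2)] algebra_simps)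
  then show ?case using runs_move[OF ts(1), of False \<sigma>]
    by (intro exI[of _ "moved False ts \<sigma>"]) auto
next
  case (Mark t b)
  let ?\<sigma> = "\<sigma>(Track t True := bit_sym b # tl (\<sigma> (Track t True)))"
  have 1: "runs (compile ts (Mark t b)) (1 + 1) \<sigma> ?\<sigma>"
    using runs_Push[of "Track t True" "bit_sym b" "\<sigma>(Track t True := tl (\<sigma> (Track t True)))"]
    by (simp only: compile.simps, intro runs_Pop) simp
  have 2: "rep A ro ?\<sigma> (leval ro (Mark t b) s)"
    using Mark.prems(2)
    by (auto simp: rep_def cell_write simp del: fun_upd_apply) (auto simp: rep_def split: if_splits)
  show ?case
    by (rule exI[of _ ?\<sigma>], intro conjI, use 1 in \<open>simp only: ltime.simps one_add_one\<close>, rule 2) simp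
next
  case (Flag f b)
  obtain T h F where s: "s = (T, h, F)" by (rule prod_cases3)
  have tl: "tl (\<sigma> (Fl f)) = []" using Flag.prems(2) by (simp add: rep_def s)
  let ?\<sigma> = "\<sigma>(Fl f := if b then [Bit1] else [])"
  have "runs (if b then Push (Fl f) Bit1 else Skip) 1 (\<sigma>(Fl f := tl (\<sigma> (Fl f)))) ?\<sigma>"
    using runs_Push[of "Fl f" Bit1 "\<sigma>(Fl f := [])"] runs_Skip[of "\<sigma>(Fl f := [])"] tl by simp
  then have 1: "runs (compile ts (Flag f b)) (1 + 1) \<sigma> ?\<sigma>"
    by (simp only: compile.simps, intro runs_Pop)
  have 2: "rep A ro ?\<sigma> (leval ro (Flag f b) s)"
    using Flag.prems(2) by (auto simp: rep_def s)
  show ?case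
    by (rule exI[of _ ?\<sigma>], intro conjI, use 1 in \<open>simp only: ltime.simps one_add_one\<close>, rule 2) simp
next
  case (LSeq c1 c2)
  obtain \<sigma>1 where 1: "runs (compile ts c1) (ltime (length ts) c1 N) \<sigma> \<sigma>1" "rep A ro \<sigma>1 (leval ro c1 s)"
    "\<And>r b. r \<notin> A \<Longrightarrow> \<sigma>1 (Str r b) = \<sigma> (Str r b)"
    using LSeq.IH(1)[of A \<sigma> s] LSeq.prems by auto
  obtain \<sigma>2 where 2: "runs (compile ts c2) (ltime (length ts) c2 N) \<sigma>1 \<sigma>2"
    "rep A ro \<sigma>2 (leval ro c2 (leval ro c1 s))" "\<And>r b. r \<notin> A \<Longrightarrow> \<sigma>2 (Str r b) = \<sigma>1 (Str r b)"
    using LSeq.IH(2)[of A \<sigma>1 "leval ro c1 s"] LSeq.prems 1(2) by auto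
  show ?case using runs_Seq[OF 1(1) 2(1)] 1(3) 2(2,3) by auto
next
  case (Test t c1 c2)
  obtain T h F where s: "s = (T, h, F)" by (rule prod_cases3)
  define \<sigma>1 where "\<sigma>1 = \<sigma>(Track t True := bit_sym (T t h) # tl (\<sigma> (Track t True)))"
  let ?c = "if T t h then c1 else c2"
  have T: "hd_option (\<sigma> (Track t True)) = Some Bit1 \<longleftrightarrow> T t h"
    using Test.prems(2) by (auto simp: rep_def s hd_option_bit cell_def dest!: spec[of _ t] dest: spec[of _ 0])
  have "rep A ro \<sigma>1 s"
    using Test.prems(2) unfolding \<sigma>1_def
    by (auto simp: rep_def cell_write s simp del: fun_upd_apply) (auto simp: rep_def)
  then obtain \<sigma>' where \<sigma>': "runs (compile ts ?c) (ltime (length ts) ?c N) \<sigma>1 \<sigma>'"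
    "rep A ro \<sigma>' (leval ro ?c s)" "\<And>r b. r \<notin> A \<Longrightarrow> \<sigma>' (Str r b) = \<sigma>1 (Str r b)"
    using Test.IH(1)[of A \<sigma>1 s] Test.IH(2)[of A \<sigma>1 s] Test.prems(1,3) by (cases "T t h") auto
  have "runs (Push (Track t True) (bit_sym (T t h))) 1 (\<sigma>(Track t True := tl (\<sigma> (Track t True)))) \<sigma>1"
    using runs_Push[of "Track t True" "bit_sym (T t h)" "\<sigma>(Track t True := tl (\<sigma> (Track t True)))"]
    by (simp add: \<sigma>1_def)
  from runs_Seq[OF this \<sigma>'(1)]
  have "runs (compile ts (Test t c1 c2)) (1 + ltime (length ts) ?c N + 1 + 1) \<sigma> \<sigma>'"
    by (simp only: compile.simps, intro runs_Pop) (cases "T t h", simp_all add: T)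
  then have "runs (compile ts (Test t c1 c2)) (ltime (length ts) (Test t c1 c2) N) \<sigma> \<sigma>'"
    by (rule runs_mono) (cases "T t h", auto)
  then show ?case using \<sigma>'(2,3) by (intro exI[of _ \<sigma>']) (auto simp: s \<sigma>1_def)
next
  case (IfF f c1 c2)
  obtain T h F where s: "s = (T, h, F)" by (rule prod_cases3)
  have f: "\<sigma> (Fl f) = (if F f then [Bit1] else [])" using IfF.prems(2) by (simp add: rep_def s)
  let ?c = "if F f then c1 else c2"
  obtain \<sigma>' where \<sigma>': "runs (compile ts ?c) (ltime (length ts) ?c N) \<sigma> \<sigma>'"
    "rep A ro \<sigma>' (leval ro ?c s)" "\<And>r b. r \<notin> A \<Longrightarrow> \<sigma>' (Str r b) = \<sigma> (Str r b)"
    using IfF.IH(1)[of A \<sigma> s] IfF.IH(2)[of A \<sigma> s] IfF.prems by (cases "F f") auto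
  have "runs (compile ts (IfF f c1 c2)) (ltime (length ts) (IfF f c1 c2) N) \<sigma> \<sigma>'"
  proof (cases "F f")
    case True
    have "runs (Push (Fl f) Bit1) 1 (\<sigma>(Fl f := tl (\<sigma> (Fl f)))) \<sigma>"
      using runs_Push[of "Fl f" Bit1 "\<sigma>(Fl f := [])"] f True by (simp add: fun_upd_idem)
    from runs_Seq[OF this \<sigma>'(1)] True
    have "runs (compile ts (IfF f c1 c2)) (1 + ltime (length ts) c1 N + 1 + 1) \<sigma> \<sigma>'"
      by (simp only: compile.simps, intro runs_Pop) (simp add: f)
    then show ?thesis by (rule runs_mono) simp
  next
    case False
    have "\<sigma>(Fl f := tl (\<sigma> (Fl f))) = \<sigma>" using f False by (simp add: fun_upd_idem)
    with \<sigma>'(1) False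
    have "runs (compile ts (IfF f c1 c2)) (ltime (length ts) c2 N + 1) \<sigma> \<sigma>'"
      by (simp only: compile.simps, intro runs_Pop) (simp add: f)
    then show ?thesis by (rule runs_mono) simp
  qed
  then show ?case using \<sigma>'(2,3) by (intro exI[of _ \<sigma>']) (auto simp: s)
next
  case (For r g)
  let ?S = "\<Sum>a\<in>UNIV. ltime (length ts) (g a) N"
  \<comment> \<open>\<open>zs\<close> is the part already read. It determines the state reached, and
    its reversed copy is what the string is restored from.\<close>
  define I where "I ys \<sigma>1 \<longleftrightarrow> (\<exists>zs. ro r = zs @ ys \<and> \<sigma>1 (Str r True) = ys \<and> \<sigma>1 (Str r False) = rev zs \<and>
      rep (A - {r}) ro \<sigma>1 (fold (\<lambda>a. leval ro (g a)) zs s) \<and>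
      (\<forall>r b. r \<notin> A \<longrightarrow> \<sigma>1 (Str r b) = \<sigma> (Str r b)))" for ys \<sigma>1
  have r: "r \<in> A" "\<And>a. lwf (g a) (A - {r})" using For.prems(1) by auto
  have "I (ro r) \<sigma>"
    unfolding I_def using For.prems(2) r by (intro exI[of _ "[]"]) (auto simp: rep_def)
  then have "\<exists>\<sigma>'. runs (Drain (Str r True) (\<lambda>a. Push (Str r False) a ;; compile ts (g a)))
      (length (ro r) * ((?S + 2) + 1) + 1) \<sigma> \<sigma>' \<and> I [] \<sigma>'"
  proof (rule runs_Drain)
    fix ys \<sigma>1 assume "I ys \<sigma>1" then show "\<sigma>1 (Str r True) = ys" unfolding I_def by blast
  next
    fix a as \<sigma>1 assume "I (a # as) \<sigma>1"
    then obtain zs where zs: "ro r = zs @ a # as" "\<sigma>1 (Str r True) = a # as" "\<sigma>1 (Str r False) = rev zs"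
      "rep (A - {r}) ro \<sigma>1 (fold (\<lambda>a. leval ro (g a)) zs s)"
      "\<And>r b. r \<notin> A \<Longrightarrow> \<sigma>1 (Str r b) = \<sigma> (Str r b)"
      unfolding I_def by blast
    let ?\<sigma>2 = "\<sigma>1(Str r True := as, Str r False := a # rev zs)"
    have "runs (Push (Str r False) a) 1 (\<sigma>1(Str r True := as)) ?\<sigma>2"
      using runs_Push[of "Str r False" a "\<sigma>1(Str r True := as)"] zs(3) by simp
    moreover have rep2: "rep (A - {r}) ro ?\<sigma>2 (fold (\<lambda>a. leval ro (g a)) zs s)"
      using zs(4) by (auto simp: rep_def)
    have len: "length (ro r') \<le> N" if "r' \<in> A - {r}" for r' using For.prems(3) that by simp
    obtain \<sigma>3 where \<sigma>3: "runs (compile ts (g a)) (ltime (length ts) (g a) N) ?\<sigma>2 \<sigma>3"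
      "rep (A - {r}) ro \<sigma>3 (leval ro (g a) (fold (\<lambda>a. leval ro (g a)) zs s))"
      "\<And>r' b. r' \<notin> A - {r} \<Longrightarrow> \<sigma>3 (Str r' b) = ?\<sigma>2 (Str r' b)"
      using For.IH[OF rangeI r(2) rep2 len] by blast
    ultimately have "runs (Push (Str r False) a ;; compile ts (g a))
        (1 + ltime (length ts) (g a) N + 1) (\<sigma>1(Str r True := as)) \<sigma>3"
      by (intro runs_Seq)
    moreover have "ltime (length ts) (g a) N \<le> ?S"
      by (rule member_le_sum) auto
    then have "1 + ltime (length ts) (g a) N + 1 \<le> ?S + 2" by simp
    ultimately have "runs (Push (Str r False) a ;; compile ts (g a)) (?S + 2) (\<sigma>1(Str r True := as)) \<sigma>3"
      by (rule runs_mono)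
    moreover have "I as \<sigma>3"
      unfolding I_def using zs(1,5) \<sigma>3(2,3) r(1) by (intro exI[of _ "zs @ [a]"]) auto
    ultimately show "\<exists>\<sigma>'. runs (Push (Str r False) a ;; compile ts (g a)) (?S + 2)
        (\<sigma>1(Str r True := as)) \<sigma>' \<and> I as \<sigma>'" by blast
  qed
  then obtain \<sigma>1 where 1: "runs (Drain (Str r True) (\<lambda>a. Push (Str r False) a ;; compile ts (g a)))
      (length (ro r) * ((?S + 2) + 1) + 1) \<sigma> \<sigma>1" "I [] \<sigma>1" by blast
  from 1(2) have \<sigma>1: "\<sigma>1 (Str r True) = []" "\<sigma>1 (Str r False) = rev (ro r)"
    "rep (A - {r}) ro \<sigma>1 (leval ro (For r g) s)" "\<And>r b. r \<notin> A \<Longrightarrow> \<sigma>1 (Str r b) = \<sigma> (Str r b)"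
    unfolding I_def by auto
  let ?\<sigma>2 = "\<sigma>1(Str r False := [], Str r True := ro r)"
  have 2: "runs (Drain (Str r False) (Push (Str r True))) (2 * length (ro r) + 1) \<sigma>1 ?\<sigma>2"
    using runs_Drain_Push[of "Str r True" "Str r False" \<sigma>1 "rev (ro r)"] \<sigma>1(1,2) by simp
  have "length (ro r) * ((?S + 2) + 1) \<le> N * (?S + 3)"
    using For.prems(3)[OF r(1)] by (intro mult_le_mono) auto
  then have "length (ro r) * ((?S + 2) + 1) + 1 + (2 * length (ro r) + 1) + 1
      \<le> ltime (length ts) (For r g) N"
    using For.prems(3)[OF r(1)] by simp
  then have "runs (compile ts (For r g)) (ltime (length ts) (For r g) N) \<sigma> ?\<sigma>2"
    unfolding compile.simps using runs_mono[OF runs_Seq[OF 1(1) 2]] by blast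
  moreover have "rep A ro ?\<sigma>2 (leval ro (For r g) s)"
    using \<sigma>1(3) by (auto simp: rep_def)
  moreover have "\<forall>r' b. r' \<notin> A \<longrightarrow> ?\<sigma>2 (Str r' b) = \<sigma> (Str r' b)" using \<sigma>1(4) r(1) by auto
  ultimately show ?case by blast
qed

section \<open>Provability and closure\<close>

lemma shift_Un: "shift i (M \<union> N) = shift i M \<union> shift i N"
  by (auto simp: shift_def)

lemma shift_shift: "shift i (shift j M) = shift (j + i) M"
  by (simp add: shift_def image_image case_prod_beta add.assoc)

lemma shift_0 [simp]: "shift 0 M = M"
  by (auto simp: shift_def)

lemma finite_shift [simp]: "finite M \<Longrightarrow> finite (shift i M)"
  by (simp add: shift_def)

lemma mem_shift: "(y, k) \<in> shift i M \<longleftrightarrow> (y, k - i) \<in> M"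
  by (auto simp: shift_def image_iff intro!: bexI[of _ "(y, k - i)"])

text \<open>Closed sets play the part of models: derivable formulas hold in them at every shift, and
  for predictive input a failure of derivability is witnessed by one of them.\<close>

definition closed_under :: "'y fml set \<Rightarrow> 'y tattr set \<Rightarrow> bool" where
  "closed_under \<Sigma> C \<longleftrightarrow> (\<forall>g\<in>\<Sigma>. \<forall>i. shift i (fst g) \<subseteq> C \<longrightarrow> shift i (snd g) \<subseteq> C)"

lemma follows_Ax: "finite A \<Longrightarrow> finite B \<Longrightarrow> follows S (A \<union> B, A)"
  unfolding follows_def by (intro disjI1 exI[of _ A] exI[of _ B]) simp

lemma follows_Cut:
  "finite A \<Longrightarrow> finite B \<Longrightarrow> finite C \<Longrightarrow> finite D \<Longrightarrow> (A, B) \<in> S \<Longrightarrow> (B \<union> C, D) \<in> S \<Longrightarrow>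
    follows S (A \<union> C, D)"
  unfolding follows_def
  by (intro disjI2[OF disjI1] exI[of _ A] exI[of _ B] exI[of _ C] exI[of _ D]) simp

lemma follows_Shf:
  "finite A \<Longrightarrow> finite B \<Longrightarrow> (A, B) \<in> S \<Longrightarrow> follows S (shift i A, shift i B)"
  unfolding follows_def by (intro disjI2 exI[of _ A] exI[of _ B] exI[of _ i]) simp

lemma follows_cases [consumes 1, case_names Ax Cut Shf]:
  assumes "follows S \<phi>"
  obtains A B where "finite A" "finite B" "\<phi> = (A \<union> B, A)"
  | A B C D where "finite A" "finite B" "finite C" "finite D" "(A, B) \<in> S" "(B \<union> C, D) \<in> S"
      "\<phi> = (A \<union> C, D)"
  | A B i where "finite A" "finite B" "(A, B) \<in> S" "\<phi> = (shift i A, shift i B)"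
  using assms unfolding follows_def by (elim disjE exE conjE)

lemma follows_mono:
  assumes "follows S \<phi>" "S \<subseteq> S'" shows "follows S' \<phi>"
  using assms(1)
proof (cases rule: follows_cases)
  case (Ax A B)
  then show ?thesis by (simp add: follows_Ax)
next
  case (Cut A B C D)
  then show ?thesis using follows_Cut[of A B C D S'] assms(2) by blast
next
  case (Shf A B i)
  then show ?thesis using follows_Shf[of A B S'] assms(2) by blast
qed

lemma provable_sound:
  assumes "provable \<Sigma> \<phi>" "closed_under \<Sigma> C" "shift i (fst \<phi>) \<subseteq> C"
  shows "shift i (snd \<phi>) \<subseteq> C"
proof -
  from assms(1) obtain ds where ds': "ds \<noteq> [] \<and> last ds = \<phi> \<and>
      (\<forall>k<length ds. ds ! k \<in> \<Sigma> \<or> follows (set (take k ds)) (ds ! k))"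
    unfolding provable_def by (elim exE)
  note ds = conjunct1[OF ds'] conjunct1[OF conjunct2[OF ds']]
    and step = conjunct2[OF conjunct2[OF ds'], rule_format]
  \<comment> \<open>\<open>i\<close> stays arbitrary because (Shf) reduces the claim at
    \<open>i\<close> to its premise at another shift.\<close>
  have "k < length ds \<Longrightarrow> shift i (fst (ds ! k)) \<subseteq> C \<Longrightarrow> shift i (snd (ds ! k)) \<subseteq> C" for k i
  proof (induction k arbitrary: i rule: less_induct)
    case (less k)
    have IH: "shift j (snd \<psi>) \<subseteq> C" if \<psi>: "\<psi> \<in> set (take k ds)" "shift j (fst \<psi>) \<subseteq> C" for \<psi> j
    proof -
      obtain m where "m < length (take k ds)" "take k ds ! m = \<psi>"
        by (metis in_set_conv_nth \<psi>(1))
      then show ?thesis using less.IH[of m j] less.prems(1) \<psi>(2) by simp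
    qed
    from step[OF less.prems(1)] show ?case
    proof
      assume "ds ! k \<in> \<Sigma>"
      with assms(2) have "shift i (fst (ds ! k)) \<subseteq> C \<longrightarrow> shift i (snd (ds ! k)) \<subseteq> C"
        unfolding closed_under_def by simp
      then show ?thesis using less.prems(2) by (rule mp)
    next
      assume "follows (set (take k ds)) (ds ! k)"
      then show ?thesis
      proof (cases rule: follows_cases)
        case Ax
        then show ?thesis using less.prems(2) by (simp add: shift_Un)
      next
        case (Cut A B D E)
        then have "shift i B \<subseteq> C" using IH[of "(A, B)" i] less.prems(2) by (simp add: shift_Un)
        then show ?thesis using IH[of "(B \<union> D, E)" i] Cut less.prems(2) by (simp add: shift_Un)
      next
        case (Shf A B j)
        then show ?thesis using IH[of "(A, B)" "j + i"] less.prems(2) by (simp add: shift_shift)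
      qed
    qed
  qed
  from this[of "length ds - 1" i] show ?thesis using ds(1,2) assms(3) by (simp add: last_conv_nth)
qed

text \<open>Separated from \<open>provable\<close> since derivations, unlike proofs of one given
  formula, can be concatenated.\<close>

definition derivation :: "'y fml set \<Rightarrow> 'y fml list \<Rightarrow> bool" where
  "derivation \<Sigma> ds \<longleftrightarrow> (\<forall>k<length ds. ds ! k \<in> \<Sigma> \<or> follows (set (take k ds)) (ds ! k))"

lemma derivation_append:
  assumes "derivation \<Sigma> ds" "derivation \<Sigma> es" shows "derivation \<Sigma> (ds @ es)"
  unfolding derivation_def
proof (intro allI impI)
  fix k assume k: "k < length (ds @ es)"
  show "(ds @ es) ! k \<in> \<Sigma> \<or> follows (set (take k (ds @ es))) ((ds @ es) ! k)"
  proof (cases "k < length ds")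
    case True
    then show ?thesis using assms(1) by (simp add: derivation_def nth_append)
  next
    case False
    then have "es ! (k - length ds) \<in> \<Sigma> \<or> follows (set (take (k - length ds) es)) (es ! (k - length ds))"
      using assms(2) k by (simp add: derivation_def)
    moreover have "set (take (k - length ds) es) \<subseteq> set (take k (ds @ es))" by simp
    moreover have eq: "(ds @ es) ! k = es ! (k - length ds)" using False by (simp add: nth_append)
    ultimately show ?thesis unfolding eq using follows_mono by blast
  qed
qed

lemma derivation_snoc:
  assumes "derivation \<Sigma> ds" "\<phi> \<in> \<Sigma> \<or> follows (set ds) \<phi>" shows "derivation \<Sigma> (ds @ [\<phi>])"
  using assms by (auto simp: derivation_def nth_append less_Suc_eq)

lemma provable_iff: "provable \<Sigma> \<phi> \<longleftrightarrow> (\<exists>ds. derivation \<Sigma> (ds @ [\<phi>]))"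
proof
  assume "provable \<Sigma> \<phi>"
  then obtain ds where "ds \<noteq> [] \<and> last ds = \<phi> \<and> derivation \<Sigma> ds"
    unfolding provable_def derivation_def by (elim exE)
  then have "derivation \<Sigma> (butlast ds @ [\<phi>])" using append_butlast_last_id[of ds] by simp
  then show "\<exists>ds. derivation \<Sigma> (ds @ [\<phi>])" by blast
next
  assume "\<exists>ds. derivation \<Sigma> (ds @ [\<phi>])"
  then obtain ds where "derivation \<Sigma> (ds @ [\<phi>])" by blast
  then show "provable \<Sigma> \<phi>" unfolding provable_def derivation_def by (intro exI[of _ "ds @ [\<phi>]"]) simp
qed

lemma provable_mem: "\<phi> \<in> \<Sigma> \<Longrightarrow> provable \<Sigma> \<phi>"
  unfolding provable_iff by (intro exI[of _ "[]"]) (simp add: derivation_def)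

lemma provable_follows1:
  assumes "follows {\<psi>} \<phi>" "provable \<Sigma> \<psi>" shows "provable \<Sigma> \<phi>"
proof -
  obtain ds where "derivation \<Sigma> (ds @ [\<psi>])" using assms(2) unfolding provable_iff by blast
  then have "derivation \<Sigma> ((ds @ [\<psi>]) @ [\<phi>])"
    by (rule derivation_snoc) (use follows_mono[OF assms(1)] in auto)
  then show ?thesis unfolding provable_iff by blast
qed

lemma provable_follows2:
  assumes "follows {\<psi>, \<psi>'} \<phi>" "provable \<Sigma> \<psi>" "provable \<Sigma> \<psi>'" shows "provable \<Sigma> \<phi>"
proof -
  obtain ds es where "derivation \<Sigma> (ds @ [\<psi>])" "derivation \<Sigma> (es @ [\<psi>'])"
    using assms(2,3) unfolding provable_iff by blast
  then have "derivation \<Sigma> ((ds @ [\<psi>]) @ es @ [\<psi>'])" by (rule derivation_append)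
  then have "derivation \<Sigma> (((ds @ [\<psi>]) @ es @ [\<psi>']) @ [\<phi>])"
    by (rule derivation_snoc) (use follows_mono[OF assms(1)] in auto)
  then show ?thesis unfolding provable_iff by blast
qed

lemma provable_Ax: "finite A \<Longrightarrow> finite B \<Longrightarrow> provable \<Sigma> (A \<union> B, A)"
  unfolding provable_iff by (intro exI[of _ "[]"]) (simp add: derivation_def follows_Ax)

lemma provable_Cut:
  assumes "finite A" "finite B" "finite C" "finite D" "provable \<Sigma> (A, B)" "provable \<Sigma> (B \<union> C, D)"
  shows "provable \<Sigma> (A \<union> C, D)"
  by (rule provable_follows2[OF _ assms(5,6)], rule follows_Cut[OF assms(1-4)]) simp_all

lemma provable_Shf:
  assumes "finite A" "finite B" "provable \<Sigma> (A, B)" shows "provable \<Sigma> (shift i A, shift i B)"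
  by (rule provable_follows1[OF _ assms(3)], rule follows_Shf[OF assms(1,2)]) simp

text \<open>Cutting the shifted formula E => F with an instance of (Ax) that contains
  \<open>X\<close> on both sides gives E \<union> X => X \<union> F. As E lies in \<open>X\<close>,
  the left side is just \<open>X\<close>, and a second cut chains this to A => X.\<close>

lemma provable_extend:
  assumes fin: "finite A" "finite X" and prov: "provable \<Sigma> (A, X)" and g: "g \<in> \<Sigma>" "is_fml g"
    and sub: "shift i (fst g) \<subseteq> X"
  shows "provable \<Sigma> (A, X \<union> shift i (snd g))"
proof -
  obtain E F where EF: "g = (E, F)" "finite E" "finite F" using g(2) by (cases g) (auto simp: is_fml_def)
  have "provable \<Sigma> (shift i E, shift i F)"
    using provable_Shf[OF EF(2,3) provable_mem, of \<Sigma> i] g(1) EF(1) by simp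
  moreover have "provable \<Sigma> (shift i F \<union> X, X \<union> shift i F)"
    using provable_Ax[of "X \<union> shift i F" "{}" \<Sigma>] fin EF by (simp add: Un_commute)
  ultimately have "provable \<Sigma> (shift i E \<union> X, X \<union> shift i F)"
    using fin EF by (intro provable_Cut[of "shift i E" "shift i F" X]) auto
  moreover have "shift i E \<union> X = X \<union> {}" using sub EF by auto
  ultimately have "provable \<Sigma> (A \<union> {}, X \<union> shift i F)"
    using fin EF prov by (intro provable_Cut[of A X "{}"]) auto
  then show ?thesis using EF by simp
qed

section \<open>Forward chaining in a finite window\<close>

definition fire :: "'y fml \<Rightarrow> int \<Rightarrow> 'y tattr set \<Rightarrow> 'y tattr set" where
  "fire g i C = (if shift i (fst g) \<subseteq> C then C \<union> shift i (snd g) else C)"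

text \<open>One round. Conclusions are available at once to later formulas and shifts of the same
  round, which is how the machine works when it overwrites its timelines.\<close>

definition saturate :: "'y fml list \<Rightarrow> int list \<Rightarrow> 'y tattr set \<Rightarrow> 'y tattr set" where
  "saturate gs js C = fold (\<lambda>i C. fold (\<lambda>g. fire g i) gs C) js C"

lemma fire_inc: "C \<subseteq> fire g i C"
  by (auto simp: fire_def)

lemma fold_inc: "(\<And>x C. C \<subseteq> f x C) \<Longrightarrow> C \<subseteq> fold f xs C"
  by (induction xs arbitrary: C) (auto, blast)

lemma saturate_inc: "C \<subseteq> saturate gs js C"
  unfolding saturate_def by (intro fold_inc fire_inc)

lemma saturate_fires:
  assumes "g \<in> set gs" "i \<in> set js" "shift i (fst g) \<subseteq> C"
  shows "shift i (snd g) \<subseteq> saturate gs js C"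
proof -
  obtain js1 js2 where js: "js = js1 @ i # js2" using assms(2) by (meson split_list)
  obtain gs1 gs2 where gs: "gs = gs1 @ g # gs2" using assms(1) by (meson split_list)
  let ?F = "\<lambda>i C. fold (\<lambda>g. fire g i) gs C"
  let ?C1 = "fold (\<lambda>g. fire g i) gs1 (fold ?F js1 C)"
  have "C \<subseteq> fold ?F js1 C" by (intro fold_inc fire_inc)
  also have "\<dots> \<subseteq> ?C1" by (intro fold_inc fire_inc)
  finally have "shift i (snd g) \<subseteq> fire g i ?C1" using assms(3) by (auto simp: fire_def)
  also have "\<dots> \<subseteq> fold (\<lambda>g. fire g i) gs2 (fire g i ?C1)" by (intro fold_inc fire_inc)
  also have "\<dots> = ?F i (fold ?F js1 C)" by (simp add: gs)
  also have "\<dots> \<subseteq> fold ?F js2 (?F i (fold ?F js1 C))" by (intro fold_inc fire_inc)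
  also have "\<dots> = saturate gs js C" by (simp add: saturate_def js)
  finally show ?thesis .
qed

lemma saturate_provable:
  assumes "finite A" "\<And>g. g \<in> set gs \<Longrightarrow> is_fml g" "finite C \<and> provable (set gs) (A, C)"
  shows "finite (saturate gs js C) \<and> provable (set gs) (A, saturate gs js C)"
proof -
  have fire: "finite (fire g i C) \<and> provable (set gs) (A, fire g i C)"
    if "g \<in> set gs" "finite C \<and> provable (set gs) (A, C)" for g i C
    using that assms(1,2) provable_extend[of A C "set gs" g i] by (auto simp: fire_def is_fml_def)
  have "set hs \<subseteq> set gs \<Longrightarrow> finite C \<and> provable (set gs) (A, C) \<Longrightarrow>
      finite (fold (\<lambda>g. fire g i) hs C) \<and> provable (set gs) (A, fold (\<lambda>g. fire g i) hs C)" for hs i C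
    by (induction hs arbitrary: C) (use fire in auto)
  then show ?thesis unfolding saturate_def using assms(3)
    by (induction js arbitrary: C) auto
qed

text \<open>A round that changes the trace on \<open>W\<close> adds an element of \<open>W\<close>,
  which can happen at most \<open>K\<close> times. Only the trace is claimed to become stationary;
  outside \<open>W\<close> the sets may still grow at round \<open>r\<close>.\<close>

lemma stabilises:
  fixes C :: "nat \<Rightarrow> 'a set"
  assumes inc: "\<And>r. C r \<subseteq> C (Suc r)" and W: "finite W" "card W \<le> K"
  shows "\<exists>r\<le>K. C r \<inter> W = C (Suc r) \<inter> W"
proof (rule ccontr)
  assume no: "\<not> ?thesis"
  have "r \<le> Suc K \<Longrightarrow> r \<le> card (C r \<inter> W)" for r
  proof (induction r)
    case (Suc r)
    have "C r \<inter> W \<subset> C (Suc r) \<inter> W" using inc[of r] no Suc.prems by auto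
    then have "card (C r \<inter> W) < card (C (Suc r) \<inter> W)" using W(1) by (intro psubset_card_mono) auto
    then show ?case using Suc by simp
  qed simp
  then have "Suc K \<le> card (C (Suc K) \<inter> W)" by blast
  also have "\<dots> \<le> card W" using W(1) by (intro card_mono) auto
  finally show False using W(2) by simp
qed

text \<open>In a predictive theory premises never lie later than conclusions, so elements later than \<open>N\<close>
  cannot contribute to those up to \<open>N\<close>, and adding all of them yields a closed set.\<close>

theorem provable_iff_saturate:
  fixes gs :: "('y::finite) fml list"
  assumes fml: "\<And>g. g \<in> set gs \<Longrightarrow> is_fml g" "finite A" "finite B"
    and pre: "\<And>g. g \<in> set gs \<Longrightarrow> predictive g" "predictive (A, B)"
    and bound: "\<And>g y e. g \<in> set gs \<Longrightarrow> (y, e) \<in> fst g \<Longrightarrow> \<bar>e\<bar> \<le> int N"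
      "\<And>y e. (y, e) \<in> A \<union> B \<Longrightarrow> \<bar>e\<bar> \<le> int N"
    and js: "{- 2 * int N..2 * int N} \<subseteq> set js" and K: "card (UNIV :: 'y set) * (2 * N + 1) \<le> K"
  shows "provable (set gs) (A, B) \<longleftrightarrow> B \<subseteq> (saturate gs js ^^ K) A"
proof
  let ?C = "\<lambda>r. (saturate gs js ^^ r) A"
  have C: "finite (?C r) \<and> provable (set gs) (A, ?C r)" for r
  proof (induction r)
    case 0
    then show ?case using fml(2) provable_Ax[of A "{}"] by simp
  next
    case (Suc r)
    then show ?case using saturate_provable[OF fml(2) fml(1)] by simp
  qed
  assume "B \<subseteq> ?C K"
  then have "?C K = B \<union> ?C K" by blast
  then have "provable (set gs) (?C K \<union> {}, B)" using provable_Ax[of B "?C K"] fml(3) C[of K] by simp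
  then have "provable (set gs) (A \<union> {}, B)" using C[of K] fml by (intro provable_Cut[of A "?C K" "{}"]) auto
  then show "provable (set gs) (A, B)" by simp
next
  let ?C = "\<lambda>r. (saturate gs js ^^ r) A"
  let ?W = "(UNIV :: 'y set) \<times> {- int N..int N}"
  assume prov: "provable (set gs) (A, B)"
  have inc: "?C r \<subseteq> ?C (Suc r)" for r using saturate_inc by auto
  then have mono: "r \<le> s \<Longrightarrow> ?C r \<subseteq> ?C s" for r s by (rule lift_Suc_mono_le)
  have "card ?W = card (UNIV :: 'y set) * (2 * N + 1)" by (simp add: card_cartesian_product nat_add_distrib)
  then obtain r where r: "r \<le> K" "?C r \<inter> ?W = ?C (Suc r) \<inter> ?W"
    using stabilises[of ?C ?W K, OF inc] K by auto
  define X where "X = (?C r \<inter> ?W) \<union> {(y, k). k > int N}"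
  have "closed_under (set gs) X"
    unfolding closed_under_def
  proof (intro ballI allI impI subsetI)
    fix g i p assume g: "g \<in> set gs" and E: "shift i (fst g) \<subseteq> X" and p: "p \<in> shift i (snd g)"
    obtain y k where yk: "p = (y, k)" by (cases p)
    show "p \<in> X"
    proof (cases "k > int N")
      case True
      then show ?thesis by (simp add: X_def yk)
    next
      case False
      have le: "j \<le> k" if "(x, j) \<in> shift i (fst g)" for x j
        using pre(1)[OF g] that p unfolding predictive_def yk mem_shift by force
      \<comment> \<open>Premises are at most \<open>k\<close>, hence at most N, so none of them is
        taken from the late part of \<open>X\<close>.\<close>
      have E_sub: "shift i (fst g) \<subseteq> ?C r \<inter> ?W"
        using E le False unfolding X_def by fastforce
      \<comment> \<open>Predictivity provides a premise. Its time point is within N of zero both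
        before and after the shift, which bounds the shift by 2 * N.\<close>
      obtain x e where xe: "(x, e) \<in> fst g" using pre(1)[OF g] by (auto simp: predictive_def)
      then have "(x, e + i) \<in> shift i (fst g)" by (simp add: mem_shift)
      then have "(x, e + i) \<in> ?W" and xk: "e + i \<le> k" using E_sub le by blast+
      then have xW: "\<bar>e + i\<bar> \<le> int N" by auto
      then have "i \<in> {- 2 * int N..2 * int N}" using bound(1)[OF g xe] by auto
      then have "i \<in> set js" using js by (rule rev_subsetD)
      then have "shift i (snd g) \<subseteq> ?C (Suc r)"
        using saturate_fires[OF g, of i js "?C r"] E_sub by auto
      \<comment> \<open>The conclusion respects the lower end of the window because -N \<le> e + i
        \<le> k.\<close>
      then have "p \<in> ?C (Suc r) \<inter> ?W" using p xW xk False by (auto simp: yk)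
      then show ?thesis using r(2) by (simp add: X_def)
    qed
  qed
  moreover have "A \<subseteq> X" using bound(2) mono[of 0 r] by (force simp: X_def)
  ultimately have "B \<subseteq> X" using provable_sound[OF prov, of X 0] by simp
  then have "B \<subseteq> ?C r" using bound(2) by (force simp: X_def)
  then show "B \<subseteq> ?C K" using mono[OF r(1)] by blast
qed

section \<open>Recognising encodings\<close>

declare bin.simps [simp del]

lemma bin_step: "1 \<le> n \<Longrightarrow> bin (2 * n) = bin n @ [Bit0]" "1 \<le> n \<Longrightarrow> bin (2 * n + 1) = bin n @ [Bit1]"
  by (subst bin.simps, simp)+

lemma bin_01 [simp]: "bin 0 = [Bit0]" "bin 1 = [Bit1]" "bin (Suc 0) = [Bit1]"
  by (simp_all add: bin.simps)

text \<open>Induction over the digits behind the leading one. The condition \<open>1 \<le> n\<close>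
  rules out a leading zero, for which \<open>bin_step\<close> would fail.\<close>

lemma bin_induct [case_names zero one even odd]:
  assumes "P 0" "P 1" "\<And>n. 1 \<le> n \<Longrightarrow> P n \<Longrightarrow> P (2 * n)" "\<And>n. 1 \<le> n \<Longrightarrow> P n \<Longrightarrow> P (2 * n + 1)"
  shows "P (n :: nat)"
proof (induction n rule: less_induct)
  case (less n)
  consider "n = 0" | "n = 1" | m where "1 \<le> m" "n = 2 * m" | m where "1 \<le> m" "n = 2 * m + 1"
  proof (cases "n < 2")
    case False
    then have "1 \<le> n div 2" by simp
    moreover have "n = 2 * (n div 2) \<or> n = 2 * (n div 2) + 1" by linarith
    ultimately show ?thesis using that(3,4) by blast
  qed (use that(1,2) in linarith)
  then show ?case
  proof cases
    case (3 m)
    then show ?thesis using assms(3) less.IH[of m] by simp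
  next
    case (4 m)
    then show ?thesis using assms(4)[OF 4(1) less.IH[of m]] by simp
  qed (use assms(1,2) in simp_all)
qed

lemma enc_term_0: "enc_term (y, 0) = [Att y, Bit0]"
  by (simp add: enc_term_def enc_int_def)

lemma enc_term_pos: "enc_term (y, int n) = Att y # bin n"
  by (simp add: enc_term_def enc_int_def)

lemma enc_term_neg: "1 \<le> n \<Longrightarrow> enc_term (y, - int n) = Att y # Neg # bin n"
  by (simp add: enc_term_def enc_int_def)

lemma enc_term_cases:
  obtains y n where "t = (y, int n)" | y n where "t = (y, - int n)" "1 \<le> n"
proof (cases "0 \<le> snd t")
  case True
  then show ?thesis using that(1)[of "fst t" "nat (snd t)"] by simp
next
  case False
  then show ?thesis using that(2)[of "fst t" "nat (- snd t)"] by (simp add: prod_eq_iff)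
qed

text \<open>A state of the automaton is a pair. The first component describes the position inside a term:
  \<open>Semi\<close> before a term or after a zero, \<open>Arrow\<close> after the attribute, \<open>Neg\<close> after the sign, \<open>Bit1\<close>
  inside a nonzero numeral. The second component is \<open>Semi\<close> in a premise and \<open>Arrow\<close> in a conclusion.\<close>

fun dfa :: "'y sym \<times> 'y sym \<Rightarrow> 'y sym \<Rightarrow> ('y sym \<times> 'y sym) option" where
  "dfa (q, d) (Att y) = (if q = Semi \<or> q = Bit1 then Some (Arrow, d) else None)"
| "dfa (q, d) Neg = (if q = Arrow then Some (Neg, d) else None)"
| "dfa (q, d) Bit0 = (if q = Arrow then Some (Semi, d) else if q = Bit1 then Some (Bit1, d) else None)"
| "dfa (q, d) Bit1 = (if q = Arrow \<or> q = Neg \<or> q = Bit1 then Some (Bit1, d) else None)"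
| "dfa (q, d) Arrow = (if (q = Semi \<or> q = Bit1) \<and> d = Semi then Some (Semi, Arrow) else None)"
| "dfa (q, d) Semi = (if (q = Semi \<or> q = Bit1) \<and> d = Arrow then Some (Semi, Semi) else None)"

fun accepting :: "'y sym \<times> 'y sym \<Rightarrow> bool" where
  "accepting (q, d) \<longleftrightarrow> (q = Semi \<or> q = Bit1) \<and> d = Arrow"

fun dfa_accepts :: "'y sym \<times> 'y sym \<Rightarrow> 'y sym list \<Rightarrow> bool" where
  "dfa_accepts p [] = accepting p"
| "dfa_accepts p (s # w) = (case dfa p s of None \<Rightarrow> False | Some p' \<Rightarrow> dfa_accepts p' w)"

abbreviation enc_terms :: "'y tattr list \<Rightarrow> 'y sym list" where
  "enc_terms ts \<equiv> concat (map enc_term ts)"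

text \<open>The possible remainders of an encoding at a term boundary. Inside a premise such a
  remainder is again a full encoding, that of the same input with the first terms removed; inside a
  conclusion it is a list of terms, followed either by nothing or by \<open>Semi\<close> and a full
  encoding.\<close>

definition suffixes :: "'y sym \<Rightarrow> 'y sym list set" where
  "suffixes d = (if d = Semi then {enc_input \<Sigma>s f | \<Sigma>s f. True}
     else {enc_terms us | us. True} \<union> {enc_terms us @ Semi # enc_input \<Sigma>s f | us \<Sigma>s f. True})"

lemma suffixes_Nil: "[] \<in> suffixes Arrow"
proof -
  have "[] \<in> {enc_terms us | us. True}" by (intro CollectI exI[of _ "[]"]) simp
  then show ?thesis by (simp add: suffixes_def)
qed

lemma suffixes_Semi: assumes "w \<in> suffixes Semi" shows "Semi # w \<in> suffixes Arrow"
proof -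
  obtain \<Sigma>s f where "w = enc_input \<Sigma>s f" using assms by (auto simp: suffixes_def)
  then have "Semi # w = enc_terms [] @ Semi # enc_input \<Sigma>s f" by simp
  then have "Semi # w \<in> {enc_terms us @ Semi # enc_input \<Sigma>s f | us \<Sigma>s f. True}" by blast
  then show ?thesis by (simp add: suffixes_def)
qed

lemma enc_input_Cons: "enc_input ((a, b) # \<Sigma>s) f = enc_terms a @ Arrow # enc_terms b @ Semi # enc_input \<Sigma>s f"
  by (simp add: enc_input_def enc_fml_def)

lemma enc_input_Nil: "enc_input [] (a, b) = enc_terms a @ Arrow # enc_terms b"
  by (simp add: enc_input_def enc_fml_def)

lemma suffixes_Arrow: assumes "w \<in> suffixes Arrow" shows "Arrow # w \<in> suffixes Semi"
proof -
  from assms consider us where "w = enc_terms us" | us \<Sigma>s f where "w = enc_terms us @ Semi # enc_input \<Sigma>s f"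
    by (auto simp: suffixes_def)
  then have "\<exists>\<Sigma>s f. Arrow # w = enc_input \<Sigma>s f"
  proof cases
    case (1 us)
    then have "Arrow # w = enc_input [] ([], us)" by (simp add: enc_input_Nil)
    then show ?thesis by blast
  next
    case (2 us \<Sigma>s f)
    then have "Arrow # w = enc_input (([], us) # \<Sigma>s) f" by (simp add: enc_input_Cons)
    then show ?thesis by blast
  qed
  then show ?thesis by (simp add: suffixes_def)
qed

lemma suffixes_term:
  assumes "w \<in> suffixes d" shows "enc_term t @ w \<in> suffixes d"
proof (cases "d = Semi")
  case True
  then obtain \<Sigma>s f where w: "w = enc_input \<Sigma>s f" using assms by (auto simp: suffixes_def)
  have "\<exists>\<Sigma>s f. enc_term t @ w = enc_input \<Sigma>s f"
  proof (cases \<Sigma>s)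
    case Nil
    then have "enc_term t @ w = enc_input [] (t # fst f, snd f)"
      using w by (cases f) (simp add: enc_input_Nil)
    then show ?thesis by blast
  next
    case (Cons g \<Sigma>s')
    then have "enc_term t @ w = enc_input ((t # fst g, snd g) # \<Sigma>s') f"
      using w by (cases g) (simp add: enc_input_Cons)
    then show ?thesis by blast
  qed
  then show ?thesis using True by (simp add: suffixes_def)
next
  case False
  from assms False consider us where "w = enc_terms us" | us \<Sigma>s f where "w = enc_terms us @ Semi # enc_input \<Sigma>s f"
    by (auto simp: suffixes_def)
  then have "(\<exists>us. enc_term t @ w = enc_terms us) \<or>
      (\<exists>us \<Sigma>s f. enc_term t @ w = enc_terms us @ Semi # enc_input \<Sigma>s f)"
  proof cases
    case (1 us)
    then have "enc_term t @ w = enc_terms (t # us)" by simp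
    then show ?thesis by blast
  next
    case (2 us \<Sigma>s f)
    then have "enc_term t @ w = enc_terms (t # us) @ Semi # enc_input \<Sigma>s f" by simp
    then show ?thesis by blast
  qed
  then show ?thesis using False by (simp add: suffixes_def)
qed

text \<open>In the middle of a term the remaining word makes sense only together with what has been
  read of that term. For the induction every state therefore puts this part back in front of
  \<open>w\<close>; in state \<open>Bit1\<close> it is an arbitrary nonzero numeral.\<close>

lemma dfa_sound:
  assumes "dfa_accepts (q, d) w" "d = Semi \<or> d = Arrow"
  shows "(q = Semi \<longrightarrow> w \<in> suffixes d) \<and> (q = Arrow \<longrightarrow> (\<forall>y. Att y # w \<in> suffixes d)) \<and>
    (q = Neg \<longrightarrow> (\<forall>y. Att y # Neg # w \<in> suffixes d)) \<and>
    (q = Bit1 \<longrightarrow> (\<forall>y n. 1 \<le> n \<longrightarrow> Att y # bin n @ w \<in> suffixes d \<and> Att y # Neg # bin n @ w \<in> suffixes d))"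
  using assms
proof (induction w arbitrary: q d)
  case Nil
  then have d: "d = Arrow" "q = Semi \<or> q = Bit1" by auto
  have "Att y # bin n @ [] \<in> suffixes d \<and> Att y # Neg # bin n @ [] \<in> suffixes d" if "1 \<le> n" for y n
    using suffixes_term[OF suffixes_Nil, of "(y, int n)"] suffixes_term[OF suffixes_Nil, of "(y, - int n)"]
    by (simp add: d enc_term_pos enc_term_neg[OF that])
  then show ?case using d suffixes_Nil by auto
next
  case (Cons s w)
  obtain q' d' where p: "dfa (q, d) s = Some (q', d')" "dfa_accepts (q', d') w"
    using Cons.prems(1) by (auto split: option.splits)
  have end_num: "Att y # bin n @ s # w \<in> suffixes d \<and> Att y # Neg # bin n @ s # w \<in> suffixes d"
    if "s # w \<in> suffixes d" "1 \<le> n" for y n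
    using suffixes_term[OF that(1), of "(y, int n)"] suffixes_term[OF that(1), of "(y, - int n)"]
    by (simp add: enc_term_pos enc_term_neg[OF that(2)])
  show ?case
  proof (cases s)
    case (Att y)
    then have q: "q = Semi \<or> q = Bit1" "q' = Arrow" "d' = d" using p(1) by (auto split: if_splits)
    then have "s # w \<in> suffixes d" using Cons.IH[OF p(2)] Cons.prems(2) Att by simp
    then show ?thesis using q(1) end_num by auto
  next
    case Bit0
    then consider "q = Arrow" "q' = Semi" "d' = d" | "q = Bit1" "q' = Bit1" "d' = d"
      using p(1) by (auto split: if_splits)
    then show ?thesis
    proof cases
      case 1
      then have "w \<in> suffixes d" using Cons.IH[OF p(2)] Cons.prems(2) by simp
      then have "Att y # s # w \<in> suffixes d" for y using suffixes_term[of w d "(y, 0)"]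
        by (simp add: enc_term_0 Bit0)
      then show ?thesis using 1 by simp
    next
      case 2
      have "Att y # bin n @ s # w \<in> suffixes d \<and> Att y # Neg # bin n @ s # w \<in> suffixes d"
        if "1 \<le> n" for y n
      proof -
        \<comment> \<open>The bit just read belongs to the numeral: \<open>bin n\<close> followed by
          it is \<open>bin (2 * n)\<close>.\<close>
        have "1 \<le> 2 * n" using that by simp
        then have "Att y # bin (2 * n) @ w \<in> suffixes d \<and> Att y # Neg # bin (2 * n) @ w \<in> suffixes d"
          using Cons.IH[OF p(2)] Cons.prems(2) 2 by blast
        then show ?thesis by (simp add: bin_step(1)[OF that] Bit0)
      qed
      then show ?thesis using 2 by simp
    qed
  next
    case Bit1
    then have q: "q = Arrow \<or> q = Neg \<or> q = Bit1" and q': "q' = Bit1" "d' = d"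
      using p(1) by (auto split: if_splits)
    then have IH: "Att y # bin n @ w \<in> suffixes d \<and> Att y # Neg # bin n @ w \<in> suffixes d"
      if "1 \<le> n" for y n
      using Cons.IH[OF p(2)] Cons.prems(2) that by blast
    have 1: "Att y # s # w \<in> suffixes d \<and> Att y # Neg # s # w \<in> suffixes d" for y
      using IH[of 1 y] by (simp add: Bit1)
    have 2: "Att y # bin n @ s # w \<in> suffixes d \<and> Att y # Neg # bin n @ s # w \<in> suffixes d"
      if "1 \<le> n" for y n
    proof -
      have "1 \<le> 2 * n + 1" by simp
      from IH[OF this, of y] show ?thesis by (simp only: bin_step(2)[OF that] Bit1) simp
    qed
    show ?thesis using q 1 2 by auto
  next
    case Neg
    then have "q = Arrow" "q' = Neg" "d' = d" using p(1) by (auto split: if_splits)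
    then show ?thesis using Cons.IH[OF p(2)] Cons.prems(2) Neg by simp
  next
    case Arrow
    then have q: "q = Semi \<or> q = Bit1" "d = Semi" "q' = Semi" "d' = Arrow" using p(1) by (auto split: if_splits)
    then have "s # w \<in> suffixes d" using Cons.IH[OF p(2)] suffixes_Arrow Arrow by simp
    then show ?thesis using q(1) end_num by auto
  next
    case Semi
    then have q: "q = Semi \<or> q = Bit1" "d = Arrow" "q' = Semi" "d' = Semi" using p(1) by (auto split: if_splits)
    then have "s # w \<in> suffixes d" using Cons.IH[OF p(2)] suffixes_Semi Semi by simp
    then show ?thesis using q(1) end_num by auto
  qed
qed

lemma dfa_bin:
  assumes "1 \<le> n" "q = Arrow \<or> q = Neg"
  shows "dfa_accepts (q, d) (bin n @ w) = dfa_accepts (Bit1, d) w"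
  using assms(1)
proof (induction n arbitrary: w rule: bin_induct)
  case one
  then show ?case using assms(2) by auto
next
  case (even n)
  then show ?case by (simp only: bin_step append_assoc) simp
next
  case (odd n)
  then show ?case by (simp only: bin_step append_assoc) simp
qed simp

lemma dfa_term:
  assumes "q = Semi \<or> q = Bit1"
  shows "\<exists>q'. (q' = Semi \<or> q' = Bit1) \<and> dfa_accepts (q, d) (enc_term t @ w) = dfa_accepts (q', d) w"
proof (cases t rule: enc_term_cases)
  case (1 y n)
  show ?thesis
  proof (cases "n = 0")
    case True
    then show ?thesis using assms 1 by (intro exI[of _ Semi]) (auto simp: enc_term_0)
  next
    case False
    then show ?thesis using assms 1 dfa_bin[of n Arrow d w] by (intro exI[of _ Bit1]) (auto simp: enc_term_pos)
  qed
next
  case (2 y n)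
  then show ?thesis using assms dfa_bin[of n Neg d w]
    by (intro exI[of _ Bit1]) (auto simp: enc_term_neg)
qed

lemma dfa_terms:
  assumes "q = Semi \<or> q = Bit1"
  shows "\<exists>q'. (q' = Semi \<or> q' = Bit1) \<and> dfa_accepts (q, d) (enc_terms ts @ w) = dfa_accepts (q', d) w"
  using assms
proof (induction ts arbitrary: q)
  case (Cons t ts)
  obtain q1 where q1: "q1 = Semi \<or> q1 = Bit1"
    "dfa_accepts (q, d) (enc_term t @ enc_terms ts @ w) = dfa_accepts (q1, d) (enc_terms ts @ w)"
    using dfa_term[OF Cons.prems] by metis
  then show ?case using Cons.IH[OF q1(1)] by simp
qed auto

lemma dfa_complete: "q = Semi \<or> q = Bit1 \<Longrightarrow> dfa_accepts (q, Semi) (enc_input \<Sigma>s f)"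
proof (induction \<Sigma>s arbitrary: q)
  case Nil
  obtain a b where f: "f = (a, b)" by (cases f)
  from dfa_terms[OF Nil, of Semi a "Arrow # enc_terms b"]
  have "dfa_accepts (q, Semi) (enc_input [] f) = dfa_accepts (Semi, Arrow) (enc_terms b)"
    unfolding f enc_input_Nil by fastforce
  moreover from dfa_terms[of Semi Arrow b "[]"] have "dfa_accepts (Semi, Arrow) (enc_terms b)"
    by fastforce
  ultimately show ?case by blast
next
  case (Cons g \<Sigma>s)
  obtain a b where g: "g = (a, b)" by (cases g)
  let ?w = "enc_input \<Sigma>s f"
  from dfa_terms[OF Cons.prems, of Semi a "Arrow # enc_terms b @ Semi # ?w"]
  have "dfa_accepts (q, Semi) (enc_input (g # \<Sigma>s) f) = dfa_accepts (Semi, Arrow) (enc_terms b @ Semi # ?w)"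
    unfolding g enc_input_Cons by fastforce
  also from dfa_terms[of Semi Arrow b "Semi # ?w"]
  have "\<dots> = dfa_accepts (Semi, Semi) ?w" by fastforce
  finally show ?case using Cons.IH[of Semi] by blast
qed

theorem dfa_accepts_iff: "dfa_accepts (Semi, Semi) w \<longleftrightarrow> (\<exists>\<Sigma>s f. w = enc_input \<Sigma>s f)"
  using dfa_sound[of Semi Semi w] dfa_complete[of Semi] by (auto simp: suffixes_def)

section \<open>Magnitude\<close>

lemma bin_val_append: "bin_val (xs @ ys) = bin_val xs * 2 ^ length ys + bin_val ys"
  by (induction xs) (auto simp: algebra_simps power_add)

lemma bin_val_bin [simp]: "bin_val (bin n) = n"
proof (induction n rule: bin_induct)
  case (even n)
  then show ?case by (simp add: bin_step bin_val_append)
next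
  case (odd n)
  then show ?case by (simp only: bin_step bin_val_append) simp
qed simp_all

lemma set_bin: "set (bin n) \<subseteq> {Bit0, Bit1}"
proof (induction n rule: bin_induct)
  case (even n)
  then show ?case by (simp add: bin_step)
next
  case (odd n)
  then show ?case by (simp only: bin_step) simp
qed simp_all

lemma le_magnitude:
  fixes u v :: "'y sym list"
  shows "n \<le> magnitude (u @ bin n @ v)"
proof -
  let ?w = "u @ bin n @ v"
  let ?M = "{bin_val ds | ds u v. ?w = u @ ds @ v \<and> set ds \<subseteq> {Bit0, Bit1}}"
  \<comment> \<open>\<open>Max\<close> is meaningful for finite sets only; the factors of
    \<open>?w\<close> in question are words of bounded length over two letters.\<close>
  have "?M \<subseteq> bin_val ` {ds :: 'y sym list. set ds \<subseteq> {Bit0, Bit1} \<and> length ds \<le> length ?w}"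
  proof
    fix m assume "m \<in> ?M"
    then obtain ds u' v' where ds: "m = bin_val ds" "?w = u' @ ds @ v'" "set ds \<subseteq> {Bit0, Bit1}" by blast
    have "length ds \<le> length ?w" unfolding ds(2) by simp
    then show "m \<in> bin_val ` {ds :: 'y sym list. set ds \<subseteq> {Bit0, Bit1} \<and> length ds \<le> length ?w}"
      unfolding ds(1) using ds(3) by (intro imageI CollectI conjI)
  qed
  then have fin: "finite ({0} \<union> ?M)"
    using finite_lists_length_le[of "{Bit0, Bit1 :: 'y sym}" "length ?w"] by (simp add: finite_subset)
  have "bin_val (bin n :: 'y sym list) \<in> ?M" using set_bin by blast
  then have "n \<in> {0} \<union> ?M" by simp
  then show ?thesis unfolding magnitude_def using fin by (rule Max_ge[rotated])
qed

lemma abs_le_magnitude: "nat \<bar>snd t\<bar> \<le> magnitude (u @ enc_term t @ v)"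
proof (cases t rule: enc_term_cases)
  case (1 y n)
  then show ?thesis using le_magnitude[of n "u @ [Att y]" v] by (simp add: enc_term_pos)
next
  case (2 y n)
  then show ?thesis using le_magnitude[of n "u @ [Att y, Neg]" v] by (simp add: enc_term_neg)
qed

lemma term_le_magnitude:
  assumes "(a, b) \<in> set (\<Sigma>s @ [f])" "t \<in> set a \<union> set b"
  shows "nat \<bar>snd t\<bar> \<le> magnitude (enc_input \<Sigma>s f)"
proof -
  have terms: "\<exists>u v. enc_terms ts = u @ enc_term t @ v" if t: "t \<in> set ts" for ts
  proof -
    obtain ts1 ts2 where "ts = ts1 @ t # ts2" using t by (meson split_list)
    then have "enc_terms ts = enc_terms ts1 @ enc_term t @ enc_terms ts2" by simp
    then show ?thesis by blast
  qed
  have fml: "\<exists>u v. enc_fml (a, b) = u @ enc_term t @ v"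
  proof (cases "t \<in> set a")
    case True
    then obtain u v where "enc_terms a = u @ enc_term t @ v" using terms by blast
    then have "enc_fml (a, b) = u @ enc_term t @ (v @ Arrow # enc_terms b)" by (simp add: enc_fml_def)
    then show ?thesis by blast
  next
    case False
    then obtain u v where "enc_terms b = u @ enc_term t @ v" using terms assms(2) by blast
    then have "enc_fml (a, b) = (enc_terms a @ Arrow # u) @ enc_term t @ v" by (simp add: enc_fml_def)
    then show ?thesis by blast
  qed
  have "\<exists>u v. enc_input \<Sigma>s f = u @ enc_fml (a, b) @ v"
  proof (cases "(a, b) = f")
    case True
    then have "enc_input \<Sigma>s f = concat (map (\<lambda>g. enc_fml g @ [Semi]) \<Sigma>s) @ enc_fml (a, b) @ []"
      by (simp add: enc_input_def)
    then show ?thesis by blast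
  next
    case False
    then have "(a, b) \<in> set \<Sigma>s" using assms(1) by auto
    then obtain \<Sigma>1 \<Sigma>2 where "\<Sigma>s = \<Sigma>1 @ (a, b) # \<Sigma>2" by (meson split_list)
    then have "enc_input \<Sigma>s f = concat (map (\<lambda>g. enc_fml g @ [Semi]) \<Sigma>1) @ enc_fml (a, b) @
        (Semi # concat (map (\<lambda>g. enc_fml g @ [Semi]) \<Sigma>2) @ enc_fml f)"
      by (simp add: enc_input_def)
    then show ?thesis by blast
  qed
  then obtain u v where uv: "enc_input \<Sigma>s f = u @ enc_fml (a, b) @ v" by blast
  obtain u' v' where "enc_fml (a, b) = u' @ enc_term t @ v'" using fml by blast
  then show ?thesis using abs_le_magnitude[of t "u @ u'" "v' @ v"] uv by simp
qed

section \<open>Programs that end in a verdict\<close>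

definition halts :: "('v, 'a) com \<Rightarrow> nat \<Rightarrow> ('v \<Rightarrow> 'a list) \<Rightarrow> bool \<Rightarrow> bool" where
  "halts c \<tau> \<sigma> b \<longleftrightarrow> (\<exists>t\<le>\<tau>. \<forall>K. \<exists>K' \<sigma>'. (sstep ^^ t) (c # K, \<sigma>) = (Halt b # K', \<sigma>'))"

lemma halts_mono: "halts c \<tau> \<sigma> b \<Longrightarrow> \<tau> \<le> \<tau>' \<Longrightarrow> halts c \<tau>' \<sigma> b"
  unfolding halts_def using le_trans by blast

lemma halts_Halt: "halts (Halt b) 0 \<sigma> b"
  unfolding halts_def by (rule exI[of _ 0]) simp

lemma halts_Seq:
  assumes "runs c1 t1 \<sigma> \<sigma>1" "halts c2 t2 \<sigma>1 b" shows "halts (c1 ;; c2) (t1 + t2 + 1) \<sigma> b"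
proof -
  obtain s1 where s1: "s1 \<le> t1" "\<And>K. (sstep ^^ s1) (c1 # K, \<sigma>) = (K, \<sigma>1)"
    using assms(1) unfolding runs_def by blast
  obtain s2 where s2: "s2 \<le> t2" "\<And>K. \<exists>K' \<sigma>'. (sstep ^^ s2) (c2 # K, \<sigma>1) = (Halt b # K', \<sigma>')"
    using assms(2) unfolding halts_def by blast
  have "\<exists>K' \<sigma>'. (sstep ^^ Suc (s1 + s2)) ((c1 ;; c2) # K, \<sigma>) = (Halt b # K', \<sigma>')" for K
  proof -
    obtain K' \<sigma>' where "(sstep ^^ s2) (c2 # K, \<sigma>1) = (Halt b # K', \<sigma>')" using s2(2) by blast
    moreover have "sstep ((c1 ;; c2) # K, \<sigma>) = (c1 # c2 # K, \<sigma>)" by (simp add: sstep_def)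
    ultimately show ?thesis using funpow_first[OF _ funpow_trans[OF s1(2)]] by blast
  qed
  then show ?thesis unfolding halts_def using s1(1) s2(1) by (intro exI[of _ "Suc (s1 + s2)"]) auto
qed

lemma halts_Pop:
  assumes "halts (f (hd_option (\<sigma> v))) t (\<sigma>(v := tl (\<sigma> v))) b" shows "halts (Pop v f) (t + 1) \<sigma> b"
proof -
  obtain s where s: "s \<le> t"
    "\<And>K. \<exists>K' \<sigma>'. (sstep ^^ s) (f (hd_option (\<sigma> v)) # K, \<sigma>(v := tl (\<sigma> v))) = (Halt b # K', \<sigma>')"
    using assms unfolding halts_def by blast
  have "\<exists>K' \<sigma>'. (sstep ^^ Suc s) (Pop v f # K, \<sigma>) = (Halt b # K', \<sigma>')" for K
  proof -
    obtain K' \<sigma>' where 2: "(sstep ^^ s) (f (hd_option (\<sigma> v)) # K, \<sigma>(v := tl (\<sigma> v))) = (Halt b # K', \<sigma>')"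
      using s(2)[of K] by (elim exE)
    have 1: "sstep (Pop v f # K, \<sigma>) = (f (hd_option (\<sigma> v)) # K, \<sigma>(v := tl (\<sigma> v)))"
      by (simp add: sstep_def)
    show ?thesis using funpow_first[OF 1 2] by (intro exI)
  qed
  then show ?thesis unfolding halts_def using s(1) by (intro exI[of _ "Suc s"]) auto
qed

lemma runs_eq: "runs c \<tau> \<sigma> \<sigma>1 \<Longrightarrow> \<sigma>1 = \<sigma>2 \<Longrightarrow> runs c \<tau> \<sigma> \<sigma>2"
  by simp

section \<open>Draining loops\<close>

fun pushall :: "('v \<times> 'a) list \<Rightarrow> ('v, 'a) com" where
  "pushall [] = Skip"
| "pushall ((v, a) # ps) = Push v a ;; pushall ps"

definition pushed :: "('v \<times> 'a) list \<Rightarrow> 'v \<Rightarrow> 'a list" where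
  "pushed ps u = rev (map snd (filter (\<lambda>p. fst p = u) ps))"

lemma pushed_simps [simp]: "pushed [] u = []"
  "pushed ((v, a) # ps) u = pushed ps u @ (if v = u then [a] else [])"
  by (simp_all add: pushed_def)

lemma runs_pushall: "runs (pushall ps) (2 * length ps + 1) \<sigma> (\<lambda>u. pushed ps u @ \<sigma> u)"
proof (induction ps arbitrary: \<sigma>)
  case Nil
  then show ?case using runs_Skip[of \<sigma>] by simp
next
  case (Cons p ps)
  obtain v a where p: "p = (v, a)" by (cases p)
  show ?case unfolding p pushall.simps
    by (rule runs_eq[OF runs_mono[OF runs_Seq[OF runs_Push Cons.IH]]]) (auto simp: fun_eq_iff)
qed

text \<open>The loops that shuffle data during conversion and counting all have this shape, so this
  closed form reduces each of them to a pointwise comparison of stores. The reversal occurs because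
  later symbols end up on top.\<close>

lemma runs_Drain_pushall:
  assumes "\<sigma> v = xs" "\<And>a. pushed (ps a) v = []" "\<And>a. length (ps a) \<le> k"
  shows "runs (Drain v (\<lambda>a. pushall (ps a))) (length xs * (2 * k + 2) + 1) \<sigma>
    (\<lambda>u. concat (rev (map (\<lambda>a. pushed (ps a) u) xs)) @ (if u = v then [] else \<sigma> u))"
  using assms(1)
proof (induction xs arbitrary: \<sigma>)
  case Nil
  have "(\<lambda>u. if u = v then [] else \<sigma> u) = \<sigma>" using Nil by auto
  then show ?case using runs_Drain_Nil[of \<sigma> v] Nil by simp
next
  case (Cons a as)
  let ?\<sigma>1 = "\<lambda>u. pushed (ps a) u @ (\<sigma>(v := as)) u"
  have 1: "runs (pushall (ps a)) (2 * k + 1) (\<sigma>(v := as)) ?\<sigma>1"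
    by (rule runs_mono[OF runs_pushall]) (use assms(3) in simp)
  have "(\<lambda>u. concat (rev (map (\<lambda>a. pushed (ps a) u) as)) @ (if u = v then [] else ?\<sigma>1 u)) =
      (\<lambda>u. concat (rev (map (\<lambda>a. pushed (ps a) u) (a # as))) @ (if u = v then [] else \<sigma> u))"
    using assms(2) by auto
  with Cons.IH[of ?\<sigma>1] assms(2)
  have 2: "runs (Drain v (\<lambda>a. pushall (ps a))) (length as * (2 * k + 2) + 1) ?\<sigma>1
      (\<lambda>u. concat (rev (map (\<lambda>a. pushed (ps a) u) (a # as))) @ (if u = v then [] else \<sigma> u))"
    by simp
  show ?case
    by (rule runs_mono[OF runs_Drain_Cons[where f = "\<lambda>a. pushall (ps a)", OF Cons.prems 1 2]]) simp
qed

section \<open>Syntax check\<close>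

text \<open>Theory, query, and two unary copies of N. Two are necessary because a sweep loops over
  \<open>CA\<close> inside the loop over \<open>CB\<close> that counts the rounds.\<close>

datatype ro = Sig | Qry | CA | CB

text \<open>One timeline per attribute for the set derived so far, and two on which the time points
  of the premise (\<open>ME\<close>) and the conclusion (\<open>MF\<close>) of a single formula are
  marked.\<close>

datatype 'y track = At 'y | ME | MF

text \<open>\<open>Sd\<close>: inside a conclusion; \<open>No\<close>: some premise is absent;
  \<open>Bad\<close>: the input is to be rejected; \<open>SE\<close>, \<open>SF\<close>: a premise
  or conclusion mark has been seen during a scan.\<close>

datatype flag = Sd | No | Bad | SE | SF

type_synonym 'y pvar = "(ro, 'y track, flag) var"

text \<open>The automaton state lies on \<open>Tmp 1\<close> and \<open>Tmp 2\<close>. After a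
  failure both remain empty, so failure persists to the end. The input is copied to
  \<open>Tmp 0\<close> in reverse, which suits the conversion: it wants the least significant bit
  first.\<close>

definition scan_step :: "'y sym \<Rightarrow> ('y pvar, 'y sym) com" where
  "scan_step s = Push (Tmp 0) s ;; Pop (Tmp 1) (\<lambda>q. Pop (Tmp 2) (\<lambda>d.
     case q of None \<Rightarrow> Skip | Some q \<Rightarrow> (case d of None \<Rightarrow> Skip | Some d \<Rightarrow>
       (case dfa (q, d) s of None \<Rightarrow> Skip | Some p \<Rightarrow> Push (Tmp 1) (fst p) ;; Push (Tmp 2) (snd p)))))"

definition scan_state :: "'y sym list \<Rightarrow> 'y sym list \<Rightarrow> ('y sym \<times> 'y sym) option \<Rightarrow> 'y pvar \<Rightarrow> 'y sym list" where
  "scan_state w r p v = (case v of Inp \<Rightarrow> w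
     | Tmp n \<Rightarrow> if n = 0 then r
       else if n = 1 then (case p of None \<Rightarrow> [] | Some p \<Rightarrow> [fst p])
       else if n = 2 then (case p of None \<Rightarrow> [] | Some p \<Rightarrow> [snd p]) else []
     | _ \<Rightarrow> [])"

definition dfa_option :: "'y sym \<Rightarrow> ('y sym \<times> 'y sym) option \<Rightarrow> ('y sym \<times> 'y sym) option" where
  "dfa_option s p = Option.bind p (\<lambda>p. dfa p s)"

lemma dfa_accepts_fold:
  "dfa_accepts p w \<longleftrightarrow> (\<exists>p'. fold dfa_option w (Some p) = Some p' \<and> accepting p')"
proof -
  have None: "fold dfa_option w None = None" for w :: "'a sym list"
    by (induction w) (simp_all add: dfa_option_def)
  show ?thesis
    by (induction w arbitrary: p) (auto simp: dfa_option_def None split: option.split)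
qed

lemma runs_scan_step:
  "runs (scan_step s) 10 (scan_state w r p) (scan_state w (s # r) (dfa_option s p))"
proof -
  let ?\<sigma> = "(scan_state w (s # r) p)(Tmp 1 := [], Tmp 2 := [])"
  have 1: "runs (Push (Tmp 0) s) 1 (scan_state w r p) (scan_state w (s # r) p)"
    by (rule runs_eq[OF runs_Push]) (auto simp: scan_state_def split: var.split)
  have 2: "runs (case p of None \<Rightarrow> Skip | Some p \<Rightarrow> (case dfa p s of None \<Rightarrow> Skip
      | Some p \<Rightarrow> Push (Tmp 1) (fst p) ;; Push (Tmp 2) (snd p))) 3 ?\<sigma> (scan_state w (s # r) (dfa_option s p))"
  proof (cases "dfa_option s p")
    case None
    have "?\<sigma> = scan_state w (s # r) None" by (auto simp: scan_state_def split: var.split)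
    have skip: "runs Skip 3 ?\<sigma> (scan_state w (s # r) None)"
      by (rule runs_eq[OF runs_mono[OF runs_Skip]]) (simp, fact)
    show ?thesis
    proof (cases p)
      case (Some p')
      then have "dfa p' s = None" using None by (simp add: dfa_option_def)
      then show ?thesis using skip Some None by simp
    qed (use skip None in simp)
  next
    case (Some p')
    have "runs (Push (Tmp 1) (fst p') ;; Push (Tmp 2) (snd p')) (1 + 1 + 1) ?\<sigma> (scan_state w (s # r) (Some p'))"
      by (rule runs_eq[OF runs_Seq[OF runs_Push runs_Push]]) (auto simp: scan_state_def split: var.split)
    moreover obtain p0 where "p = Some p0" "dfa p0 s = Some p'"
      using Some by (cases p) (auto simp: dfa_option_def)
    ultimately show ?thesis using Some by (simp add: numeral_3_eq_3)
  qed
  have "runs (Pop (Tmp 1) (\<lambda>q. Pop (Tmp 2) (\<lambda>d.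
     case q of None \<Rightarrow> Skip | Some q \<Rightarrow> (case d of None \<Rightarrow> Skip | Some d \<Rightarrow>
       (case dfa (q, d) s of None \<Rightarrow> Skip | Some p \<Rightarrow> Push (Tmp 1) (fst p) ;; Push (Tmp 2) (snd p))))))
     (3 + 1 + 1) (scan_state w (s # r) p) (scan_state w (s # r) (dfa_option s p))"
  proof (intro runs_Pop)
    have "((scan_state w (s # r) p)(Tmp 1 := tl (scan_state w (s # r) p (Tmp 1))))
      (Tmp 2 := tl (((scan_state w (s # r) p)(Tmp 1 := tl (scan_state w (s # r) p (Tmp 1)))) (Tmp 2))) = ?\<sigma>"
      by (auto simp: scan_state_def split: var.split option.split)
    then show "runs (case hd_option (scan_state w (s # r) p (Tmp 1)) of None \<Rightarrow> Skip | Some q \<Rightarrow>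
        (case hd_option (((scan_state w (s # r) p)(Tmp 1 := tl (scan_state w (s # r) p (Tmp 1)))) (Tmp 2)) of
          None \<Rightarrow> Skip | Some d \<Rightarrow>
       (case dfa (q, d) s of None \<Rightarrow> Skip | Some p \<Rightarrow> Push (Tmp 1) (fst p) ;; Push (Tmp 2) (snd p)))) 3
      (((scan_state w (s # r) p)(Tmp 1 := tl (scan_state w (s # r) p (Tmp 1))))
      (Tmp 2 := tl (((scan_state w (s # r) p)(Tmp 1 := tl (scan_state w (s # r) p (Tmp 1)))) (Tmp 2))))
      (scan_state w (s # r) (dfa_option s p))"
      using 2 by (cases p) (simp_all add: scan_state_def)
  qed
  then show ?thesis unfolding scan_step_def by (rule runs_mono[OF runs_Seq[OF 1]]) simp
qed

lemma runs_scan: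
  "runs (Drain Inp scan_step) (11 * length w + 1) (scan_state w r p)
    (scan_state [] (rev w @ r) (fold dfa_option w p) :: 'y pvar \<Rightarrow> 'y sym list)"
proof (induction w arbitrary: r p)
  case Nil
  show ?case by (rule runs_eq[OF runs_mono[OF runs_Drain_Nil]]) (simp_all add: scan_state_def)
next
  case (Cons s w)
  have "(scan_state (s # w) r p)(Inp := w) = scan_state w r p"
    by (auto simp: scan_state_def split: var.split)
  then have "runs (scan_step s) 10 ((scan_state (s # w) r p)(Inp := w))
      (scan_state w (s # r) (dfa_option s p) :: 'y pvar \<Rightarrow> 'y sym list)"
    using runs_scan_step by metis
  then show ?case
    by (rule runs_eq[OF runs_mono[OF runs_Drain_Cons[where f = scan_step, OF _ _ Cons.IH]], rotated])
      (simp_all add: scan_state_def)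
qed


section \<open>Conversion to unary\<close>

text \<open>A term \<open>(y, e)\<close> becomes \<open>|e|\<close> moves of the head, the attribute, and the moves back.\<close>

definition conv_term :: "'y tattr \<Rightarrow> 'y sym list" where
  "conv_term t = (let n = nat \<bar>snd t\<bar> in
     replicate n (if snd t < 0 then Neg else Bit1) @ Att (fst t) #
     replicate n (if snd t < 0 then Bit1 else Neg))"

abbreviation conv_terms :: "'y tattr list \<Rightarrow> 'y sym list" where
  "conv_terms ts \<equiv> concat (map conv_term ts)"

text \<open>In contrast to \<open>enc_input\<close>, the query too is closed by \<open>Semi\<close>,
  the symbol on which the later passes perform their final action for a formula.\<close>

definition conv_fml :: "'y tattr list \<times> 'y tattr list \<Rightarrow> 'y sym list" where
  "conv_fml g = conv_terms (fst g) @ Arrow # conv_terms (snd g) @ [Semi]"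

text \<open>The weight on \<open>Tmp 3\<close> is doubled by way of \<open>Tmp 4\<close>; for a one
  bit it is also added to the value on \<open>Tmp 5\<close>.\<close>

definition conv_bit :: "bool \<Rightarrow> ('y pvar, 'y sym) com" where
  "conv_bit b = Drain (Tmp 3) (\<lambda>_. pushall ((if b then [(Tmp 5, Bit1)] else []) @ [(Tmp 4, Bit1), (Tmp 4, Bit1)])) ;;
     Drain (Tmp 4) (\<lambda>_. pushall [(Tmp 3, Bit1)])"

text \<open>The input comes reversed, so the attribute arrives after its bits and its sign, and
  symbols pushed later stand further left in the output. Hence the moves back are pushed before the
  attribute and the moves towards the time point after it. Finally the weight is reset to
  one.\<close>

fun conv_sym :: "ro \<Rightarrow> 'y sym \<Rightarrow> ('y pvar, 'y sym) com" where
  "conv_sym u Bit0 = conv_bit False"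
| "conv_sym u Bit1 = conv_bit True"
| "conv_sym u Neg = Push (Tmp 7) Neg"
| "conv_sym u (Att y) = Pop (Tmp 7) (\<lambda>x.
     Drain (Tmp 5) (\<lambda>_. pushall [(Tmp 6, Bit1), (Str u True, if x = None then Neg else Bit1)]) ;;
     Push (Str u True) (Att y) ;;
     Drain (Tmp 6) (\<lambda>_. pushall [(Str u True, if x = None then Bit1 else Neg)])) ;;
     Drain (Tmp 3) (\<lambda>_. pushall []) ;; Push (Tmp 3) Bit1"
| "conv_sym u Arrow = Push (Str u True) Arrow"
| "conv_sym u Semi = Push (Str u True) Semi"

text \<open>Read from the right, the input begins with the query, and the first \<open>Semi\<close>
  met ends it. From then on the flag on \<open>Tmp 8\<close> directs the output to the
  theory.\<close>

definition conv_step :: "'y sym \<Rightarrow> ('y pvar, 'y sym) com" where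
  "conv_step s = Pop (Tmp 8) (\<lambda>x. case x of
     None \<Rightarrow> if s = Semi then Push (Tmp 8) Bit1 ;; Push (Str Sig True) Semi else conv_sym Qry s
   | Some a \<Rightarrow> Push (Tmp 8) a ;; conv_sym Sig s)"

text \<open>The contents of the stacks during the conversion: the rest \<open>r\<close> of the reversed input, the
  weight \<open>p\<close> of the next bit and the value \<open>v\<close> of the previous ones in unary, the sign, and a flag
  that tells whether the query has already been read.\<close>

definition conv_state :: "'y sym list \<Rightarrow> nat \<Rightarrow> nat \<Rightarrow> 'y sym list \<Rightarrow> 'y sym list \<Rightarrow> (ro \<Rightarrow> 'y sym list) \<Rightarrow>
    'y pvar \<Rightarrow> 'y sym list" where
  "conv_state r p v sg fl out u = (case u of
     Tmp n \<Rightarrow> if n = 0 then r else if n = 3 then replicate p Bit1 else if n = 5 then replicate v Bit1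
       else if n = 7 then sg else if n = 8 then fl else []
   | Str q b \<Rightarrow> if b then out q else []
   | _ \<Rightarrow> [])"

lemma concat_replicate_1: "concat (replicate n [a]) = replicate n a"
  by (induction n) simp_all

lemma concat_replicate_2: "concat (replicate n [a, a]) = replicate (2 * n) a"
  by (induction n) simp_all

lemmas drain_simps = map_replicate_const concat_replicate_1 concat_replicate_2

lemma runs_conv_bit:
  "runs (conv_bit b) (20 * p + 10) (conv_state r p v sg fl out)
     (conv_state r (2 * p) (v + (if b then p else 0)) sg fl out :: 'y pvar \<Rightarrow> 'y sym list)"
proof -
  let ?ps = "(if b then [(Tmp 5, Bit1)] else []) @ [(Tmp 4, Bit1), (Tmp 4, Bit1)]"
  define \<sigma>1 :: "'y pvar \<Rightarrow> 'y sym list"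
    where "\<sigma>1 = (conv_state r 0 (v + (if b then p else 0)) sg fl out)(Tmp 4 := replicate (2 * p) Bit1)"
  have 1: "runs (Drain (Tmp 3) (\<lambda>_. pushall ?ps)) (p * 8 + 1) (conv_state r p v sg fl out) \<sigma>1"
    by (rule runs_eq[OF runs_mono[OF runs_Drain_pushall[where xs = "replicate p Bit1" and k = 3]]])
      (auto simp: conv_state_def \<sigma>1_def fun_eq_iff drain_simps replicate_add add.commute split: var.split)
  have 2: "runs (Drain (Tmp 4) (\<lambda>_. pushall [(Tmp 3, Bit1)])) (2 * p * 4 + 1) \<sigma>1
      (conv_state r (2 * p) (v + (if b then p else 0)) sg fl out)"
    by (rule runs_eq[OF runs_mono[OF runs_Drain_pushall[where xs = "replicate (2 * p) Bit1" and k = 1]]])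
      (auto simp: conv_state_def \<sigma>1_def fun_eq_iff drain_simps split: var.split)
  show ?thesis unfolding conv_bit_def by (rule runs_mono[OF runs_Seq[OF 1 2]]) simp
qed

lemma runs_conv_Att:
  assumes "sg = [] \<or> sg = [Neg]"
  shows "runs (conv_sym u (Att y)) (10 * v + 2 * p + 20) (conv_state r p v sg fl out)
     (conv_state r 1 0 [] fl (out(u := replicate v (if sg = [] then Bit1 else Neg) @ Att y #
        replicate v (if sg = [] then Neg else Bit1) @ out u)))"
proof -
  let ?d = "if sg = [] then Bit1 else Neg" and ?d' = "if sg = [] then Neg else Bit1"
  define out1 where "out1 = out(u := replicate v ?d' @ out u)"
  define out2 where "out2 = out(u := Att y # replicate v ?d' @ out u)"
  define out3 where "out3 = out(u := replicate v ?d @ Att y # replicate v ?d' @ out u)"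
  let ?V2 = "\<lambda>\<sigma>. \<sigma>(Tmp 6 := replicate v Bit1)"
  have 1: "runs (Drain (Tmp 5) (\<lambda>_. pushall [(Tmp 6, Bit1), (Str u True, ?d')])) (v * 6 + 1)
      (conv_state r p v [] fl out) (?V2 (conv_state r p 0 [] fl out1))"
    by (rule runs_eq[OF runs_mono[OF runs_Drain_pushall[where xs = "replicate v Bit1" and k = 2]]])
      (auto simp: conv_state_def out1_def fun_eq_iff drain_simps split: var.split)
  have 2: "runs (Push (Str u True) (Att y)) 1 (?V2 (conv_state r p 0 [] fl out1)) (?V2 (conv_state r p 0 [] fl out2))"
    by (rule runs_eq[OF runs_Push])
      (auto simp: conv_state_def out1_def out2_def fun_eq_iff split: var.split)
  have 3: "runs (Drain (Tmp 6) (\<lambda>_. pushall [(Str u True, ?d)])) (v * 4 + 1)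
      (?V2 (conv_state r p 0 [] fl out2)) (conv_state r p 0 [] fl out3)"
    by (rule runs_eq[OF runs_mono[OF runs_Drain_pushall[where xs = "replicate v Bit1" and k = 1]]])
      (auto simp: conv_state_def out2_def out3_def fun_eq_iff drain_simps split: var.split)
  have 4: "runs (Drain (Tmp 3) (\<lambda>_. pushall [])) (p * 2 + 1)
      (conv_state r p 0 [] fl out3) (conv_state r 0 0 [] fl out3)"
    by (rule runs_eq[OF runs_mono[OF runs_Drain_pushall[where xs = "replicate p Bit1" and k = 0]]])
      (auto simp: conv_state_def fun_eq_iff drain_simps split: var.split)
  have 5: "runs (Push (Tmp 3) Bit1) 1 (conv_state r 0 0 [] fl out3) (conv_state r 1 0 [] fl out3)"
    by (rule runs_eq[OF runs_Push]) (auto simp: conv_state_def fun_eq_iff split: var.split)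
  have sg: "conv_state r p v sg fl out (Tmp 7) = sg" by (simp add: conv_state_def)
  have tl: "(conv_state r p v sg fl out)(Tmp 7 := tl sg) = conv_state r p v [] fl out"
    using assms by (auto simp: conv_state_def fun_eq_iff split: var.split)
  have x: "(hd_option sg = None) = (sg = [])" using assms by auto
  let ?c = "\<lambda>x. Drain (Tmp 5) (\<lambda>_. pushall [(Tmp 6, Bit1), (Str u True, if x = None then Neg else Bit1)]) ;;
     Push (Str u True) (Att y) ;;
     Drain (Tmp 6) (\<lambda>_. pushall [(Str u True, if x = None then Bit1 else Neg)])"
  have "runs (?c (hd_option sg)) (v * 6 + 1 + (1 + (v * 4 + 1) + 1) + 1)
      (conv_state r p v [] fl out) (conv_state r p 0 [] fl out3)"
    unfolding x using runs_Seq[OF 1 runs_Seq[OF 2 3]] by simp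
  then have 6: "runs (Pop (Tmp 7) ?c) (v * 6 + 1 + (1 + (v * 4 + 1) + 1) + 1 + 1)
      (conv_state r p v sg fl out) (conv_state r p 0 [] fl out3)"
    by (intro runs_Pop) (simp only: sg tl)
  show ?thesis unfolding conv_sym.simps out3_def[symmetric]
    by (rule runs_mono[OF runs_Seq[OF 6 runs_Seq[OF 4 5]]]) simp
qed

definition out_str :: "'y sym list \<Rightarrow> ro" where
  "out_str fl = (if fl = [] then Qry else Sig)"

lemma runs_conv_step:
  fixes \<sigma>' :: "'y pvar \<Rightarrow> 'y sym list"
  assumes "fl = [] \<or> fl = [Bit1]" "s \<noteq> Semi"
    and "runs (conv_sym (out_str fl) s) \<tau> (conv_state r p v sg fl out) \<sigma>'"
  shows "runs (conv_step s) (\<tau> + 3) (conv_state r p v sg fl out) \<sigma>'"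
proof -
  have fl: "conv_state r p v sg fl out (Tmp 8) = fl" by (simp add: conv_state_def)
  let ?\<sigma> = "(conv_state r p v sg fl out)(Tmp 8 := tl fl) :: 'y pvar \<Rightarrow> 'y sym list"
  have "runs (case hd_option fl of
     None \<Rightarrow> if s = Semi then Push (Tmp 8) Bit1 ;; Push (Str Sig True) Semi else conv_sym Qry s
   | Some a \<Rightarrow> Push (Tmp 8) a ;; conv_sym Sig s) (\<tau> + 2) ?\<sigma> \<sigma>'"
  proof (cases "fl = []")
    case True
    then have "?\<sigma> = conv_state r p v sg fl out"
      by (auto simp: conv_state_def fun_eq_iff split: var.split)
    moreover have "runs (conv_sym Qry s) (\<tau> + 2) (conv_state r p v sg fl out) \<sigma>'"
      by (rule runs_mono[where \<tau> = \<tau>]) (use assms(3) True in \<open>simp_all add: out_str_def\<close>)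
    ultimately show ?thesis using True assms(2) by (simp only: hd_option_simps option.case if_False)
  next
    case False
    then have "fl = [Bit1]" using assms(1) by simp
    moreover have "runs (Push (Tmp 8) Bit1) 1 ?\<sigma> (conv_state r p v sg fl out)"
      by (rule runs_eq[OF runs_Push])
        (use \<open>fl = [Bit1]\<close> in \<open>auto simp: conv_state_def fun_eq_iff split: var.split\<close>)
    ultimately have "runs (Push (Tmp 8) Bit1 ;; conv_sym Sig s) (\<tau> + 2) ?\<sigma> \<sigma>'"
      using assms(3)
      by (intro runs_mono[OF runs_Seq[where ?t1.0 = 1 and ?t2.0 = \<tau>]]) (simp_all add: out_str_def)
    then show ?thesis using \<open>fl = [Bit1]\<close> by (simp only: hd_option_simps option.case)
  qed
  then have "runs (conv_step s) (\<tau> + 2 + 1) (conv_state r p v sg fl out) \<sigma>'"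
    unfolding conv_step_def by (intro runs_Pop) (simp only: fl)
  then show ?thesis by (rule runs_mono) simp
qed

lemma runs_conv_step_Semi:
  assumes "fl = [] \<or> fl = [Bit1]"
  shows "runs (conv_step Semi) 4 (conv_state r p v sg fl out)
    (conv_state r p v sg [Bit1] (out(Sig := Semi # out Sig)))"
proof -
  have fl: "conv_state r p v sg fl out (Tmp 8) = fl" by (simp add: conv_state_def)
  let ?\<sigma> = "(conv_state r p v sg fl out)(Tmp 8 := tl fl)"
  have "runs (Push (Tmp 8) Bit1 ;; Push (Str Sig True) Semi) (1 + 1 + 1) ?\<sigma>
      (conv_state r p v sg [Bit1] (out(Sig := Semi # out Sig)))"
    by (rule runs_eq[OF runs_Seq[OF runs_Push runs_Push]])
      (use assms in \<open>auto simp: conv_state_def fun_eq_iff split: var.split\<close>)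
  then have "runs (case hd_option fl of
     None \<Rightarrow> if Semi = Semi then Push (Tmp 8) Bit1 ;; Push (Str Sig True) Semi else conv_sym Qry Semi
   | Some a \<Rightarrow> Push (Tmp 8) a ;; conv_sym Sig Semi) 3 ?\<sigma>
      (conv_state r p v sg [Bit1] (out(Sig := Semi # out Sig)))"
    using assms by (elim disjE) (simp_all add: numeral_3_eq_3)
  then have "runs (conv_step Semi) (3 + 1) (conv_state r p v sg fl out)
      (conv_state r p v sg [Bit1] (out(Sig := Semi # out Sig)))"
    unfolding conv_step_def by (intro runs_Pop) (simp only: fl)
  then show ?thesis by simp
qed

text \<open>\<open>feeds B u S S'\<close> says that the conversion loop reads \<open>u\<close> and thereby passes from the
  configuration \<open>S\<close> to \<open>S'\<close>; phrasing it relative to the rest of the run makes it compositional.\<close>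

definition feeds :: "nat \<Rightarrow> 'y sym list \<Rightarrow> ('y sym list \<Rightarrow> 'y pvar \<Rightarrow> 'y sym list) \<Rightarrow>
    ('y sym list \<Rightarrow> 'y pvar \<Rightarrow> 'y sym list) \<Rightarrow> bool" where
  "feeds B u S S' \<longleftrightarrow> (\<forall>r t \<sigma>. runs (Drain (Tmp 0) conv_step) t (S' r) \<sigma> \<longrightarrow>
     runs (Drain (Tmp 0) conv_step) (t + length u * (20 * B + 30)) (S (u @ r)) \<sigma>)"

lemma feeds_Nil: "feeds B [] S S"
  by (simp add: feeds_def)

lemma feeds_append:
  assumes "feeds B u S S1" "feeds B u' S1 S2" shows "feeds B (u @ u') S S2"
  unfolding feeds_def
proof (intro allI impI)
  fix r t \<sigma> assume "runs (Drain (Tmp 0) conv_step) t (S2 r) \<sigma>"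
  then have "runs (Drain (Tmp 0) conv_step) (t + length u' * (20 * B + 30)) (S1 (u' @ r)) \<sigma>"
    using assms(2) unfolding feeds_def by simp
  then have "runs (Drain (Tmp 0) conv_step)
      (t + length u' * (20 * B + 30) + length u * (20 * B + 30)) (S (u @ u' @ r)) \<sigma>"
    using assms(1) unfolding feeds_def by simp
  then show "runs (Drain (Tmp 0) conv_step) (t + length (u @ u') * (20 * B + 30)) (S ((u @ u') @ r)) \<sigma>"
    by (simp only: append_assoc length_append add_mult_distrib add.assoc
      add.commute[of "length u' * _"])
qed

lemma feeds_single:
  fixes S' :: "'y sym list \<Rightarrow> 'y pvar \<Rightarrow> 'y sym list"
  assumes "\<And>r. runs (conv_step s) (20 * B + 29) (conv_state r p v sg fl out) (S' r)"
  shows "feeds B [s] (\<lambda>r. conv_state r p v sg fl out) S'"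
  unfolding feeds_def
proof (intro allI impI)
  fix r t \<sigma> assume S': "runs (Drain (Tmp 0) conv_step) t (S' r) \<sigma>"
  have "(conv_state (s # r) p v sg fl out)(Tmp 0 := r) = (conv_state r p v sg fl out :: 'y pvar \<Rightarrow> 'y sym list)"
    by (auto simp: conv_state_def fun_eq_iff split: var.split)
  then have 1: "runs (conv_step s) (20 * B + 29) ((conv_state (s # r) p v sg fl out)(Tmp 0 := r)) (S' r)"
    using assms[of r] by simp
  have "runs (Drain (Tmp 0) conv_step) (t + length [s] * (20 * B + 30)) (conv_state (s # r) p v sg fl out) \<sigma>"
    by (rule runs_mono[OF runs_Drain_Cons[where f = conv_step, OF _ 1 S']]) (simp_all add: conv_state_def)
  then show "runs (Drain (Tmp 0) conv_step) (t + length [s] * (20 * B + 30)) (conv_state ([s] @ r) p v sg fl out) \<sigma>"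
    by (simp only: append_Cons append_Nil)
qed

lemma feeds_bit:
  assumes "fl = [] \<or> fl = [Bit1]" "p \<le> B"
  shows "feeds B [bit_sym b] (\<lambda>r. conv_state r p v sg fl out)
    (\<lambda>r. conv_state r (2 * p) (v + (if b then p else 0)) sg fl out)"
proof (rule feeds_single)
  fix r
  have "runs (conv_sym (out_str fl) (bit_sym b)) (20 * p + 10) (conv_state r p v sg fl out)
     (conv_state r (2 * p) (v + (if b then p else 0)) sg fl out)"
    using runs_conv_bit[of b] by (cases b) simp_all
  from runs_conv_step[OF assms(1) _ this]
  show "runs (conv_step (bit_sym b)) (20 * B + 29) (conv_state r p v sg fl out)
     (conv_state r (2 * p) (v + (if b then p else 0)) sg fl out)"
    by (rule runs_mono) (use assms(2) in \<open>simp_all split: if_splits\<close>)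
qed

text \<open>The weight of the leading one bit is at most the value of the numeral, and it is doubled
  once more after that bit has been read; this is where \<open>2 * B\<close> comes from.\<close>

lemma feeds_bin:
  assumes "fl = [] \<or> fl = [Bit1]" "p \<le> B" "p * n \<le> B"
  shows "\<exists>p'\<le>2 * B. feeds B (rev (bin n)) (\<lambda>r. conv_state r p v sg fl out)
    (\<lambda>r. conv_state r p' (v + p * n) sg fl out)"
  using assms(2,3)
proof (induction n arbitrary: p v rule: bin_induct)
  case zero
  show ?case
  proof (intro exI conjI)
    show "2 * p \<le> 2 * B" using zero(1) by simp
    show "feeds B (rev (bin 0)) (\<lambda>r. conv_state r p v sg fl out)
        (\<lambda>r. conv_state r (2 * p) (v + p * 0) sg fl out)"
      using feeds_bit[OF assms(1) zero(1), of False v sg out] by simp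
  qed
next
  case one
  show ?case
  proof (intro exI conjI)
    show "2 * p \<le> 2 * B" using one(1) by simp
    show "feeds B (rev (bin 1)) (\<lambda>r. conv_state r p v sg fl out)
        (\<lambda>r. conv_state r (2 * p) (v + p * 1) sg fl out)"
      using feeds_bit[OF assms(1) one(1), of True v sg out] by simp
  qed
next
  case (even n)
  have le: "2 * p * 1 \<le> 2 * p * n" using even.hyps by (intro mult_le_mono) auto
  have eq: "p * (2 * n) = 2 * p * n" by simp
  have "2 * p \<le> B" "2 * p * n \<le> B" using even.prems(2) le unfolding eq by linarith+
  from even.IH[OF this, of v] obtain p' where p': "p' \<le> 2 * B"
    "feeds B (rev (bin n)) (\<lambda>r. conv_state r (2 * p) v sg fl out)
      (\<lambda>r. conv_state r p' (v + 2 * p * n) sg fl out)" by (elim exE conjE) (rule that)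
  have "feeds B [Bit0] (\<lambda>r. conv_state r p v sg fl out) (\<lambda>r. conv_state r (2 * p) v sg fl out)"
    using feeds_bit[OF assms(1) even.prems(1), of False v sg out] by simp
  from feeds_append[OF this p'(2)]
  have "feeds B (rev (bin (2 * n))) (\<lambda>r. conv_state r p v sg fl out)
      (\<lambda>r. conv_state r p' (v + p * (2 * n)) sg fl out)"
    by (simp only: bin_step(1)[OF even.hyps] rev.simps rev_append append_Nil eq)
  then show ?case using p'(1) by (intro exI conjI)
next
  case (odd n)
  have le: "2 * p * 1 \<le> 2 * p * n" using odd.hyps by (intro mult_le_mono) auto
  have eq: "p * (2 * n + 1) = p + 2 * p * n" by simp
  have "2 * p \<le> B" "2 * p * n \<le> B" using odd.prems(2) le unfolding eq by linarith+
  from odd.IH[OF this, of "v + p"] obtain p' where p': "p' \<le> 2 * B"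
    "feeds B (rev (bin n)) (\<lambda>r. conv_state r (2 * p) (v + p) sg fl out)
      (\<lambda>r. conv_state r p' (v + p + 2 * p * n) sg fl out)" by (elim exE conjE) (rule that)
  have "feeds B [Bit1] (\<lambda>r. conv_state r p v sg fl out) (\<lambda>r. conv_state r (2 * p) (v + p) sg fl out)"
    using feeds_bit[OF assms(1) odd.prems(1), of True v sg out] by simp
  from feeds_append[OF this p'(2)]
  have "feeds B (rev (bin (2 * n + 1))) (\<lambda>r. conv_state r p v sg fl out)
      (\<lambda>r. conv_state r p' (v + p * (2 * n + 1)) sg fl out)"
    by (simp only: bin_step(2)[OF odd.hyps] rev.simps rev_append append_Nil eq add.assoc)
  then show ?case using p'(1) by (intro exI conjI)
qed

lemma feeds_conv:
  assumes "fl = [] \<or> fl = [Bit1]" "s \<noteq> Semi" "\<tau> \<le> 20 * B + 26"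
    and "\<And>r. runs (conv_sym (out_str fl) s) \<tau> (conv_state r p v sg fl out) (S' r)"
  shows "feeds B [s] (\<lambda>r. conv_state r p v sg fl out) S'"
  by (rule feeds_single, rule runs_mono[OF runs_conv_step[OF assms(1,2,4)]]) (use assms(3) in simp)

lemma feeds_term:
  assumes fl: "fl = [] \<or> fl = [Bit1]" and B: "nat \<bar>snd t\<bar> \<le> B" "1 \<le> B"
  shows "feeds B (rev (enc_term t)) (\<lambda>r. conv_state r 1 0 [] fl out)
    (\<lambda>r. conv_state r 1 0 [] fl (out(out_str fl := conv_term t @ out (out_str fl))))"
proof -
  have Att: "feeds B [Att y] (\<lambda>r. conv_state r p n sg fl out)
      (\<lambda>r. conv_state r 1 0 [] fl (out(out_str fl := replicate n (if sg = [] then Bit1 else Neg) @ Att y #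
        replicate n (if sg = [] then Neg else Bit1) @ out (out_str fl))))"
    if "sg = [] \<or> sg = [Neg]" "n \<le> B" "p \<le> 2 * B" for y p n sg
    by (rule feeds_conv[OF fl _ _ runs_conv_Att[OF that(1)]]) (use that(2,3) in simp_all)
  show ?thesis
  proof (cases t rule: enc_term_cases)
    case (1 y n)
    then have n: "n \<le> B" using B by simp
    from feeds_bin[OF fl B(2), of n 0 "[]" out, unfolded mult_1 add_0, OF n]
    obtain p' where p': "p' \<le> 2 * B" "feeds B (rev (bin n)) (\<lambda>r. conv_state r 1 0 [] fl out)
        (\<lambda>r. conv_state r p' n [] fl out)" by (elim exE conjE) (rule that)
    from feeds_append[OF p'(2) Att[OF _ n p'(1), of "[]" y]] show ?thesis
      by (simp add: 1 enc_term_pos conv_term_def)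
  next
    case (2 y n)
    then have n: "n \<le> B" using B by simp
    from feeds_bin[OF fl B(2), of n 0 "[]" out, unfolded mult_1 add_0, OF n]
    obtain p' where p': "p' \<le> 2 * B" "feeds B (rev (bin n)) (\<lambda>r. conv_state r 1 0 [] fl out)
        (\<lambda>r. conv_state r p' n [] fl out)" by (elim exE conjE) (rule that)
    have Neg: "feeds B [Neg] (\<lambda>r. conv_state r p' n [] fl out) (\<lambda>r. conv_state r p' n [Neg] fl out)"
    proof (rule feeds_conv[OF fl, where \<tau> = 1])
      fix r
      show "runs (conv_sym (out_str fl) Neg) 1 (conv_state r p' n [] fl out) (conv_state r p' n [Neg] fl out)"
        unfolding conv_sym.simps
        by (rule runs_eq[OF runs_Push]) (auto simp: conv_state_def fun_eq_iff split: var.split)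
    qed simp_all
    from feeds_append[OF p'(2) feeds_append[OF Neg Att[OF _ n p'(1), of "[Neg]" y]]] 2(2) show ?thesis
      by (simp add: 2 enc_term_neg conv_term_def)
  qed
qed

lemma feeds_terms:
  assumes fl: "fl = [] \<or> fl = [Bit1]" and B: "\<And>t. t \<in> set ts \<Longrightarrow> nat \<bar>snd t\<bar> \<le> B" "1 \<le> B"
  shows "feeds B (rev (enc_terms ts)) (\<lambda>r. conv_state r 1 0 [] fl out)
    (\<lambda>r. conv_state r 1 0 [] fl (out(out_str fl := conv_terms ts @ out (out_str fl))))"
  using B(1)
proof (induction ts)
  case Nil
  show ?case using feeds_Nil by simp
next
  case (Cons t ts)
  let ?u = "out_str fl"
  have 1: "feeds B (rev (enc_terms ts)) (\<lambda>r. conv_state r 1 0 [] fl out)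
    (\<lambda>r. conv_state r 1 0 [] fl (out(?u := conv_terms ts @ out ?u)))"
    by (rule Cons.IH, rule Cons.prems) simp
  have 2: "feeds B (rev (enc_term t)) (\<lambda>r. conv_state r 1 0 [] fl (out(?u := conv_terms ts @ out ?u)))
    (\<lambda>r. conv_state r 1 0 [] fl (out(?u := conv_terms (t # ts) @ out ?u)))"
    using feeds_term[where out = "out(?u := conv_terms ts @ out ?u)", OF fl Cons.prems[of t] B(2)]
    by (simp only: fun_upd_upd fun_upd_same list.map concat.simps append_assoc list.set_intros)
  show ?case using feeds_append[OF 1 2]
    by (simp only: list.map concat.simps rev_append)
qed

text \<open>The closing \<open>Semi\<close> is already on the output when the formula is read: for
  the query it was pushed in advance, for a formula of the theory by the step that read its
  \<open>Semi\<close>.\<close>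

lemma feeds_fml:
  assumes fl: "fl = [] \<or> fl = [Bit1]" and B: "\<And>t. t \<in> set (fst g) \<union> set (snd g) \<Longrightarrow> nat \<bar>snd t\<bar> \<le> B" "1 \<le> B"
  shows "feeds B (rev (enc_fml g)) (\<lambda>r. conv_state r 1 0 [] fl (out(out_str fl := Semi # xs)))
    (\<lambda>r. conv_state r 1 0 [] fl (out(out_str fl := conv_fml g @ xs)))"
proof -
  let ?S = "\<lambda>xs r. conv_state r 1 0 [] fl (out(out_str fl := xs))"
  have a: "nat \<bar>snd t\<bar> \<le> B" if "t \<in> set (fst g)" for t using B(1) that by simp
  have b: "nat \<bar>snd t\<bar> \<le> B" if "t \<in> set (snd g)" for t using B(1) that by simp
  have 1: "feeds B (rev (enc_terms (snd g))) (?S (Semi # xs)) (?S (conv_terms (snd g) @ Semi # xs))"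
    using feeds_terms[where out = "out(out_str fl := Semi # xs)", OF fl b B(2)]
    by (simp only: fun_upd_upd fun_upd_same)
  have 2: "feeds B [Arrow] (?S (conv_terms (snd g) @ Semi # xs)) (?S (Arrow # conv_terms (snd g) @ Semi # xs))"
  proof (rule feeds_conv[OF fl, where \<tau> = 1])
    fix r
    show "runs (conv_sym (out_str fl) Arrow) 1 (?S (conv_terms (snd g) @ Semi # xs) r)
        (?S (Arrow # conv_terms (snd g) @ Semi # xs) r)"
      unfolding conv_sym.simps
      by (rule runs_eq[OF runs_Push]) (auto simp: conv_state_def fun_eq_iff split: var.split)
  qed simp_all
  have 3: "feeds B (rev (enc_terms (fst g))) (?S (Arrow # conv_terms (snd g) @ Semi # xs)) (?S (conv_fml g @ xs))"
    using feeds_terms[where out = "out(out_str fl := Arrow # conv_terms (snd g) @ Semi # xs)", OF fl a B(2)]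
    by (simp only: fun_upd_upd fun_upd_same conv_fml_def append_assoc append_Cons append_Nil)
  show ?thesis using feeds_append[OF feeds_append[OF 1 2] 3]
    by (simp only: enc_fml_def rev_append rev.simps append_Nil append_assoc)
qed

text \<open>The final flag depends on whether any \<open>Semi\<close> was met, that is on whether
  the theory is empty; hence the existential quantifier.\<close>

lemma feeds_theory:
  assumes fl: "fl = [] \<or> fl = [Bit1]" and B: "1 \<le> B"
    and terms: "\<And>g t. g \<in> set \<Sigma>s \<Longrightarrow> t \<in> set (fst g) \<union> set (snd g) \<Longrightarrow> nat \<bar>snd t\<bar> \<le> B"
  shows "\<exists>fl'. feeds B (rev (concat (map (\<lambda>g. enc_fml g @ [Semi]) \<Sigma>s)))
    (\<lambda>r. conv_state r 1 0 [] fl (out(Sig := [])))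
    (\<lambda>r. conv_state r 1 0 [] fl' (out(Sig := concat (map conv_fml \<Sigma>s)))) \<and>
    (fl' = [] \<or> fl' = [Bit1])"
  using terms
proof (induction \<Sigma>s)
  case Nil
  show ?case using feeds_Nil fl by (intro exI[of _ fl]) simp
next
  case (Cons g \<Sigma>s)
  let ?S = "\<lambda>fl xs r. conv_state r 1 0 [] fl (out(Sig := xs))"
  let ?xs = "concat (map conv_fml \<Sigma>s)"
  have prems: "nat \<bar>snd t\<bar> \<le> B" if "h \<in> set \<Sigma>s" "t \<in> set (fst h) \<union> set (snd h)" for h t
    by (rule Cons.prems[OF _ that(2)]) (use that(1) in simp)
  have "\<exists>fl'. feeds B (rev (concat (map (\<lambda>g. enc_fml g @ [Semi]) \<Sigma>s))) (?S fl []) (?S fl' ?xs) \<and>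
      (fl' = [] \<or> fl' = [Bit1])"
    by (rule Cons.IH, rule prems)
  then obtain fl' where
    1: "feeds B (rev (concat (map (\<lambda>g. enc_fml g @ [Semi]) \<Sigma>s))) (?S fl []) (?S fl' ?xs)"
    and fl': "fl' = [] \<or> fl' = [Bit1]" by (elim exE conjE) (rule that)
  have 2: "feeds B [Semi] (?S fl' ?xs) (?S [Bit1] (Semi # ?xs))"
    using runs_mono[OF runs_conv_step_Semi[OF fl', where out = "out(Sig := ?xs)"], of "20 * B + 29"]
    by (intro feeds_single) (simp only: fun_upd_upd fun_upd_same)
  have 3: "feeds B (rev (enc_fml g)) (?S [Bit1] (Semi # ?xs)) (?S [Bit1] (conv_fml g @ ?xs))"
    using feeds_fml[where fl = "[Bit1]" and g = g and B = B and out = out and xs = ?xs,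
        OF _ Cons.prems[OF list.set_intros(1)] B] by (simp add: out_str_def)
  show ?case
    using feeds_append[OF feeds_append[OF 1 2] 3] by (intro exI[of _ "[Bit1]"]) (simp del: fun_upd_apply)
qed

lemma runs_convert:
  assumes terms: "\<And>g t. g \<in> set (\<Sigma>s @ [f]) \<Longrightarrow> t \<in> set (fst g) \<union> set (snd g) \<Longrightarrow> nat \<bar>snd t\<bar> \<le> B"
    and B: "1 \<le> B"
  shows "\<exists>fl. runs (Drain (Tmp 0) conv_step) (length (enc_input \<Sigma>s f) * (20 * B + 30) + 1)
    (conv_state (rev (enc_input \<Sigma>s f)) 1 0 [] [] ((\<lambda>_. [])(Qry := [Semi])))
    (conv_state [] 1 0 [] fl ((\<lambda>_. [])(Qry := conv_fml f, Sig := concat (map conv_fml \<Sigma>s))))"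
proof -
  let ?q = "(\<lambda>_. [])(Qry := conv_fml f)"
  have "nat \<bar>snd t\<bar> \<le> B" if "t \<in> set (fst f) \<union> set (snd f)" for t
    by (rule terms[OF _ that]) simp
  then have 1: "feeds B (rev (enc_fml f)) (\<lambda>r. conv_state r 1 0 [] [] ((\<lambda>_. [])(Qry := [Semi])))
      (\<lambda>r. conv_state r 1 0 [] [] ?q)"
    using feeds_fml[where fl = "[]" and g = f and B = B and out = "\<lambda>_. []" and xs = "[]"] B
    by (simp add: out_str_def)
  have prems: "nat \<bar>snd t\<bar> \<le> B" if "h \<in> set \<Sigma>s" "t \<in> set (fst h) \<union> set (snd h)" for h t
    by (rule terms[OF _ that(2)]) (use that(1) in simp)
  have q: "?q(Sig := []) = ?q" by (simp add: fun_eq_iff)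
  have "\<exists>fl'. feeds B (rev (concat (map (\<lambda>g. enc_fml g @ [Semi]) \<Sigma>s)))
    (\<lambda>r. conv_state r 1 0 [] [] (?q(Sig := [])))
    (\<lambda>r. conv_state r 1 0 [] fl' (?q(Sig := concat (map conv_fml \<Sigma>s)))) \<and>
    (fl' = [] \<or> fl' = [Bit1])"
    by (rule feeds_theory[OF _ B prems]) simp_all
  then obtain fl where 2: "feeds B (rev (concat (map (\<lambda>g. enc_fml g @ [Semi]) \<Sigma>s)))
    (\<lambda>r. conv_state r 1 0 [] [] ?q)
    (\<lambda>r. conv_state r 1 0 [] fl (?q(Sig := concat (map conv_fml \<Sigma>s))))"
    unfolding q by (elim exE conjE) (rule that)
  have "runs (Drain (Tmp 0) conv_step) 1
    (conv_state [] 1 0 [] fl (?q(Sig := concat (map conv_fml \<Sigma>s))))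
    (conv_state [] 1 0 [] fl (?q(Sig := concat (map conv_fml \<Sigma>s))))"
    by (rule runs_Drain_Nil) (simp add: conv_state_def)
  from feeds_append[OF 1 2, unfolded feeds_def, rule_format, OF this]
  have "runs (Drain (Tmp 0) conv_step) (length (enc_input \<Sigma>s f) * (20 * B + 30) + 1)
    (conv_state (rev (enc_input \<Sigma>s f)) 1 0 [] [] ((\<lambda>_. [])(Qry := [Semi])))
    (conv_state [] 1 0 [] fl (?q(Sig := concat (map conv_fml \<Sigma>s))))"
    by (simp only: enc_input_def rev_append append_Nil2 length_append length_rev add.commute)
  then show ?thesis by (rule exI)
qed

section \<open>The decision procedure on timelines\<close>

type_synonym 'y prog = "(ro, 'y track, flag, 'y sym) lcom"

text \<open>A template for all passes over a converted string. The unary moves bring the head to the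
  time point of each attribute and back, so the parameters act on the right cell without any
  arithmetic.\<close>

definition pass_step :: "('y \<Rightarrow> 'y prog) \<Rightarrow> ('y \<Rightarrow> 'y prog) \<Rightarrow> 'y prog \<Rightarrow> 'y sym \<Rightarrow> 'y prog" where
  "pass_step cE cF cend s = (case s of Bit0 \<Rightarrow> LSkip | Bit1 \<Rightarrow> MoveR | Neg \<Rightarrow> MoveL
     | Att y \<Rightarrow> IfF Sd (cF y) (cE y) | Arrow \<Rightarrow> Flag Sd True | Semi \<Rightarrow> Flag Sd False ; cend)"

abbreviation pass :: "(ro \<Rightarrow> 'y sym list) \<Rightarrow> ('y \<Rightarrow> 'y prog) \<Rightarrow> ('y \<Rightarrow> 'y prog) \<Rightarrow> 'y prog \<Rightarrow>
    'y sym list \<Rightarrow> ('y track, flag) lstate \<Rightarrow> ('y track, flag) lstate" where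
  "pass ro cE cF cend \<equiv> fold (\<lambda>s. leval ro (pass_step cE cF cend s))"

text \<open>In a scan from left to right, predictivity is violated by a premise mark met after a
  conclusion mark. Testing \<open>ME\<close> before \<open>MF\<close> tolerates the two at the same
  time point. The marks are erased on the way, ready for the next formula.\<close>

definition cell_check :: "'y prog" where
  "cell_check = Test ME (Flag SE True ; IfF SF (Flag Bad True) LSkip ; Mark ME False) LSkip ;
     Test MF (Flag SF True ; Mark MF False) LSkip ; MoveR"

text \<open>The scan covers the 2 * N + 1 cells from -N to N and stops at N + 1, which explains the
  extra \<open>MoveL\<close> at the end. A flag \<open>SE\<close> or \<open>SF\<close> still unset
  reveals an empty premise or conclusion.\<close>

definition order_check :: "'y prog" where
  "order_check = For CA (\<lambda>_. MoveL) ; For CA (\<lambda>_. cell_check) ; For CA (\<lambda>_. cell_check) ; cell_check ;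
     IfF SE LSkip (Flag Bad True) ; IfF SF LSkip (Flag Bad True) ; Flag SE False ; Flag SF False ;
     For CA (\<lambda>_. MoveL) ; MoveL"

definition predictive_check :: "ro \<Rightarrow> 'y prog" where
  "predictive_check r = For r (pass_step (\<lambda>_. Mark ME True) (\<lambda>_. Mark MF True) order_check)"

definition load :: "'y prog" where
  "load = For Qry (pass_step (\<lambda>y. Mark (At y) True) (\<lambda>_. LSkip) LSkip)"

definition fire_all :: "'y prog" where
  "fire_all = For Sig (pass_step (\<lambda>y. Test (At y) LSkip (Flag No True))
     (\<lambda>y. IfF No LSkip (Mark (At y) True)) (Flag No False))"

text \<open>Shifts are head positions. From -2 * N to 2 * N there are 4 * N + 1 of them: four loops
  of N and one final pass without a move, after which the head is 2 * N cells away from the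
  origin.\<close>

definition sweep :: "'y prog" where
  "sweep = For CA (\<lambda>_. MoveL) ; For CA (\<lambda>_. MoveL) ;
     For CA (\<lambda>_. fire_all ; MoveR) ; For CA (\<lambda>_. fire_all ; MoveR) ;
     For CA (\<lambda>_. fire_all ; MoveR) ; For CA (\<lambda>_. fire_all ; MoveR) ; fire_all ;
     For CA (\<lambda>_. MoveL) ; For CA (\<lambda>_. MoveL)"

text \<open>Repetition in the program text. It is used only with a count that depends on the number
  of attributes, not on the input.\<close>

primrec repeat :: "nat \<Rightarrow> 'y prog \<Rightarrow> 'y prog" where
  "repeat 0 c = LSkip"
| "repeat (Suc n) c = c ; repeat n c"

definition check :: "'y prog" where
  "check = For Qry (pass_step (\<lambda>_. LSkip) (\<lambda>y. Test (At y) LSkip (Flag Bad True)) LSkip)"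

definition procedure :: "nat \<Rightarrow> 'y prog" where
  "procedure n = predictive_check Sig ; predictive_check Qry ; load ;
     repeat n (For CB (\<lambda>_. sweep)) ; check"

lemma lwf_procedure: "lwf (procedure n :: 'y prog) UNIV"
proof -
  have "lwf (repeat n c) A" if "lwf c A" for c :: "'y prog" and A
    using that by (induction n) auto
  then show ?thesis
    by (auto simp: procedure_def predictive_check_def load_def check_def sweep_def fire_all_def
        order_check_def cell_check_def pass_step_def split: sym.split)
qed

section \<open>Effect of the passes on the timelines\<close>

definition trk :: "'y tattr set \<Rightarrow> int set \<Rightarrow> int set \<Rightarrow> 'y track \<Rightarrow> int \<Rightarrow> bool" where
  "trk C P Q t k = (case t of At y \<Rightarrow> (y, k) \<in> C | ME \<Rightarrow> k \<in> P | MF \<Rightarrow> k \<in> Q)"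

definition flg :: "bool \<Rightarrow> bool \<Rightarrow> bool \<Rightarrow> bool \<Rightarrow> bool \<Rightarrow> flag \<Rightarrow> bool" where
  "flg sd no bad se sf f = (case f of Sd \<Rightarrow> sd | No \<Rightarrow> no | Bad \<Rightarrow> bad | SE \<Rightarrow> se | SF \<Rightarrow> sf)"

text \<open>With states written by \<open>trk\<close> and \<open>flg\<close>, the updates made by
  the passes lead to states of the same form, so the simplifier can execute the passes
  symbolically.\<close>

lemma trk_simps [simp]:
  "trk C P Q (At y) k \<longleftrightarrow> (y, k) \<in> C" "trk C P Q ME k \<longleftrightarrow> k \<in> P" "trk C P Q MF k \<longleftrightarrow> k \<in> Q"
  "(trk C P Q)(At y := (trk C P Q (At y))(k := True)) = trk (insert (y, k) C) P Q"
  "(trk C P Q)(ME := (trk C P Q ME)(k := True)) = trk C (insert k P) Q"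
  "(trk C P Q)(MF := (trk C P Q MF)(k := True)) = trk C P (insert k Q)"
  "(trk C P Q)(ME := (trk C P Q ME)(k := False)) = trk C (P - {k}) Q"
  "(trk C P Q)(MF := (trk C P Q MF)(k := False)) = trk C P (Q - {k})"
  by (auto simp: trk_def fun_eq_iff split: track.split)

lemma flg_simps [simp]:
  "flg sd no bad se sf Sd = sd" "flg sd no bad se sf No = no" "flg sd no bad se sf Bad = bad"
  "flg sd no bad se sf SE = se" "flg sd no bad se sf SF = sf"
  "(flg sd no bad se sf)(Sd := b) = flg b no bad se sf"
  "(flg sd no bad se sf)(No := b) = flg sd b bad se sf"
  "(flg sd no bad se sf)(Bad := b) = flg sd no b se sf"
  "(flg sd no bad se sf)(SE := b) = flg sd no bad b sf"
  "(flg sd no bad se sf)(SF := b) = flg sd no bad se b"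
  by (auto simp: flg_def fun_eq_iff split: flag.split)

lemma fold_const: "fold (\<lambda>_. f) xs s = (f ^^ length xs) s"
  by (induction xs arbitrary: s) (simp_all add: funpow_swap1)

lemma funpow_moves:
  "(leval ro (pass_step cE cF cend Bit1) ^^ n) (T, h, F) = (T, h + int n, F)"
  "(leval ro (pass_step cE cF cend Neg) ^^ n) (T, h, F) = (T, h - int n, F)"
  by (induction n) (simp_all add: pass_step_def)

text \<open>The moves before and after the attribute cancel, which leaves only its action at the
  time point \<open>h + snd t\<close>.\<close>

lemma fold_conv_term:
  assumes "leval ro (if F Sd then cF (fst t) else cE (fst t)) (T, h + snd t, F) = (T', h + snd t, F')"
  shows "pass ro cE cF cend (conv_term t) (T, h, F) = (T', h, F')"
proof -
  have Att: "leval ro (pass_step cE cF cend (Att (fst t))) (T, h + snd t, F) = (T', h + snd t, F')"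
    using assms by (cases "F Sd") (simp_all add: pass_step_def)
  show ?thesis
  proof (cases "snd t < 0")
    case True
    then have "h - int (nat \<bar>snd t\<bar>) = h + snd t" by simp
    then show ?thesis using True Att by (simp add: conv_term_def Let_def funpow_moves)
  next
    case False
    then have "h + int (nat \<bar>snd t\<bar>) = h + snd t" by simp
    then show ?thesis using False Att by (simp add: conv_term_def Let_def funpow_moves)
  qed
qed

lemma fold_conv_fml:
  assumes "pass ro cE cF cend (conv_terms (fst g)) (T, h, F) = (T1, h, F1)"
    and "pass ro cE cF cend (conv_terms (snd g)) (T1, h, F1(Sd := True)) = (T2, h, F2)"
  shows "pass ro cE cF cend (conv_fml g) (T, h, F) =
    leval ro cend (T2, h, F2(Sd := False))"
  using assms by (simp add: conv_fml_def) (simp add: pass_step_def)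

definition time_points :: "'y tattr list \<Rightarrow> int \<Rightarrow> int set" where
  "time_points ts h = (\<lambda>t. h + snd t) ` set ts"

lemma time_points_simps [simp]: "time_points [] h = {}" "time_points (t # ts) h = insert (h + snd t) (time_points ts h)"
  by (simp_all add: time_points_def)

definition placed :: "'y tattr list \<Rightarrow> int \<Rightarrow> 'y tattr set" where
  "placed ts h = shift h (set ts)"

lemma placed_simps [simp]: "placed [] h = {}" "placed (t # ts) h = insert (fst t, h + snd t) (placed ts h)"
  by (auto simp: placed_def shift_def add.commute split: prod.splits)

lemma mark_E:
  "pass ro (\<lambda>_. Mark ME True) cF cend (conv_terms ts)
    (trk C P Q, h, flg False no bad se sf) = (trk C (P \<union> time_points ts h) Q, h, flg False no bad se sf)"
proof (induction ts arbitrary: P)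
  case (Cons t ts)
  have "pass ro (\<lambda>_. Mark ME True) cF cend (conv_term t)
    (trk C P Q, h, flg False no bad se sf) = (trk C (insert (h + snd t) P) Q, h, flg False no bad se sf)"
    by (rule fold_conv_term) simp
  then show ?case using Cons by simp
qed simp

lemma mark_F:
  "pass ro cE (\<lambda>_. Mark MF True) cend (conv_terms ts)
    (trk C P Q, h, flg True no bad se sf) = (trk C P (Q \<union> time_points ts h), h, flg True no bad se sf)"
proof (induction ts arbitrary: Q)
  case (Cons t ts)
  have "pass ro cE (\<lambda>_. Mark MF True) cend (conv_term t)
    (trk C P Q, h, flg True no bad se sf) = (trk C P (insert (h + snd t) Q), h, flg True no bad se sf)"
    by (rule fold_conv_term) simp
  then show ?case using Cons by simp
qed simp

lemma load_E:
  "pass ro (\<lambda>y. Mark (At y) True) cF cend (conv_terms ts)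
    (trk C P Q, h, flg False no bad se sf) = (trk (C \<union> placed ts h) P Q, h, flg False no bad se sf)"
proof (induction ts arbitrary: C)
  case (Cons t ts)
  have "pass ro (\<lambda>y. Mark (At y) True) cF cend (conv_term t)
    (trk C P Q, h, flg False no bad se sf) = (trk (insert (fst t, h + snd t) C) P Q, h, flg False no bad se sf)"
    by (rule fold_conv_term) simp
  then show ?case using Cons by simp
qed simp

lemma skip_F:
  "pass ro cE (\<lambda>_. LSkip) cend (conv_terms ts)
    (trk C P Q, h, flg True no bad se sf) = (trk C P Q, h, flg True no bad se sf)"
proof (induction ts)
  case (Cons t ts)
  have "pass ro cE (\<lambda>_. LSkip) cend (conv_term t)
    (trk C P Q, h, flg True no bad se sf) = (trk C P Q, h, flg True no bad se sf)"
    by (rule fold_conv_term) simp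
  then show ?case using Cons by simp
qed simp

lemma skip_E:
  "pass ro (\<lambda>_. LSkip) cF cend (conv_terms ts)
    (trk C P Q, h, flg False no bad se sf) = (trk C P Q, h, flg False no bad se sf)"
proof (induction ts)
  case (Cons t ts)
  have "pass ro (\<lambda>_. LSkip) cF cend (conv_term t)
    (trk C P Q, h, flg False no bad se sf) = (trk C P Q, h, flg False no bad se sf)"
    by (rule fold_conv_term) simp
  then show ?case using Cons by simp
qed simp

lemma test_E:
  "pass ro (\<lambda>y. Test (At y) LSkip (Flag No True)) cF cend (conv_terms ts)
    (trk C P Q, h, flg False no bad se sf) = (trk C P Q, h, flg False (no \<or> \<not> placed ts h \<subseteq> C) bad se sf)"
proof (induction ts arbitrary: no)
  case (Cons t ts)
  have "pass ro (\<lambda>y. Test (At y) LSkip (Flag No True)) cF cend (conv_term t)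
    (trk C P Q, h, flg False no bad se sf) =
    (trk C P Q, h, flg False (no \<or> (fst t, h + snd t) \<notin> C) bad se sf)"
    by (rule fold_conv_term) simp
  then show ?case using Cons by simp
qed simp

lemma fire_F:
  "pass ro cE (\<lambda>y. IfF No LSkip (Mark (At y) True)) cend (conv_terms ts)
    (trk C P Q, h, flg True no bad se sf) =
    (trk (if no then C else C \<union> placed ts h) P Q, h, flg True no bad se sf)"
proof (induction ts arbitrary: C)
  case (Cons t ts)
  have "pass ro cE (\<lambda>y. IfF No LSkip (Mark (At y) True)) cend (conv_term t)
    (trk C P Q, h, flg True no bad se sf) =
    (trk (if no then C else insert (fst t, h + snd t) C) P Q, h, flg True no bad se sf)"
    by (rule fold_conv_term) simp
  then show ?case using Cons by simp
qed simp

lemma check_F: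
  "pass ro cE (\<lambda>y. Test (At y) LSkip (Flag Bad True)) cend (conv_terms ts)
    (trk C P Q, h, flg True no bad se sf) =
    (trk C P Q, h, flg True no (bad \<or> \<not> placed ts h \<subseteq> C) se sf)"
proof (induction ts arbitrary: bad)
  case (Cons t ts)
  have "pass ro cE (\<lambda>y. Test (At y) LSkip (Flag Bad True)) cend (conv_term t)
    (trk C P Q, h, flg True no bad se sf) =
    (trk C P Q, h, flg True no (bad \<or> (fst t, h + snd t) \<notin> C) se sf)"
    by (rule fold_conv_term) simp
  then show ?case using Cons by simp
qed simp

text \<open>A pass that starts with the head at \<open>h\<close> meets a term (y, e) at position h +
  e, so it tests and writes the formulas shifted by \<open>h\<close>.\<close>

lemma leval_fire_all:
  assumes "ro Sig = concat (map conv_fml \<Sigma>s)"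
  shows "leval ro fire_all (trk C P Q, h, flg False False bad se sf) =
    (trk (fold (\<lambda>g. fire g h) (map fml_of \<Sigma>s) C) P Q, h, flg False False bad se sf)"
proof -
  let ?f = "\<lambda>s. leval ro (pass_step (\<lambda>y. Test (At y) LSkip (Flag No True))
     (\<lambda>y. IfF No LSkip (Mark (At y) True)) (Flag No False) s)"
  have 1: "fold ?f (conv_fml g) (trk C P Q, h, flg False False bad se sf) =
      (trk (fire (fml_of g) h C) P Q, h, flg False False bad se sf)" for g C
  proof -
    have "fold ?f (conv_fml g) (trk C P Q, h, flg False False bad se sf) =
        leval ro (Flag No False) (trk (if \<not> placed (fst g) h \<subseteq> C then C else C \<union> placed (snd g) h) P Q, h,
          (flg True (\<not> placed (fst g) h \<subseteq> C) bad se sf)(Sd := False))"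
      by (rule fold_conv_fml[OF test_E]) (simp only: flg_simps fire_F simp_thms)
    then show ?thesis by (simp add: fire_def fml_of_def placed_def)
  qed
  have "fold ?f (concat (map conv_fml \<Sigma>s)) (trk C P Q, h, flg False False bad se sf) =
    (trk (fold (\<lambda>g. fire g h) (map fml_of \<Sigma>s) C) P Q, h, flg False False bad se sf)"
    by (induction \<Sigma>s arbitrary: C) (simp_all add: 1)
  then show ?thesis by (simp add: fire_all_def assms)
qed

lemma funpow_MoveL: "(leval ro MoveL ^^ n) (T, h, F) = (T, h - int n, F)"
  by (induction n) auto

lemma leval_sweep:
  assumes "ro Sig = concat (map conv_fml \<Sigma>s)" "length (ro CA) = N"
  shows "leval ro sweep (trk C P Q, 0, flg False False bad se sf) =
    (trk (saturate (map fml_of \<Sigma>s) (map (\<lambda>i. int i - 2 * int N) [0..<4 * N + 1]) C) P Q, 0,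
     flg False False bad se sf)"
proof -
  let ?F = "\<lambda>i C. fold (\<lambda>g. fire g i) (map fml_of \<Sigma>s) C"
  let ?S = "\<lambda>C h. (trk C P Q, h, flg False False bad se sf)"
  have move: "leval ro (For CA (\<lambda>_. MoveL)) (?S C h) = ?S C (h - int N)" for C h
    by (simp add: fold_const assms(2) funpow_MoveL)
  have step: "(leval ro (fire_all ; MoveR) ^^ n) (?S C h) =
      ?S (fold ?F (map (\<lambda>i. h + int i) [0..<n]) C) (h + int n)" for n C h
    by (induction n) (simp_all add: leval_fire_all[of ro \<Sigma>s, OF assms(1)])
  have loop: "leval ro (For CA (\<lambda>_. fire_all ; MoveR)) (?S C h) =
      ?S (fold ?F (map (\<lambda>i. h + int i) [0..<N]) C) (h + int N)" for C h
    using step[of N C h] by (simp only: leval.simps(9) fold_const assms(2))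
  have app: "fold ?F (map (\<lambda>i. h + int m + int i) [0..<n]) (fold ?F (map (\<lambda>i. h + int i) [0..<m]) C) =
      fold ?F (map (\<lambda>i. h + int i) [0..<m + n]) C" for h m n C
  proof -
    have "map (\<lambda>i. h + int i) [0..<m + n] = map (\<lambda>i. h + int i) [0..<m] @ map (\<lambda>i. h + int m + int i) [0..<n]"
      by (rule nth_equalityI) (auto simp: nth_append)
    then show ?thesis by simp
  qed
  let ?h = "- 2 * int N"
  have "leval ro sweep (?S C 0) =
    ?S (?F (?h + int (4 * N)) (fold ?F (map (\<lambda>i. ?h + int i) [0..<4 * N]) C)) 0"
  proof -
    have eq: "?h + int N + int N = ?h + int (N + N)" "?h + int (N + N) + int N = ?h + int (N + N + N)"
      "?h + int (N + N + N) + int N = ?h + int (N + N + N + N)" "0 - int N - int N = ?h" "N + N + N + N = 4 * N"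
      "?h + int (4 * N) - int N - int N = 0"
      by simp_all
    show ?thesis
      unfolding sweep_def leval.simps(6) move loop leval_fire_all[of ro \<Sigma>s, OF assms(1)] eq(4)
      unfolding eq(1-3) app unfolding eq(5) move eq(6) leval_fire_all[of ro \<Sigma>s, OF assms(1)] by simp
  qed
  also have "?F (?h + int (4 * N)) (fold ?F (map (\<lambda>i. ?h + int i) [0..<4 * N]) C) =
      fold ?F (map (\<lambda>i. ?h + int i) [0..<4 * N + 1]) C" by simp
  also have "map (\<lambda>i. ?h + int i) [0..<4 * N + 1] = map (\<lambda>i. int i - 2 * int N) [0..<4 * N + 1]" by simp
  finally show ?thesis by (simp only: saturate_def)
qed

lemma leval_repeat: "leval ro (repeat n c) s = (leval ro c ^^ n) s"
  by (induction n arbitrary: s) (simp_all add: funpow_swap1)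

lemma leval_rounds:
  assumes "ro Sig = concat (map conv_fml \<Sigma>s)" "length (ro CA) = N" "length (ro CB) = N"
  shows "leval ro (repeat n (For CB (\<lambda>_. sweep))) (trk C P Q, 0, flg False False bad se sf) =
    (trk ((saturate (map fml_of \<Sigma>s) (map (\<lambda>i. int i - 2 * int N) [0..<4 * N + 1]) ^^ (n * N)) C) P Q, 0,
     flg False False bad se sf)"
proof -
  let ?sat = "saturate (map fml_of \<Sigma>s) (map (\<lambda>i. int i - 2 * int N) [0..<4 * N + 1])"
  have "(leval ro sweep ^^ m) (trk C P Q, 0, flg False False bad se sf) =
      (trk ((?sat ^^ m) C) P Q, 0, flg False False bad se sf)" for m C
  proof (induction m)
    case (Suc m)
    then show ?case using leval_sweep[of ro \<Sigma>s N, OF assms(1,2)] by simp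
  qed simp
  then have "leval ro (For CB (\<lambda>_. sweep)) (trk C P Q, 0, flg False False bad se sf) =
      (trk ((?sat ^^ N) C) P Q, 0, flg False False bad se sf)" for C
    by (simp only: leval.simps(9) fold_const assms(3))
  then have "(leval ro (For CB (\<lambda>_. sweep)) ^^ n) (trk C P Q, 0, flg False False bad se sf) =
      (trk ((?sat ^^ (n * N)) C) P Q, 0, flg False False bad se sf)"
    by (induction n) (simp_all only: funpow.simps comp_apply mult_Suc funpow_add id_apply mult_0)
  then show ?thesis by (simp only: leval_repeat)
qed

lemma leval_cell_check:
  "leval ro cell_check (trk C P Q, h, flg sd no bad se sf) =
    (trk C (P - {h}) (Q - {h}), h + 1,
     flg sd no (bad \<or> (h \<in> P \<and> sf)) (se \<or> h \<in> P) (sf \<or> h \<in> Q))"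
  by (auto simp: cell_check_def)

text \<open>A violating pair q < p is recorded when the scan reaches the premise mark
  \<open>p\<close>, by which time \<open>q\<close> has been seen. The step from \<open>m\<close> to
  \<open>Suc m\<close> thus adds just the pairs whose \<open>p\<close> is the new cell.\<close>

lemma leval_cell_checks:
  "(leval ro cell_check ^^ m) (trk C P Q, h, flg sd no bad False False) =
    (trk C (P - {h..<h + int m}) (Q - {h..<h + int m}), h + int m,
     flg sd no (bad \<or> (\<exists>p\<in>P. \<exists>q\<in>Q. h \<le> q \<and> q < p \<and> p < h + int m))
       (\<exists>p\<in>P. h \<le> p \<and> p < h + int m) (\<exists>q\<in>Q. h \<le> q \<and> q < h + int m))"
proof (induction m)
  case 0
  have "\<not> (\<exists>p\<in>R. h \<le> p \<and> p < h + int 0)" for R by force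
  moreover have "\<not> (\<exists>p\<in>P. \<exists>q\<in>Q. h \<le> q \<and> q < p \<and> p < h + int 0)" by force
  ultimately show ?case by (simp only: funpow.simps id_apply) simp
next
  case (Suc m)
  have 1: "(\<exists>p\<in>P. \<exists>q\<in>Q. h \<le> q \<and> q < p \<and> p < h + int (Suc m)) \<longleftrightarrow>
      (\<exists>p\<in>P. \<exists>q\<in>Q. h \<le> q \<and> q < p \<and> p < h + int m) \<or>
      (h + int m \<in> P - {h..<h + int m} \<and> (\<exists>q\<in>Q. h \<le> q \<and> q < h + int m))"
    (is "?l = (?a \<or> ?b)")
  proof
    assume ?l
    then obtain p q where pq: "p \<in> P" "q \<in> Q" "h \<le> q" "q < p" "p < h + int (Suc m)" by blast
    show "?a \<or> ?b"
    proof (cases "p = h + int m")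
      case True
      then have "h + int m \<in> P - {h..<h + int m}" "q < h + int m" using pq by auto
      then show ?thesis using pq(2,3) by blast
    next
      case False
      then have "p < h + int m" using pq(5) by simp
      then show ?thesis using pq by blast
    qed
  next
    assume "?a \<or> ?b"
    then show ?l
    proof
      assume ?a
      then obtain p q where "p \<in> P" "q \<in> Q" "h \<le> q" "q < p" "p < h + int m" by blast
      then show ?l by (intro bexI[of _ p] bexI[of _ q]) auto
    next
      assume ?b
      then obtain q where "q \<in> Q" "h \<le> q" "q < h + int m" "h + int m \<in> P" by blast
      then show ?l by (intro bexI[of _ "h + int m"] bexI[of _ q]) auto
    qed
  qed
  have 2: "(\<exists>p\<in>R. h \<le> p \<and> p < h + int (Suc m)) \<longleftrightarrow>
      (\<exists>p\<in>R. h \<le> p \<and> p < h + int m) \<or> h + int m \<in> R - {h..<h + int m}" (is "?l = ?r") for R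
  proof
    assume ?l
    then obtain p where p: "p \<in> R" "h \<le> p" "p < h + int (Suc m)" by blast
    then show ?r by (cases "p = h + int m") auto
  next
    assume ?r
    then show ?l
    proof
      assume "\<exists>p\<in>R. h \<le> p \<and> p < h + int m"
      then obtain p where "p \<in> R" "h \<le> p" "p < h + int m" by blast
      then show ?l by (intro bexI[of _ p]) auto
    next
      assume "h + int m \<in> R - {h..<h + int m}"
      then show ?l by (intro bexI[of _ "h + int m"]) auto
    qed
  qed
  have 3: "R - {h..<h + int m} - {h + int m} = R - {h..<h + int (Suc m)}" for R
    by auto
  have 4: "h + int m + 1 = h + int (Suc m)" by simp
  show ?case
    unfolding funpow.simps comp_apply Suc.IH leval_cell_check 1 2 3 4 by (simp add: disj_assoc)
qed

lemma leval_order_check: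
  assumes "length (ro CA) = N" "P \<subseteq> {- int N..int N}" "Q \<subseteq> {- int N..int N}"
  shows "leval ro order_check (trk C P Q, 0, flg sd no bad False False) =
    (trk C {} {}, 0, flg sd no (bad \<or> \<not> (P \<noteq> {} \<and> Q \<noteq> {} \<and> (\<forall>p\<in>P. \<forall>q\<in>Q. p \<le> q))) False False)"
proof -
  let ?h = "- int N" and ?m = "N + N + 1"
  have move: "leval ro (For CA (\<lambda>_. MoveL)) (T, h, F) = (T, h - int N, F)" for T h F
    by (simp add: fold_const assms(1) funpow_MoveL)
  have loop: "leval ro (For CA (\<lambda>_. cell_check)) s = (leval ro cell_check ^^ N) s" for s
    by (simp only: leval.simps(9) fold_const assms(1))
  have "leval ro cell_check ((leval ro cell_check ^^ N) ((leval ro cell_check ^^ N) s)) =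
      (leval ro cell_check ^^ ?m) s" for s
    by (simp add: funpow_add)
  then have cells: "leval ro order_check (trk C P Q, 0, flg sd no bad False False) =
      leval ro (IfF SE LSkip (Flag Bad True) ; IfF SF LSkip (Flag Bad True) ; Flag SE False ; Flag SF False ;
     For CA (\<lambda>_. MoveL) ; MoveL) ((leval ro cell_check ^^ ?m) (trk C P Q, ?h, flg sd no bad False False))"
    unfolding order_check_def leval.simps(6) move loop by simp
  have bound: "p \<in> P \<Longrightarrow> - int N \<le> p \<and> p < ?h + int ?m" "p \<in> Q \<Longrightarrow> - int N \<le> p \<and> p < ?h + int ?m" for p
    using assms(2,3) by force+
  have P: "P - {?h..<?h + int ?m} = {}" "Q - {?h..<?h + int ?m} = {}" using bound by auto
  have ex: "(\<exists>p\<in>P. ?h \<le> p \<and> p < ?h + int ?m) \<longleftrightarrow> P \<noteq> {}" "(\<exists>q\<in>Q. ?h \<le> q \<and> q < ?h + int ?m) \<longleftrightarrow> Q \<noteq> {}"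
    using bound by blast+
  have bad: "(\<exists>p\<in>P. \<exists>q\<in>Q. ?h \<le> q \<and> q < p \<and> p < ?h + int ?m) \<longleftrightarrow> \<not> (\<forall>p\<in>P. \<forall>q\<in>Q. p \<le> q)"
    using bound by (meson not_le)
  show ?thesis
    unfolding cells leval_cell_checks P ex bad leval.simps(6) by (auto simp: move simp del: leval.simps(9))
qed

lemma predictive_fml_of:
  "predictive (fml_of g) \<longleftrightarrow> time_points (fst g) 0 \<noteq> {} \<and> time_points (snd g) 0 \<noteq> {} \<and>
    (\<forall>p\<in>time_points (fst g) 0. \<forall>q\<in>time_points (snd g) 0. p \<le> q)"
  unfolding predictive_def fml_of_def time_points_def by force

lemma fold_predictive:
  assumes "length (ro CA) = N" "\<And>t. t \<in> set (fst g) \<union> set (snd g) \<Longrightarrow> \<bar>snd t\<bar> \<le> int N"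
  shows "pass ro (\<lambda>_. Mark ME True) (\<lambda>_. Mark MF True) order_check (conv_fml g)
    (trk C {} {}, 0, flg False no bad False False) =
    (trk C {} {}, 0, flg False no (bad \<or> \<not> predictive (fml_of g)) False False)"
proof -
  have P: "time_points (fst g) 0 \<subseteq> {- int N..int N}" "time_points (snd g) 0 \<subseteq> {- int N..int N}"
    using assms(2) by (force simp: time_points_def)+
  have "pass ro (\<lambda>_. Mark ME True) (\<lambda>_. Mark MF True) order_check (conv_fml g)
      (trk C {} {}, 0, flg False no bad False False) =
      leval ro order_check (trk C (time_points (fst g) 0) (time_points (snd g) 0), 0,
        (flg True no bad False False)(Sd := False))"
    by (rule fold_conv_fml[OF mark_E[where P = "{}", unfolded Un_empty_left]])
      (simp only: mark_F flg_simps Un_empty_left)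
  then show ?thesis
    by (simp only: flg_simps leval_order_check[of ro N, OF assms(1) P] predictive_fml_of)
qed

lemma leval_predictive_check:
  assumes "length (ro CA) = N" "ro r = concat (map conv_fml gs)"
    "\<And>g t. g \<in> set gs \<Longrightarrow> t \<in> set (fst g) \<union> set (snd g) \<Longrightarrow> \<bar>snd t\<bar> \<le> int N"
  shows "leval ro (predictive_check r) (trk C {} {}, 0, flg False no bad False False) =
    (trk C {} {}, 0, flg False no (bad \<or> \<not> (\<forall>g\<in>set gs. predictive (fml_of g))) False False)"
proof -
  have "pass ro (\<lambda>_. Mark ME True) (\<lambda>_. Mark MF True) order_check
      (concat (map conv_fml gs)) (trk C {} {}, 0, flg False no bad False False) =
    (trk C {} {}, 0, flg False no (bad \<or> \<not> (\<forall>g\<in>set gs. predictive (fml_of g))) False False)"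
    using assms(3)
  proof (induction gs arbitrary: bad)
    case (Cons g gs)
    have "\<bar>snd t\<bar> \<le> int N" if "t \<in> set (fst g) \<union> set (snd g)" for t
      by (rule Cons.prems[OF _ that]) simp
    note g = fold_predictive[of ro N g, OF assms(1) this]
    have IH: "pass ro (\<lambda>_. Mark ME True) (\<lambda>_. Mark MF True) order_check
      (concat (map conv_fml gs)) (trk C {} {}, 0, flg False no bad False False) =
      (trk C {} {}, 0, flg False no (bad \<or> \<not> (\<forall>g\<in>set gs. predictive (fml_of g))) False False)" for bad
      by (rule Cons.IH, rule Cons.prems) auto
    show ?case by (simp only: list.map concat.simps fold_append comp_apply g IH) simp
  qed simp
  then show ?thesis by (simp only: predictive_check_def leval.simps(9) assms(2))
qed

theorem leval_procedure:
  assumes ro: "ro Sig = concat (map conv_fml \<Sigma>s)" "ro Qry = conv_fml f" "length (ro CA) = N" "length (ro CB) = N"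
    and bound: "\<And>g t. g \<in> set (\<Sigma>s @ [f]) \<Longrightarrow> t \<in> set (fst g) \<union> set (snd g) \<Longrightarrow> \<bar>snd t\<bar> \<le> int N"
  shows "\<exists>T h F. leval ro (procedure n) (\<lambda>_ _. False, 0, \<lambda>_. False) = (T, h, F) \<and>
    (F Bad \<longleftrightarrow> \<not> ((\<forall>g\<in>set (\<Sigma>s @ [f]). predictive (fml_of g)) \<and> set (snd f) \<subseteq>
      (saturate (map fml_of \<Sigma>s) (map (\<lambda>i. int i - 2 * int N) [0..<4 * N + 1]) ^^ (n * N)) (set (fst f))))"
proof -
  let ?sat = "saturate (map fml_of \<Sigma>s) (map (\<lambda>i. int i - 2 * int N) [0..<4 * N + 1]) ^^ (n * N)"
  let ?b1 = "\<not> (\<forall>g\<in>set \<Sigma>s. predictive (fml_of g))" and ?b2 = "\<not> (\<forall>g\<in>set [f]. predictive (fml_of g))"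
  have init: "(\<lambda>_ _. False, 0, \<lambda>_. False) = (trk {} {} {}, 0, flg False False False False False)"
    by (auto simp: trk_def flg_def fun_eq_iff split: track.split flag.split)
  have b1: "\<bar>snd t\<bar> \<le> int N" if "g \<in> set \<Sigma>s" "t \<in> set (fst g) \<union> set (snd g)" for g t
    by (rule bound[OF _ that(2)]) (use that(1) in simp)
  have b2: "\<bar>snd t\<bar> \<le> int N" if "g \<in> set [f]" "t \<in> set (fst g) \<union> set (snd g)" for g t
    by (rule bound[OF _ that(2)]) (use that(1) in simp)
  have q: "ro Qry = concat (map conv_fml [f])" using ro(2) by simp
  have load: "leval ro load (trk {} {} {}, 0, flg False False bad False False) =
      (trk (set (fst f)) {} {}, 0, flg False False bad False False)" for bad
  proof -
    have "pass ro (\<lambda>y. Mark (At y) True) (\<lambda>_. LSkip) LSkip (conv_fml f)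
      (trk {} {} {}, 0, flg False False bad False False) =
      leval ro LSkip (trk (placed (fst f) 0) {} {}, 0, (flg True False bad False False)(Sd := False))"
      by (rule fold_conv_fml[OF load_E[where C = "{}", unfolded Un_empty_left]])
        (simp only: skip_F flg_simps)
    then show ?thesis by (simp add: load_def ro(2) placed_def)
  qed
  have check: "leval ro check (trk C {} {}, 0, flg False False bad False False) =
      (trk C {} {}, 0, flg False False (bad \<or> \<not> set (snd f) \<subseteq> C) False False)" for C bad
  proof -
    have "pass ro (\<lambda>_. LSkip) (\<lambda>y. Test (At y) LSkip (Flag Bad True)) LSkip (conv_fml f)
      (trk C {} {}, 0, flg False False bad False False) =
      leval ro LSkip (trk C {} {}, 0, (flg True False (bad \<or> \<not> placed (snd f) 0 \<subseteq> C) False False)(Sd := False))"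
      by (rule fold_conv_fml[OF skip_E]) (simp only: check_F flg_simps)
    then show ?thesis by (simp add: check_def ro(2) placed_def)
  qed
  have p1: "leval ro (predictive_check Sig) (trk {} {} {}, 0, flg False False bad False False) =
      (trk {} {} {}, 0, flg False False (bad \<or> ?b1) False False)" for bad
    by (rule leval_predictive_check[OF ro(3,1)]) (rule b1)
  have p2: "leval ro (predictive_check Qry) (trk {} {} {}, 0, flg False False bad False False) =
      (trk {} {} {}, 0, flg False False (bad \<or> ?b2) False False)" for bad
    by (rule leval_predictive_check[OF ro(3) q]) (rule b2)
  have "leval ro (procedure n) (\<lambda>_ _. False, 0, \<lambda>_. False) =
      (trk (?sat (set (fst f))) {} {}, 0,
       flg False False (((False \<or> ?b1) \<or> ?b2) \<or> \<not> set (snd f) \<subseteq> ?sat (set (fst f))) False False)"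
    unfolding init procedure_def leval.simps(6) p1 p2 load leval_rounds[of ro \<Sigma>s N, OF ro(1,3,4)] check
    by (rule refl)
  then show ?thesis by auto
qed

section \<open>Unique readability\<close>

lemma append_Cons_inj:
  "x \<notin> set a \<Longrightarrow> x \<notin> set a' \<Longrightarrow> a @ x # r = a' @ x # r' \<Longrightarrow> a = a' \<and> r = r'"
proof (induction a arbitrary: a')
  case Nil
  then show ?case by (cases a') auto
next
  case (Cons s a)
  then show ?case by (cases a') auto
qed

lemma set_enc_int: "set (enc_int e :: 'y sym list) \<subseteq> {Neg, Bit0, Bit1}"
proof -
  let ?B = "set (bin (nat \<bar>e\<bar>) :: 'y sym list)"
  have "set (enc_int e :: 'y sym list) \<subseteq> insert Neg ?B"
    unfolding enc_int_def set_append by (rule Un_least; auto)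
  also have "\<dots> \<subseteq> {Neg, Bit0, Bit1}" by (rule insert_mono, rule set_bin)
  finally show ?thesis .
qed

definition dec_int :: "'y sym list \<Rightarrow> int" where
  "dec_int xs = (case xs of Neg # ys \<Rightarrow> - int (bin_val ys) | _ \<Rightarrow> int (bin_val xs))"

lemma dec_enc_int: "dec_int (enc_int e :: 'y sym list) = e"
proof (cases "e < 0")
  case True
  then have "enc_int e = (Neg :: 'y sym) # bin (nat \<bar>e\<bar>)" by (simp add: enc_int_def)
  then have "dec_int (enc_int e :: 'y sym list) = - int (nat \<bar>e\<bar>)" by (simp only: dec_int_def list.case sym.case bin_val_bin)
  then show ?thesis using True by simp
next
  case False
  have enc: "enc_int e = (bin (nat \<bar>e\<bar>) :: 'y sym list)" using False by (simp add: enc_int_def)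
  show ?thesis
  proof (cases "bin (nat \<bar>e\<bar>) :: 'y sym list")
    case (Cons s ys)
    have "set (bin (nat \<bar>e\<bar>) :: 'y sym list) \<subseteq> {Bit0, Bit1}" by (rule set_bin)
    then have "s \<in> {Bit0, Bit1}" unfolding Cons by simp
    then have "dec_int (s # ys) = int (bin_val (s # ys))" by (auto simp: dec_int_def)
    then have "dec_int (enc_int e :: 'y sym list) = int (nat \<bar>e\<bar>)" unfolding enc by (simp only: Cons[symmetric] bin_val_bin)
    then show ?thesis using False by simp
  next
    case Nil
    then have "bin_val (bin (nat \<bar>e\<bar>) :: 'y sym list) = 0" by (simp only: bin_val.simps)
    then have "nat \<bar>e\<bar> = 0" by (simp only: bin_val_bin)
    then show ?thesis using enc Nil by (simp add: dec_int_def)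
  qed
qed

lemma enc_int_inj:
  assumes "(enc_int e :: 'y sym list) = enc_int e'" shows "e = e'"
proof -
  have "e = dec_int (enc_int e :: 'y sym list)" by (rule dec_enc_int[symmetric])
  also have "\<dots> = e'" unfolding assms by (rule dec_enc_int)
  finally show ?thesis .
qed

lemma enc_terms_inj:
  fixes ts us :: "'y tattr list"
  shows "enc_terms ts = enc_terms us \<Longrightarrow> ts = us"
proof (induction ts arbitrary: us)
  case Nil
  show ?case
  proof (cases us)
    case (Cons u us')
    have "enc_terms us = Att (fst u) # enc_int (snd u) @ enc_terms us'"
      unfolding Cons by (simp add: enc_term_def)
    then show ?thesis using Nil.prems by simp
  qed simp
next
  case (Cons t ts)
  let ?P = "\<lambda>s :: 'y sym. s \<in> {Neg, Bit0, Bit1}"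
  have tts: "enc_terms (t # ts) = Att (fst t) # enc_int (snd t) @ enc_terms ts" by (simp add: enc_term_def)
  obtain u us' where us: "us = u # us'"
  proof (cases us)
    case Nil
    then have "enc_terms (t # ts) = []" using Cons.prems by simp
    then show ?thesis using tts by simp
  qed (rule that)
  have "enc_terms us = Att (fst u) # enc_int (snd u) @ enc_terms us'"
    unfolding us by (simp add: enc_term_def)
  then have eq: "Att (fst t) # enc_int (snd t) @ enc_terms ts = Att (fst u) # enc_int (snd u) @ enc_terms us'"
    using Cons.prems tts by simp
  \<comment> \<open>Signs and bits are distinct from attributes, so the numeral behind an attribute
    is the longest prefix of such symbols.\<close>
  have take: "takeWhile ?P (enc_int e @ enc_terms ts) = enc_int e" for e and ts :: "'y tattr list"
  proof -
    have 1: "takeWhile ?P (enc_terms ts) = []" by (cases ts) (simp_all add: enc_term_def)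
    have "takeWhile ?P (enc_int e @ enc_terms ts) = enc_int e @ takeWhile ?P (enc_terms ts)"
      by (rule takeWhile_append2) (rule subsetD[OF set_enc_int])
    then show ?thesis by (simp only: 1 append_Nil2)
  qed
  from eq have eq': "enc_int (snd t) @ enc_terms ts = enc_int (snd u) @ enc_terms us'" by simp
  then have int: "(enc_int (snd t) :: 'y sym list) = enc_int (snd u)"
    using take[of "snd t" ts] take[of "snd u" us'] by (simp only:)
  then have "enc_terms ts = enc_terms us'" using eq' by simp
  then have "ts = us'" by (rule Cons.IH)
  moreover have "t = u" using enc_int_inj[OF int] eq by (simp add: prod_eq_iff)
  ultimately show ?case by (simp add: us)
qed

lemma set_enc_terms:
  fixes ts :: "'y tattr list"
  shows "Arrow \<notin> set (enc_terms ts)" "Semi \<notin> set (enc_terms ts)"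
proof -
  have "s \<noteq> Arrow \<and> s \<noteq> Semi" if "s \<in> set (enc_term t)" for s :: "'y sym" and t
  proof -
    from that consider "s = Att (fst t)" | "s \<in> set (enc_int (snd t))" by (auto simp: enc_term_def)
    then show ?thesis
    proof cases
      case 2
      then have "s \<in> {Neg, Bit0, Bit1}" by (rule subsetD[OF set_enc_int])
      then show ?thesis by auto
    qed simp
  qed
  then show "Arrow \<notin> set (enc_terms ts)" "Semi \<notin> set (enc_terms ts)" by auto
qed

text \<open>A word in the intersection comes with one reading from \<open>L_ENT\<close> and another
  from \<open>L_PRE\<close>; injectivity identifies both with the reading that the machine
  follows.\<close>

lemma enc_input_inj: "enc_input \<Sigma>s f = enc_input \<Sigma>s' f' \<Longrightarrow> \<Sigma>s = \<Sigma>s' \<and> f = f'"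
proof (induction \<Sigma>s arbitrary: \<Sigma>s')
  case Nil
  obtain a b where f: "f = (a, b)" by (cases f)
  show ?case
  proof (cases \<Sigma>s')
    case Nil': Nil
    obtain a' b' where f': "f' = (a', b')" by (cases f')
    have "enc_terms a @ Arrow # enc_terms b = enc_terms a' @ Arrow # enc_terms b'"
      using Nil by (simp only: f f' Nil' enc_input_Nil)
    from append_Cons_inj[OF set_enc_terms(1) set_enc_terms(1) this]
    have "enc_terms a = enc_terms a'" "enc_terms b = enc_terms b'" by simp_all
    then have "a = a'" "b = b'" by (simp_all only: enc_terms_inj)
    then show ?thesis using Nil' by (simp add: f f')
  next
    case (Cons g' \<Sigma>s1)
    obtain a' b' where g': "g' = (a', b')" by (cases g')
    have "enc_terms a @ Arrow # enc_terms b = enc_terms a' @ Arrow # enc_terms b' @ Semi # enc_input \<Sigma>s1 f'"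
      using Nil by (simp only: f g' Cons enc_input_Nil enc_input_Cons)
    from append_Cons_inj[OF set_enc_terms(1) set_enc_terms(1) this]
    have eq: "enc_terms b = enc_terms b' @ Semi # enc_input \<Sigma>s1 f'" by simp
    have "Semi \<in> set (enc_terms b)" unfolding eq by simp
    then show ?thesis using set_enc_terms(2) by blast
  qed
next
  case (Cons g \<Sigma>s)
  obtain a b where g: "g = (a, b)" by (cases g)
  let ?w = "enc_input \<Sigma>s f"
  show ?case
  proof (cases \<Sigma>s')
    case Nil
    obtain a' b' where f': "f' = (a', b')" by (cases f')
    have "enc_terms a @ Arrow # enc_terms b @ Semi # ?w = enc_terms a' @ Arrow # enc_terms b'"
      using Cons.prems by (simp only: g f' Nil enc_input_Nil enc_input_Cons)
    from append_Cons_inj[OF set_enc_terms(1) set_enc_terms(1) this]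
    have eq: "enc_terms b' = enc_terms b @ Semi # ?w" by simp
    have "Semi \<in> set (enc_terms b')" unfolding eq by simp
    then show ?thesis using set_enc_terms(2) by blast
  next
    case Cons': (Cons g' \<Sigma>s1)
    obtain a' b' where g': "g' = (a', b')" by (cases g')
    let ?w' = "enc_input \<Sigma>s1 f'"
    have "enc_terms a @ Arrow # enc_terms b @ Semi # ?w = enc_terms a' @ Arrow # enc_terms b' @ Semi # ?w'"
      using Cons.prems by (simp only: g g' Cons' enc_input_Cons)
    from append_Cons_inj[OF set_enc_terms(1) set_enc_terms(1) this]
    have a: "enc_terms a = enc_terms a'" and "enc_terms b @ Semi # ?w = enc_terms b' @ Semi # ?w'" by simp_all
    from append_Cons_inj[OF set_enc_terms(2) set_enc_terms(2) this(2)]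
    have b: "enc_terms b = enc_terms b'" and w: "?w = ?w'" by simp_all
    show ?thesis using enc_terms_inj[OF a] enc_terms_inj[OF b] Cons.IH[OF w] by (simp add: g g' Cons')
  qed
qed

section \<open>Length of the converted input\<close>

lemma length_conv_term: "length (conv_term t) = 2 * nat \<bar>snd t\<bar> + 1"
  by (simp add: conv_term_def Let_def)

lemma length_le_concat: "x \<in> set xs \<Longrightarrow> length x \<le> length (concat xs)"
  by (induction xs) auto

text \<open>Because a term spells out its integer in unary, the length of the converted strings can
  serve as the bound N.\<close>

lemma abs_le_length_conv_fml:
  assumes "t \<in> set (fst g) \<union> set (snd g)" shows "\<bar>snd t\<bar> \<le> int (length (conv_fml g))"
proof -
  have "length (conv_term t) \<le> length (conv_fml g)"
  proof (cases "t \<in> set (fst g)")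
    case True
    then have "length (conv_term t) \<le> length (conv_terms (fst g))" by (intro length_le_concat) simp
    then show ?thesis by (simp only: conv_fml_def length_append)
  next
    case False
    then have "length (conv_term t) \<le> length (conv_terms (snd g))"
      using assms by (intro length_le_concat) simp
    then show ?thesis by (simp only: conv_fml_def length_append list.size)
  qed
  then show ?thesis by (simp only: length_conv_term)
qed

text \<open>Each term takes at most 2 * M + 1 symbols in unary and at least one in the
  encoding.\<close>

lemma length_conv_terms:
  assumes "\<And>t. t \<in> set ts \<Longrightarrow> nat \<bar>snd t\<bar> \<le> M"
  shows "length (conv_terms ts) \<le> (2 * M + 1) * length (enc_terms ts)"
  using assms
proof (induction ts)
  case (Cons t ts)
  have "length (conv_term t) \<le> (2 * M + 1) * 1" using Cons.prems[of t] by (simp add: length_conv_term)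
  also have "\<dots> \<le> (2 * M + 1) * length (enc_term t)" by (rule mult_le_mono2) (simp add: enc_term_def)
  finally show ?case using Cons by (simp add: add_mult_distrib2)
qed simp

lemma length_conv_fml:
  assumes "\<And>t. t \<in> set (fst g) \<union> set (snd g) \<Longrightarrow> nat \<bar>snd t\<bar> \<le> M"
  shows "length (conv_fml g) \<le> (2 * M + 1) * (length (enc_fml g) + 1)"
proof -
  have "length (conv_terms (fst g)) \<le> (2 * M + 1) * length (enc_terms (fst g))"
    "length (conv_terms (snd g)) \<le> (2 * M + 1) * length (enc_terms (snd g))"
    using assms by (intro length_conv_terms; simp)+
  then have "length (conv_fml g) \<le> (2 * M + 1) * length (enc_terms (fst g)) +
      (2 * M + 1) * length (enc_terms (snd g)) + (2 * M + 1) * 2"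
    by (simp add: conv_fml_def)
  also have "\<dots> = (2 * M + 1) * (length (enc_fml g) + 1)"
    by (simp add: enc_fml_def algebra_simps)
  finally show ?thesis .
qed

lemma length_conv_theory:
  assumes "\<And>g t. g \<in> set gs \<Longrightarrow> t \<in> set (fst g) \<union> set (snd g) \<Longrightarrow> nat \<bar>snd t\<bar> \<le> M"
  shows "length (concat (map conv_fml gs)) \<le> (2 * M + 1) * length (concat (map (\<lambda>g. enc_fml g @ [Semi]) gs))"
  using assms
proof (induction gs)
  case (Cons g gs)
  have "length (conv_fml g) \<le> (2 * M + 1) * (length (enc_fml g) + 1)"
    by (rule length_conv_fml, rule Cons.prems[of g]) simp_all
  moreover have "length (concat (map conv_fml gs)) \<le>
      (2 * M + 1) * length (concat (map (\<lambda>g. enc_fml g @ [Semi]) gs))"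
    by (rule Cons.IH, rule Cons.prems) auto
  ultimately show ?case
    by (simp only: list.map concat.simps length_append list.size add_mult_distrib2)
qed simp

lemma length_conv_input:
  assumes "\<And>g t. g \<in> set (\<Sigma>s @ [f]) \<Longrightarrow> t \<in> set (fst g) \<union> set (snd g) \<Longrightarrow> nat \<bar>snd t\<bar> \<le> M"
  shows "length (concat (map conv_fml \<Sigma>s)) + length (conv_fml f) \<le> (2 * M + 1) * (length (enc_input \<Sigma>s f) + 1)"
proof -
  have "length (conv_fml f) \<le> (2 * M + 1) * (length (enc_fml f) + 1)"
    by (rule length_conv_fml, rule assms[of f]) simp_all
  moreover have "length (concat (map conv_fml \<Sigma>s)) \<le>
      (2 * M + 1) * length (concat (map (\<lambda>g. enc_fml g @ [Semi]) \<Sigma>s))"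
    by (rule length_conv_theory, rule assms) auto
  ultimately show ?thesis
    by (simp only: enc_input_def length_append add_mult_distrib2)
qed

section \<open>The complete program\<close>

text \<open>Draining destroys the string, so it is saved on \<open>Tmp 9\<close> in reverse and put
  back; meanwhile every symbol contributes one unit to both counters.\<close>

definition clock :: "ro \<Rightarrow> ('y pvar, 'y sym) com" where
  "clock r = Drain (Str r True) (\<lambda>a. pushall [(Tmp 9, a), (Str CA True, Bit1), (Str CB True, Bit1)]) ;;
     Drain (Tmp 9) (\<lambda>a. pushall [(Str r True, a)])"

lemma runs_clock:
  fixes out :: "ro \<Rightarrow> 'y sym list"
  assumes "r = Sig \<or> r = Qry"
  shows "runs (clock r) (12 * length (out r) + 3) (conv_state [] 1 0 [] fl out)
    (conv_state [] 1 0 [] fl (out(CA := replicate (length (out r)) Bit1 @ out CA,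
      CB := replicate (length (out r)) Bit1 @ out CB)))"
proof -
  let ?n = "length (out r)"
  let ?out = "out(CA := replicate ?n Bit1 @ out CA, CB := replicate ?n Bit1 @ out CB)"
  define \<sigma>1 where "\<sigma>1 = (conv_state [] 1 0 [] fl (?out(r := [])))(Tmp 9 := rev (out r))"
  have single: "concat (rev (map (\<lambda>a. [a]) xs)) = rev xs" for xs :: "'y sym list"
    by (induction xs) simp_all
  have 1: "runs (Drain (Str r True) (\<lambda>a. pushall [(Tmp 9, a), (Str CA True, Bit1), (Str CB True, Bit1)]))
      (?n * 8 + 1) (conv_state [] 1 0 [] fl out) \<sigma>1"
    by (rule runs_eq[OF runs_mono[OF runs_Drain_pushall[where xs = "out r" and k = 3]]])
      (use assms in \<open>auto simp: conv_state_def \<sigma>1_def fun_eq_iff drain_simps single split: var.split\<close>)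
  have 2: "runs (Drain (Tmp 9) (\<lambda>a. pushall [(Str r True, a)])) (?n * 4 + 1) \<sigma>1 (conv_state [] 1 0 [] fl ?out)"
    by (rule runs_eq[OF runs_mono[OF runs_Drain_pushall[where xs = "rev (out r)" and k = 1]]])
      (use assms in \<open>auto simp: conv_state_def \<sigma>1_def fun_eq_iff single split: var.split\<close>)
  show ?thesis unfolding clock_def by (rule runs_mono[OF runs_Seq[OF 1 2]]) simp
qed

text \<open>The first two pushes provide the closing \<open>Semi\<close> of the query and the
  initial bit weight 1 for the conversion. At the end an empty \<open>Fl Bad\<close> means
  acceptance.\<close>

definition main :: "'y track list \<Rightarrow> nat \<Rightarrow> ('y pvar, 'y sym) com" where
  "main ts n = (Push (Str Qry True) Semi ;; Push (Tmp 3) Bit1) ;; Drain (Tmp 0) conv_step ;;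
     (clock Sig ;; clock Qry) ;; compile ts (procedure n) ;; Pop (Fl Bad) (\<lambda>x. Halt (x = None))"

definition driver :: "'y track list \<Rightarrow> nat \<Rightarrow> ('y pvar, 'y sym) com" where
  "driver ts n = (Push (Tmp 1) Semi ;; Push (Tmp 2) Semi) ;; Drain Inp scan_step ;;
     Pop (Tmp 1) (\<lambda>q. Pop (Tmp 2) (\<lambda>d. case q of None \<Rightarrow> Halt False | Some q \<Rightarrow>
       (case d of None \<Rightarrow> Halt False | Some d \<Rightarrow> if accepting (q, d) then main ts n else Halt False)))"

definition strings :: "('y tattr list \<times> 'y tattr list) list \<Rightarrow> 'y tattr list \<times> 'y tattr list \<Rightarrow> ro \<Rightarrow> 'y sym list" where
  "strings \<Sigma>s f r = (let sig = concat (map conv_fml \<Sigma>s); qry = conv_fml f in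
     case r of Sig \<Rightarrow> sig | Qry \<Rightarrow> qry | _ \<Rightarrow> replicate (length sig + length qry) Bit1)"

lemma halts_main:
  fixes ts :: "('y::finite) track list"
  assumes ts: "distinct ts" "set ts = UNIV" and n: "n = 3 * card (UNIV :: 'y set)"
    and w: "w = enc_input \<Sigma>s f" and x: "x = length w + magnitude w"
  shows "halts (main ts n) (x * (20 * (x + 1) + 30) + 12 * ((2 * x + 1) * (x + 1)) +
      ltime (length ts) (procedure n :: 'y prog) ((2 * x + 1) * (x + 1)) + 20)
    (conv_state (rev w) 0 0 [] [] (\<lambda>_. []))
    ((\<forall>g\<in>set (\<Sigma>s @ [f]). predictive (fml_of g)) \<and> provable (fml_of ` set \<Sigma>s) (fml_of f))"
    (is "halts _ ?\<tau> _ ?b")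
proof -
  let ?M = "magnitude w"
  let ?sig = "concat (map conv_fml \<Sigma>s)" and ?qry = "conv_fml f"
  let ?N = "length ?sig + length ?qry" and ?X = "(2 * x + 1) * (x + 1)"
  let ?ro = "strings \<Sigma>s f"
  have mag: "nat \<bar>snd t\<bar> \<le> ?M" if "g \<in> set (\<Sigma>s @ [f])" "t \<in> set (fst g) \<union> set (snd g)" for g t
    using term_le_magnitude[of "fst g" "snd g" \<Sigma>s f t] that by (simp add: w)
  have "?N \<le> (2 * ?M + 1) * (length w + 1)"
    using length_conv_input[of \<Sigma>s f ?M, OF mag] by (simp add: w)
  also have "\<dots> \<le> ?X" by (rule mult_le_mono) (simp_all add: x)
  finally have NX: "?N \<le> ?X" .
  have bound: "\<bar>snd t\<bar> \<le> int ?N" if g: "g \<in> set (\<Sigma>s @ [f])" and t: "t \<in> set (fst g) \<union> set (snd g)" for g t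
  proof -
    have "length (conv_fml g) \<le> ?N"
    proof (cases "g = f")
      case False
      then have "length (conv_fml g) \<le> length ?sig" using g by (intro length_le_concat) auto
      then show ?thesis by simp
    qed simp
    then show ?thesis using abs_le_length_conv_fml[OF t] by linarith
  qed
  have 1: "runs (Push (Str Qry True) Semi ;; Push (Tmp 3) Bit1) (1 + 1 + 1) (conv_state (rev w) 0 0 [] [] (\<lambda>_. []))
      (conv_state (rev w) 1 0 [] [] ((\<lambda>_. [])(Qry := [Semi])))"
    by (rule runs_eq[OF runs_Seq[OF runs_Push runs_Push]])
      (auto simp: conv_state_def fun_eq_iff split: var.split)
  let ?out = "(\<lambda>_. [])(Qry := ?qry, Sig := ?sig)"
  have "\<exists>fl. runs (Drain (Tmp 0) conv_step) (length w * (20 * (?M + 1) + 30) + 1)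
    (conv_state (rev w) 1 0 [] [] ((\<lambda>_. [])(Qry := [Semi]))) (conv_state [] 1 0 [] fl ?out)"
    unfolding w
  proof (rule runs_convert)
    fix g t assume "g \<in> set (\<Sigma>s @ [f])" "t \<in> set (fst g) \<union> set (snd g)"
    then show "nat \<bar>snd t\<bar> \<le> magnitude (enc_input \<Sigma>s f) + 1" using mag[of g t] by (simp add: w)
  qed simp
  then obtain fl where 2: "runs (Drain (Tmp 0) conv_step) (length w * (20 * (?M + 1) + 30) + 1)
    (conv_state (rev w) 1 0 [] [] ((\<lambda>_. [])(Qry := [Semi]))) (conv_state [] 1 0 [] fl ?out)"
    by (elim exE) (rule that)
  let ?out1 = "?out(CA := replicate (length ?sig) Bit1, CB := replicate (length ?sig) Bit1)"
  have 3: "runs (clock Sig) (12 * length ?sig + 3) (conv_state [] 1 0 [] fl ?out) (conv_state [] 1 0 [] fl ?out1)"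
    using runs_clock[of Sig ?out fl] by simp
  have ro: "?out1(CA := replicate (length (?out1 Qry)) Bit1 @ ?out1 CA,
      CB := replicate (length (?out1 Qry)) Bit1 @ ?out1 CB) = ?ro"
    by (auto simp: strings_def Let_def fun_eq_iff replicate_add[symmetric] add.commute split: ro.split)
  have qry: "?out1 Qry = ?qry" by simp
  have 4: "runs (clock Qry) (12 * length ?qry + 3) (conv_state [] 1 0 [] fl ?out1) (conv_state [] 1 0 [] fl ?ro)"
    using runs_clock[of Qry ?out1 fl] unfolding ro unfolding qry by simp
  let ?s = "(\<lambda>_ _. False, 0, \<lambda>_. False) :: ('y track, flag) lstate"
  \<comment> \<open>Empty track and flag stacks represent timelines that are false everywhere and
    cleared flags, so the procedure starts without initialisation.\<close>
  have rep: "rep UNIV ?ro (conv_state [] 1 0 [] fl ?ro) ?s"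
    by (simp add: rep_def conv_state_def cell_def getbit_def)
  have len: "length (?ro r) \<le> ?X" for r
    using NX by (cases r) (simp_all add: strings_def Let_def)
  have "\<exists>\<sigma>'. runs (compile ts (procedure n)) (ltime (length ts) (procedure n :: 'y prog) ?X)
      (conv_state [] 1 0 [] fl ?ro) \<sigma>' \<and> rep UNIV ?ro \<sigma>' (leval ?ro (procedure n) ?s) \<and>
      (\<forall>r b. r \<notin> UNIV \<longrightarrow> \<sigma>' (Str r b) = conv_state [] 1 0 [] fl ?ro (Str r b))"
    by (rule runs_compile[OF ts lwf_procedure rep]) (rule len)
  then obtain \<sigma>' where
    5: "runs (compile ts (procedure n)) (ltime (length ts) (procedure n :: 'y prog) ?X)
      (conv_state [] 1 0 [] fl ?ro) \<sigma>'"
    and rep': "rep UNIV ?ro \<sigma>' (leval ?ro (procedure n) ?s)" by (elim exE conjE) (rule that)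
  let ?sat = "saturate (map fml_of \<Sigma>s) (map (\<lambda>i. int i - 2 * int ?N) [0..<4 * ?N + 1]) ^^ (n * ?N)"
  have ro_simps: "?ro Sig = ?sig" "?ro Qry = ?qry" "length (?ro CA) = ?N" "length (?ro CB) = ?N"
    by (simp_all add: strings_def Let_def)
  have "\<exists>T h F. leval ?ro (procedure n) ?s = (T, h, F) \<and> (F Bad \<longleftrightarrow>
      \<not> ((\<forall>g\<in>set (\<Sigma>s @ [f]). predictive (fml_of g)) \<and> set (snd f) \<subseteq> ?sat (set (fst f))))"
    by (rule leval_procedure[OF ro_simps]) (rule bound)
  then obtain T h F where F: "leval ?ro (procedure n) ?s = (T, h, F)" "F Bad \<longleftrightarrow>
      \<not> ((\<forall>g\<in>set (\<Sigma>s @ [f]). predictive (fml_of g)) \<and> set (snd f) \<subseteq> ?sat (set (fst f)))"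
    by (elim exE conjE) (rule that)
  have b: "?b \<longleftrightarrow> \<not> F Bad"
  proof (cases "\<forall>g\<in>set (\<Sigma>s @ [f]). predictive (fml_of g)")
    case True
    have set: "set (map fml_of \<Sigma>s) = fml_of ` set \<Sigma>s" by simp
    have f: "fml_of f = (set (fst f), set (snd f))" by (simp add: fml_of_def)
    have "provable (set (map fml_of \<Sigma>s)) (set (fst f), set (snd f)) \<longleftrightarrow> set (snd f) \<subseteq> ?sat (set (fst f))"
    proof (rule provable_iff_saturate)
      show "predictive (set (fst f), set (snd f))" using True f by simp
      show "{- 2 * int ?N..2 * int ?N} \<subseteq> set (map (\<lambda>i. int i - 2 * int ?N) [0..<4 * ?N + 1])"
      proof
        fix i assume "i \<in> {- 2 * int ?N..2 * int ?N}"
        then have "i = int (nat (i + 2 * int ?N)) - 2 * int ?N" "nat (i + 2 * int ?N) \<in> set [0..<4 * ?N + 1]"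
          by auto
        then show "i \<in> set (map (\<lambda>i. int i - 2 * int ?N) [0..<4 * ?N + 1])"
          unfolding set_map by (rule image_eqI)
      qed
      \<comment> \<open>The converted query contains at least \<open>Arrow\<close> and
        \<open>Semi\<close>. Positivity gives 2 * N + 1 \<le> 3 * N, the origin of the factor 3 in
        \<open>n\<close>.\<close>
      have "1 \<le> ?N" by (simp add: conv_fml_def)
      moreover have "2 * k + 1 \<le> 3 * k" if "1 \<le> k" for k :: nat using that by simp
      ultimately have "2 * ?N + 1 \<le> 3 * ?N" by blast
      then have "card (UNIV :: 'y set) * (2 * ?N + 1) \<le> card (UNIV :: 'y set) * (3 * ?N)"
        by (rule mult_le_mono2)
      then show "card (UNIV :: 'y set) * (2 * ?N + 1) \<le> n * ?N" by (simp only: n ac_simps)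
    next
      fix y e assume "(y, e) \<in> set (fst f) \<union> set (snd f)"
      then show "\<bar>e\<bar> \<le> int ?N" using bound[of f "(y, e)"] by simp
    next
      fix g y e assume "g \<in> set (map fml_of \<Sigma>s)" "(y, e) \<in> fst g"
      then obtain g' where "g' \<in> set \<Sigma>s" "(y, e) \<in> set (fst g')" by (auto simp: fml_of_def)
      then show "\<bar>e\<bar> \<le> int ?N" using bound[of g' "(y, e)"] by simp
    qed (use True in \<open>auto simp: is_fml_def fml_of_def\<close>)
    then show ?thesis using True F(2) unfolding set f by blast
  next
    case False
    then show ?thesis using F(2) by blast
  qed
  have "\<sigma>' (Fl Bad) = (if F Bad then [Bit1] else [])" using rep' by (simp add: F(1) rep_def)
  then have hd_option: "(hd_option (\<sigma>' (Fl Bad)) = None) = ?b" unfolding b by simp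
  have 6: "halts (Pop (Fl Bad) (\<lambda>x. Halt (x = None))) (0 + 1) \<sigma>' ?b"
    by (rule halts_Pop) (simp only: hd_option halts_Halt)
  have "length w * (20 * (?M + 1) + 30) \<le> x * (20 * (x + 1) + 30)"
    by (rule mult_le_mono) (simp_all add: x)
  then show ?thesis unfolding main_def
    by (intro halts_mono[OF halts_Seq[OF 1 halts_Seq[OF 2 halts_Seq[OF runs_Seq[OF 3 4] halts_Seq[OF 5 6]]]]])
      (use NX in linarith)
qed

definition driver_time :: "nat \<Rightarrow> nat \<Rightarrow> ('y::finite) itself \<Rightarrow> nat \<Rightarrow> nat" where
  "driver_time l n _ x = 11 * x + (x * (20 * (x + 1) + 30) + 12 * ((2 * x + 1) * (x + 1)) +
      ltime l (procedure n :: 'y prog) ((2 * x + 1) * (x + 1)) + 20) + 20"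

lemma halts_driver:
  fixes w :: "('y::finite) sym list"
  assumes ts: "distinct ts" "set ts = UNIV" and n: "n = 3 * card (UNIV :: 'y set)"
  shows "halts (driver ts n) (driver_time (length ts) n TYPE('y) (length w + magnitude w))
    ((\<lambda>_. [])(Inp := w)) (w \<in> L_ENT \<inter> L_PRE)"
proof -
  define x where "x = length w + magnitude w"
  let ?t = "x * (20 * (x + 1) + 30) + 12 * ((2 * x + 1) * (x + 1)) +
      ltime (length ts) (procedure n :: 'y prog) ((2 * x + 1) * (x + 1)) + 20"
  let ?p = "fold dfa_option w (Some (Semi, Semi))"
  have 1: "runs (Push (Tmp 1) Semi ;; Push (Tmp 2) Semi) (1 + 1 + 1) ((\<lambda>_. [])(Inp := w))
      (scan_state w [] (Some (Semi, Semi)))"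
    by (rule runs_eq[OF runs_Seq[OF runs_Push runs_Push]])
      (auto simp: scan_state_def fun_eq_iff split: var.split)
  have 2: "runs (Drain Inp scan_step) (11 * length w + 1) (scan_state w [] (Some (Semi, Semi)))
      (scan_state [] (rev w) ?p)"
    using runs_scan[of w "[]"] by simp
  \<comment> \<open>Popping the automaton state leaves only the reversed input. This is the start of
    the conversion with weight 0, that is with an empty \<open>Tmp 3\<close>.\<close>
  have clear: "(scan_state [] (rev w) ?p)(Tmp 1 := tl (scan_state [] (rev w) ?p (Tmp 1)),
      Tmp 2 := tl (((scan_state [] (rev w) ?p)(Tmp 1 := tl (scan_state [] (rev w) ?p (Tmp 1)))) (Tmp 2))) =
      conv_state (rev w) 0 0 [] [] (\<lambda>_. [])"
    by (auto simp: scan_state_def conv_state_def fun_eq_iff split: var.split option.split)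
  have "halts (case hd_option (scan_state [] (rev w) ?p (Tmp 1)) of None \<Rightarrow> Halt False | Some q \<Rightarrow>
       (case hd_option (((scan_state [] (rev w) ?p)(Tmp 1 := tl (scan_state [] (rev w) ?p (Tmp 1)))) (Tmp 2)) of
          None \<Rightarrow> Halt False | Some d \<Rightarrow> if accepting (q, d) then main ts n else Halt False)) ?t
      (conv_state (rev w) 0 0 [] [] (\<lambda>_. [])) (w \<in> L_ENT \<inter> L_PRE)"
  proof (cases "\<exists>\<Sigma>s f. w = enc_input \<Sigma>s f")
    case True
    then obtain p where p: "?p = Some p" "accepting p"
      using dfa_accepts_iff[of w] dfa_accepts_fold[of "(Semi, Semi)" w] by auto
    from True obtain \<Sigma>s f where w: "w = enc_input \<Sigma>s f" by blast
    have L: "w \<in> L_ENT \<inter> L_PRE \<longleftrightarrow>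
      (\<forall>g\<in>set (\<Sigma>s @ [f]). predictive (fml_of g)) \<and> provable (fml_of ` set \<Sigma>s) (fml_of f)"
    proof
      assume "w \<in> L_ENT \<inter> L_PRE"
      then obtain \<Sigma>1 f1 \<Sigma>2 f2 where
        12: "w = enc_input \<Sigma>1 f1" "provable (fml_of ` set \<Sigma>1) (fml_of f1)"
        "w = enc_input \<Sigma>2 f2" "\<forall>g\<in>set \<Sigma>2. predictive (fml_of g)" "predictive (fml_of f2)"
        unfolding L_ENT_def L_PRE_def by blast
      then have "\<Sigma>1 = \<Sigma>s" "f1 = f" "\<Sigma>2 = \<Sigma>s" "f2 = f" using enc_input_inj w by blast+
      then show "(\<forall>g\<in>set (\<Sigma>s @ [f]). predictive (fml_of g)) \<and> provable (fml_of ` set \<Sigma>s) (fml_of f)"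
        using 12 by auto
    next
      assume "(\<forall>g\<in>set (\<Sigma>s @ [f]). predictive (fml_of g)) \<and> provable (fml_of ` set \<Sigma>s) (fml_of f)"
      then have "provable (fml_of ` set \<Sigma>s) (fml_of f)" "\<forall>g\<in>set \<Sigma>s. predictive (fml_of g)"
        "predictive (fml_of f)" by auto
      then show "w \<in> L_ENT \<inter> L_PRE" unfolding L_ENT_def L_PRE_def w by blast
    qed
    have "halts (main ts n) ?t (conv_state (rev w) 0 0 [] [] (\<lambda>_. [])) (w \<in> L_ENT \<inter> L_PRE)"
      unfolding L by (rule halts_main[OF ts n w x_def])
    then show ?thesis using p by (cases p) (simp add: scan_state_def)
  next
    case False
    then have L: "(w \<in> L_ENT \<inter> L_PRE) = False" by (auto simp: L_ENT_def)
    have "?p = None \<or> (\<exists>p. ?p = Some p \<and> \<not> accepting p)"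
      using False dfa_accepts_iff[of w] dfa_accepts_fold[of "(Semi, Semi)" w] by (cases ?p) auto
    moreover have "halts (Halt False) ?t (conv_state (rev w) 0 0 [] [] (\<lambda>_. [])) False"
      by (rule halts_mono[OF halts_Halt]) simp
    ultimately show ?thesis unfolding L by (elim disjE exE conjE) (simp_all add: scan_state_def)
  qed
  then have 3: "halts (Pop (Tmp 1) (\<lambda>q. Pop (Tmp 2) (\<lambda>d. case q of None \<Rightarrow> Halt False | Some q \<Rightarrow>
       (case d of None \<Rightarrow> Halt False | Some d \<Rightarrow> if accepting (q, d) then main ts n else Halt False))))
      (?t + 1 + 1) (scan_state [] (rev w) ?p) (w \<in> L_ENT \<inter> L_PRE)"
    by (intro halts_Pop) (simp only: clear)
  have "length w \<le> x" by (simp add: x_def)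
  then show ?thesis unfolding driver_def driver_time_def x_def[symmetric]
    by (intro halts_mono[OF halts_Seq[OF 1 halts_Seq[OF 2 3]]]) linarith
qed

lemma poly_bounded_driver_time: "poly_bounded (driver_time l n TYPE('y::finite))"
proof -
  have "poly_bounded (\<lambda>x. (2 * x + 1) * (x + 1))" by (intro poly_bounded_intros)
  then have "poly_bounded (\<lambda>x. ltime l (procedure n :: 'y prog) ((2 * x + 1) * (x + 1)))"
    by (rule poly_bounded_compose[OF poly_bounded_ltime])
  then show ?thesis unfolding driver_time_def by (intro poly_bounded_intros)
qed

lemma finite_tracks: "finite (UNIV :: ('y::finite) track set)"
proof -
  have "(UNIV :: 'y track set) \<subseteq> range At \<union> {ME, MF}"
  proof
    fix t :: "'y track"
    show "t \<in> range At \<union> {ME, MF}" by (cases t) simp_all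
  qed
  then show ?thesis by (rule finite_subset) simp
qed

theorem theorem15:
  shows "pseudo_poly_decidable ((L_ENT :: ('y::finite) sym list set) \<inter> L_PRE)"
proof -
  \<comment> \<open>Moving the common head transfers a cell on every track, so the compilation needs
    a list of all tracks.\<close>
  obtain ts :: "'y track list" where ts: "set ts = UNIV" "distinct ts"
    using finite_distinct_list[OF finite_tracks] by blast
  define n where "n = 3 * card (UNIV :: 'y set)"
  show ?thesis
  proof (rule com_decidable[OF poly_bounded_driver_time[of "length ts" n]])
    fix w :: "'y sym list"
    from halts_driver[OF ts(2,1) n_def, of w] obtain t K \<sigma> where
      "t \<le> driver_time (length ts) n TYPE('y) (length w + magnitude w)"
      "(sstep ^^ t) ([driver ts n], (\<lambda>_. [])(Inp := w)) = (Halt (w \<in> L_ENT \<inter> L_PRE) # K, \<sigma>)"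
      unfolding halts_def by blast
    then show "\<exists>t\<le>driver_time (length ts) n TYPE('y) (length w + magnitude w). \<exists>b K \<sigma>.
      (sstep ^^ t) ([driver ts n], (\<lambda>_. [])(Inp := w)) = (Halt b # K, \<sigma>) \<and> (b \<longleftrightarrow> w \<in> L_ENT \<inter> L_PRE)"
      by blast
  qed
qed

end
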